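(* Let $X=(X_t)_{t\ge 0}$ be a Lévy process without positive jumps, such that $\mathbb{E}X_1>0$, and let $\sigma=\sup\{t\ge 0: X_t\le 0\}$ (which is finite a.s.). Then, conditionally on $\sigma$, each of the six random times $\overrightarrow{F}$, $\overleftarrow{F}$, $\overrightarrow{G}$, $\overleftarrow{G}$, $N^-$, $N^+$ is uniformly distributed on $[0,\sigma]$; that is, for each such random time $Y$ and for (almost every, with respect to the law of $\sigma$) $t>0$, $$\mathbb{P}(Y\in dx\mid \sigma=t)=\frac{1}{t}\,\mathbf{1}_{\{x\in[0,t]\}}\,dx.$$
   Context: $X$ is a real-valued Lévy process (càdlàg, $X_0=0$). Write $\overline{X}_t=\sup\{X_s: s\in[0,t]\}$ and $\underline{X}_t=\inf\{X_s: s\in[0,t]\}$ for the running supremum and running infimum. The random times are $$N^-=\int_0^\sigma \mathbf{1}_{\{X_s\le 0\}}\,ds,\qquad N^+=\int_0^\sigma \mathbf{1}_{\{X_s\ge 0\}}\,ds,$$ $$\overrightarrow{F}=\sup\{t\in[0,\sigma): X_t=\underline{X}_t\},\qquad \overrightarrow{G}=\sup\{t\in[0,\sigma): X_t=\overline{X}_t\},$$ $$\overleftarrow{F}=\sigma-\overrightarrow{F},\qquad \overleftarrow{G}=\sigma-\overrightarrow{G}.$$ When $\sigma=0$, all these times are set equal to $0$. *)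

theory Defs
  imports "HOL-Probability.Probability"
begin

definition cadlag :: "(real \<Rightarrow> real) \<Rightarrow> bool" where
  "cadlag x \<longleftrightarrow>
     (\<forall>t\<ge>0. (x \<longlongrightarrow> x t) (at_right t)) \<and>
     (\<forall>t>0. \<exists>l. (x \<longlongrightarrow> l) (at_left t))"

definition jump :: "(real \<Rightarrow> real) \<Rightarrow> real \<Rightarrow> real" where
  "jump x t = x t - Lim (at_left t) x"

text \<open>Processes are total functions of a real time; only their values at times \<open>t \<ge> 0\<close>
  are ever used.  Path properties are required almost surely.\<close>

locale levy_process = prob_space M for M :: "'a measure" +
  fixes X :: "real \<Rightarrow> 'a \<Rightarrow> real"
  assumes measurable_X: "\<And>t. 0 \<le> t \<Longrightarrow> X t \<in> borel_measurable M"
    and start_zero: "AE \<omega> in M. X 0 \<omega> = 0"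
    and cadlag_paths: "AE \<omega> in M. cadlag (\<lambda>t. X t \<omega>)"
    and indep_increments: "\<And>(n::nat) (t::nat \<Rightarrow> real).
          0 \<le> t 0 \<Longrightarrow> (\<And>i. i < n \<Longrightarrow> t i \<le> t (Suc i)) \<Longrightarrow>
          indep_vars (\<lambda>_. borel) (\<lambda>i \<omega>. X (t (Suc i)) \<omega> - X (t i) \<omega>) {..<n}"
    and stationary_increments: "\<And>s t. 0 \<le> s \<Longrightarrow> s \<le> t \<Longrightarrow>
          distr M borel (\<lambda>\<omega>. X t \<omega> - X s \<omega>) = distr M borel (X (t - s))"

definition no_positive_jumps :: "'a measure \<Rightarrow> (real \<Rightarrow> 'a \<Rightarrow> real) \<Rightarrow> bool" where
  "no_positive_jumps M X \<longleftrightarrow> (AE \<omega> in M. \<forall>t>0. jump (\<lambda>s. X s \<omega>) t \<le> 0)"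

definition running_sup :: "(real \<Rightarrow> real) \<Rightarrow> real \<Rightarrow> real" where
  "running_sup x t = (SUP s\<in>{0..t}. x s)"

definition running_inf :: "(real \<Rightarrow> real) \<Rightarrow> real \<Rightarrow> real" where
  "running_inf x t = (INF s\<in>{0..t}. x s)"

definition nonpos_times :: "(real \<Rightarrow> real) \<Rightarrow> real set" where
  "nonpos_times x = {t. 0 \<le> t \<and> x t \<le> 0}"

text \<open>A real supremum, hence meaningful only when \<open>nonpos_times x\<close> is bounded.\<close>

definition sigma_time :: "(real \<Rightarrow> real) \<Rightarrow> real" where
  "sigma_time x = Sup (nonpos_times x)"

definition N_minus :: "(real \<Rightarrow> real) \<Rightarrow> real" where
  "N_minus x = (LINT s:{0..sigma_time x}|lborel. indicator {s. x s \<le> 0} s)"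

definition N_plus :: "(real \<Rightarrow> real) \<Rightarrow> real" where
  "N_plus x = (LINT s:{0..sigma_time x}|lborel. indicator {s. x s \<ge> 0} s)"

definition F_right :: "(real \<Rightarrow> real) \<Rightarrow> real" where
  "F_right x = (if sigma_time x = 0 then 0
     else Sup {t. 0 \<le> t \<and> t < sigma_time x \<and> x t = running_inf x t})"

definition G_right :: "(real \<Rightarrow> real) \<Rightarrow> real" where
  "G_right x = (if sigma_time x = 0 then 0
     else Sup {t. 0 \<le> t \<and> t < sigma_time x \<and> x t = running_sup x t})"

definition F_left :: "(real \<Rightarrow> real) \<Rightarrow> real" where
  "F_left x = sigma_time x - F_right x"

definition G_left :: "(real \<Rightarrow> real) \<Rightarrow> real" where
  "G_left x = sigma_time x - G_right x"

text \<open>The kernel \<open>K\<close> is a regular conditional distribution of \<open>Y\<close> given \<open>S\<close> on the event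
  that \<open>S\<close> lies in \<open>T\<close>, i.e. \<open>P(Y \<in> dx | S = t) = K t (dx)\<close> for almost every \<open>t \<in> T\<close> with
  respect to the law of \<open>S\<close>: for each Borel set \<open>A\<close>, \<open>K (S \<omega>) A\<close> is, on that event, a version of the
  conditional probability of \<open>Y \<in> A\<close> given the sigma-algebra generated by \<open>S\<close>.\<close>

definition cond_distr_on ::
  "'a measure \<Rightarrow> ('a \<Rightarrow> real) \<Rightarrow> ('a \<Rightarrow> real) \<Rightarrow> real set \<Rightarrow> (real \<Rightarrow> real measure) \<Rightarrow> bool" where
  "cond_distr_on M Y S T K \<longleftrightarrow>
     S \<in> borel_measurable M \<and> Y \<in> borel_measurable M \<and>
     (\<forall>A\<in>sets borel. AE \<omega> in M. S \<omega> \<in> T \<longrightarrow>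
        real_cond_exp M (vimage_algebra (space M) S borel) (indicator (Y -` A \<inter> space M)) \<omega>
          = measure (K (S \<omega>)) A)"

end

theory Submission
  imports Defs
begin

text \<open>
  The uniform laws come from a cyclic symmetry of the path before \<open>\<sigma>\<close>, used on a grid and then
  carried to the limit.  Observe \<open>X\<close> on the grid of mesh \<open>2\<^sup>-\<^sup>m\<close> and let \<open>k\<close> be the last index at which
  this random walk is nonpositive.  Whether the last index is \<open>k\<close> depends only on the partial sums of
  order at least \<open>k\<close>, hence is unchanged when the first \<open>k\<close> increments are permuted cyclically, and so
  is the law of the independent, identically distributed increments.  Expectations restricted to
  this event may therefore be replaced by averages over the \<open>k\<close> cyclic shifts of a single sequence.
  Subtract from the walk its chord on \<open>{0..k}\<close> (\<open>bridge\<close>); a cyclic shift of the increments then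
  merely rotates this bridge and lowers it by the value at the new origin (\<open>bridge_cyc\<close>).  When the
  origin runs through all positions, the place of the maximum, or of the minimum, runs through all
  positions as well, and the number of points below the origin is the rank of the value there, so
  it also takes each value once.  Ties are dealt with by bounding from both sides
  (\<open>cyclically_uniform\<close>).  This yields two-sided estimates of expectations (\<open>expectation_bounds\<close>)
  without any conditioning on null events and without Levy bridges.

  As \<open>m\<close> grows, the last nonpositive grid time tends to \<open>\<sigma>\<close>, the walk there tends to \<open>0\<close>, and lower
  and upper discrete functionals tend to \<open>F\<close>, \<open>G\<close> and \<open>N\<^sup>-\<close>, provided that the path is not degenerate
  (\<open>nice_path\<close>): it tends to infinity, has no two local maxima or two local minima at the same height
  and no local minimum at height \<open>0\<close>, is positive at arbitrarily small times, and spends no time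
  at \<open>0\<close>.  The estimates then become an identity, namely that \<open>Y / \<sigma>\<close> is uniform and independent of
  \<open>\<sigma>\<close> on \<open>\<sigma> > 0\<close> (\<open>functional_indep_uniform\<close>), and the conditional law is read off from it.  The
  remaining times are reflections: \<open>\<sigma> - F\<close>, \<open>\<sigma> - G\<close>, and \<open>N\<^sup>+ = \<sigma> - N\<^sup>-\<close> almost surely.

  Almost every path is nice for the following reasons.  The path tends to infinity by the maximal
  ergodic inequality along the integers, and an Ottaviani type inequality between them.  Because
  there are no positive jumps, each level \<open>a \<ge> 0\<close> is attained exactly at its first passage time, where
  the process starts afresh; so a positive probability of spending time at a given height, or of
  staying nonpositive for a while, would force the same behaviour at infinitely many of the levels
  \<open>1 / (i + 1)\<close>, which a path tending to infinity has no room for (\<open>event_null_by_levels\<close>).  That no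
  height is occupied for a positive time excludes, by the Markov property and Fubini's theorem,
  local extrema at a prescribed height and hence at a common height (\<open>tie_null\<close>).
\<close>

section \<open>Cadlag paths\<close>

lemma cadlag_seq_right:
  assumes "cadlag x" "0 \<le> t" "s \<longlonglongrightarrow> t" "\<And>n. t \<le> s n"
  shows "(\<lambda>n. x (s n)) \<longlonglongrightarrow> x t"
proof -
  have "continuous (at_right t) x"
    using assms(1,2) by (simp add: cadlag_def continuous_within)
  then have "(x \<longlongrightarrow> x t) (at t within {t<..})" by (simp add: continuous_within)
  then have "(x \<longlongrightarrow> x t) (at t within {t..})"
    using at_within_Ici_at_right[of t] by simp
  then have "continuous (at t within {t..}) x" by (simp add: continuous_within)
  from continuous_within_tendsto_compose'[OF this _ assms(3)] assms(4) show ?thesis by auto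
qed

lemma cadlag_left:
  assumes "cadlag x" "0 < t"
  shows "(x \<longlongrightarrow> Lim (at_left t) x) (at_left t)"
proof -
  obtain l where l: "(x \<longlongrightarrow> l) (at_left t)" using assms by (auto simp: cadlag_def)
  then have "Lim (at_left t) x = l" by (intro tendsto_Lim) auto
  with l show ?thesis by simp
qed

lemma cadlag_seq_left:
  assumes "cadlag x" "0 < t" "s \<longlonglongrightarrow> t" "\<And>n. s n < t"
  shows "(\<lambda>n. x (s n)) \<longlonglongrightarrow> Lim (at_left t) x"
proof -
  have "filterlim s (at_left t) sequentially"
    using assms(3,4) by (auto simp: filterlim_at intro!: always_eventually)
  from filterlim_compose[OF cadlag_left[OF assms(1,2)] this] show ?thesis .
qed

text \<open>A limit of \<open>x (s n)\<close> for \<open>s n \<longlonglongrightarrow> t\<close> is one of the two one-sided values at \<open>t\<close>.  Compactness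
  arguments for cadlag paths are run with these values in place of continuity.\<close>

definition limit_val :: "(real \<Rightarrow> real) \<Rightarrow> real \<Rightarrow> real \<Rightarrow> bool" where
  "limit_val x t v \<longleftrightarrow> v = x t \<or> (0 < t \<and> v = Lim (at_left t) x)"

lemma cadlag_subseq:
  assumes "cadlag x" "0 \<le> t" "s \<longlonglongrightarrow> t" "\<And>n. 0 \<le> s n"
  shows "\<exists>r v. strict_mono (r::nat\<Rightarrow>nat) \<and> limit_val x t v \<and> (\<lambda>n. x (s (r n))) \<longlonglongrightarrow> v"
proof (cases "infinite {n. t \<le> s n}")
  case True
  obtain r :: "nat \<Rightarrow> nat" where r: "strict_mono r" "\<And>n. r n \<in> {n. t \<le> s n}"
    using infinite_enumerate[OF True] by blast
  have "(\<lambda>n. x (s (r n))) \<longlonglongrightarrow> x t"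
    using r LIMSEQ_subseq_LIMSEQ[OF assms(3) r(1)]
    by (intro cadlag_seq_right[OF assms(1,2), of "\<lambda>n. s (r n)"]) (auto simp: o_def)
  then show ?thesis using r(1) by (auto simp: limit_val_def)
next
  case False
  then have "infinite {n. s n < t}"
    by (metis (mono_tags, lifting) Collect_cong finite_Collect_not infinite_UNIV_nat not_le)
  then obtain r :: "nat \<Rightarrow> nat" where r: "strict_mono r" "\<And>n. r n \<in> {n. s n < t}"
    using infinite_enumerate by blast
  have t: "0 < t" using assms(4)[of "r 0"] r(2)[of 0] by simp
  have "(\<lambda>n. x (s (r n))) \<longlonglongrightarrow> Lim (at_left t) x"
    using r LIMSEQ_subseq_LIMSEQ[OF assms(3) r(1)]
    by (intro cadlag_seq_left[OF assms(1) t, of "\<lambda>n. s (r n)"]) (auto simp: o_def)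
  then show ?thesis using r(1) t by (auto simp: limit_val_def)
qed

lemma cadlag_subseq_compact:
  assumes "cadlag x" "0 \<le> a" "\<And>n. s n \<in> {a..b}"
  shows "\<exists>r t v. strict_mono (r::nat\<Rightarrow>nat) \<and> t \<in> {a..b} \<and> (\<lambda>n. s (r n)) \<longlonglongrightarrow> t \<and> limit_val x t v
           \<and> (\<lambda>n. x (s (r n))) \<longlonglongrightarrow> v"
proof -
  have "compact {a..b}" by simp
  then obtain t r where r: "t \<in> {a..b}" "strict_mono (r::nat\<Rightarrow>nat)" "(s \<circ> r) \<longlonglongrightarrow> t"
    using assms(3) unfolding compact_def by blast
  have s0: "0 \<le> s n" for n using assms(2) assms(3)[of n] by simp
  obtain q v where q: "strict_mono (q::nat\<Rightarrow>nat)" "limit_val x t v" "(\<lambda>n. x ((s\<circ>r) (q n))) \<longlonglongrightarrow> v"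
    using cadlag_subseq[OF assms(1) _ r(3)] r(1) assms(2) s0 by (auto simp: o_def)
  have "(\<lambda>n. s ((r \<circ> q) n)) \<longlonglongrightarrow> t"
    using LIMSEQ_subseq_LIMSEQ[OF r(3) q(1)] by (simp add: o_def)
  then show ?thesis using r q strict_mono_o[OF r(2) q(1)]
    by (intro exI[of _ "r \<circ> q"] exI[of _ t] exI[of _ v]) (auto simp: o_def)
qed

lemma cadlag_bounded:
  assumes "cadlag x" "0 \<le> a"
  shows "\<exists>C. \<forall>s\<in>{a..b}. \<bar>x s\<bar> \<le> C"
proof (rule ccontr)
  assume "\<not> ?thesis"
  then have "\<forall>n::nat. \<exists>s. s \<in> {a..b} \<and> \<bar>x s\<bar> > real n" by (meson not_le)
  then obtain s where s: "\<And>n::nat. s n \<in> {a..b}" "\<And>n::nat. \<bar>x (s n)\<bar> > real n" by metis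
  obtain r v where r: "strict_mono (r::nat\<Rightarrow>nat)" "(\<lambda>n. x (s (r n))) \<longlonglongrightarrow> v"
    using cadlag_subseq_compact[of x a s b, OF assms s(1)] by blast
  have "Bseq (\<lambda>n. x (s (r n)))" using r(2) convergent_imp_Bseq convergentI by blast
  then obtain K where K: "\<And>n. \<bar>x (s (r n))\<bar> \<le> K" by (auto simp: Bseq_def)
  obtain n :: nat where "K < real n" using reals_Archimedean2 by blast
  moreover have "real n \<le> real (r n)" using r(1) by (simp add: seq_suble)
  ultimately show False using K[of n] s(2)[of "r n"] by linarith
qed

lemma limit_val_approx:
  assumes "cadlag x" "0 \<le> t" "limit_val x t v" "0 < e" "0 < \<eta>"
  shows "\<exists>s. 0 \<le> s \<and> t - \<eta> < s \<and> s \<le> t \<and> \<bar>x s - v\<bar> < e"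
proof (cases "v = x t")
  case True then show ?thesis using assms by (intro exI[of _ t]) auto
next
  case False
  then have t: "0 < t" "v = Lim (at_left t) x" using assms(3) by (auto simp: limit_val_def)
  have "\<forall>\<^sub>F s in at_left t. dist (x s) v < e"
    using tendstoD[OF cadlag_left[OF assms(1) t(1)] assms(4)] t by simp
  moreover have "\<forall>\<^sub>F s in at_left t. max 0 (t - \<eta>) < s \<and> s < t"
    unfolding eventually_at_left_field using t assms(5) by (intro exI[of _ "max 0 (t-\<eta>)"]) auto
  ultimately have "\<forall>\<^sub>F s in at_left t. dist (x s) v < e \<and> max 0 (t - \<eta>) < s \<and> s < t"
    by eventually_elim auto
  then obtain s where "dist (x s) v < e" "max 0 (t - \<eta>) < s" "s < t"
    using eventually_happens'[of "at_left t"] by auto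
  then show ?thesis by (intro exI[of _ s]) (auto simp: dist_real_def)
qed

text \<open>Rounding up to the grid of mesh \<open>2\<^sup>-\<^sup>m\<close>: right continuity makes \<open>x (dy m s)\<close> converge to \<open>x s\<close>.\<close>

definition dy :: "nat \<Rightarrow> real \<Rightarrow> real" where "dy m s = real_of_int \<lceil>s * 2 ^ m\<rceil> / 2 ^ m"

lemma dy_ge: "s \<le> dy m s" and dy_less: "dy m s < s + 1 / 2 ^ m"
proof -
  have "s * 2^m \<le> real_of_int \<lceil>s * 2 ^ m\<rceil>" "real_of_int \<lceil>s * 2 ^ m\<rceil> < s * 2^m + 1"
    by linarith+
  then show "s \<le> dy m s" "dy m s < s + 1 / 2 ^ m" by (simp_all add: dy_def field_simps)
qed

lemma dy_tendsto: "(\<lambda>m. dy m s) \<longlonglongrightarrow> s"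
proof (rule tendsto_sandwich[of "\<lambda>m. s" _ _ "\<lambda>m. s + (1/2) ^ m"])
  show "\<forall>\<^sub>F n in sequentially. dy n s \<le> s + (1 / 2) ^ n"
    using dy_less[of _ s] by (auto intro!: always_eventually less_imp_le simp: power_divide)
  have "(\<lambda>n. s + (1 / 2) ^ n) \<longlonglongrightarrow> s + 0"
    by (intro tendsto_intros LIMSEQ_realpow_zero) auto
  then show "(\<lambda>n. s + (1 / 2) ^ n) \<longlonglongrightarrow> s" by simp
qed (auto simp: dy_ge)

lemma cadlag_dy: "cadlag x \<Longrightarrow> 0 \<le> s \<Longrightarrow> (\<lambda>m. x (dy m s)) \<longlonglongrightarrow> x s"
  by (rule cadlag_seq_right) (auto simp: dy_ge dy_tendsto)

lemma rational_sequence_right: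
  assumes "u < (b::real)"
  obtains q :: "nat \<Rightarrow> real" where "\<And>n. q n \<in> \<rat>" "\<And>n. u < q n" "\<And>n. q n < b" "q \<longlonglongrightarrow> u"
proof -
  have "\<exists>q. q \<in> \<rat> \<and> u < q \<and> q < min b (u + 1 / real (Suc n))" for n :: nat
    using Rats_dense_in_real[of u "min b (u + 1 / real (Suc n))"] assms by fastforce
  then obtain q where q: "\<And>n::nat. q n \<in> \<rat>" "\<And>n. u < q n" "\<And>n. q n < min b (u + 1 / real (Suc n))" by metis
  have "(\<lambda>n. u + 1 / real (Suc n)) \<longlonglongrightarrow> u + 0" by (intro tendsto_intros LIMSEQ_Suc[OF lim_1_over_n])
  then have "q \<longlonglongrightarrow> u"
    by (intro tendsto_sandwich[of "\<lambda>n. u" q _ "\<lambda>n. u + 1 / real (Suc n)"]) (use q in \<open>auto intro!: always_eventually simp: less_imp_le\<close>)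
  then show ?thesis using q by (intro that[of q]) auto
qed

lemma limit_val_uminus:
  assumes "cadlag x" shows "limit_val (\<lambda>s. - x s) t (-v) \<longleftrightarrow> limit_val x t v"
proof -
  have "Lim (at_left t) (\<lambda>s. - x s) = - Lim (at_left t) x" if "0 < t"
    using tendsto_minus[OF cadlag_left[OF assms that]] by (intro tendsto_Lim) auto
  then show ?thesis by (auto simp: limit_val_def)
qed

lemma cadlag_affine: assumes "cadlag x" shows "cadlag (\<lambda>t. c * t + a * x t)"
  unfolding cadlag_def
proof (intro conjI allI impI)
  fix t :: real assume "0 \<le> t" then show "((\<lambda>t. c * t + a * x t) \<longlongrightarrow> c * t + a * x t) (at_right t)"
    using assms by (auto simp: cadlag_def intro!: tendsto_intros)
next
  fix t :: real assume "0 < t" then obtain l where "(x \<longlongrightarrow> l) (at_left t)" using assms by (auto simp: cadlag_def)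
  then have "((\<lambda>t. c * t + a * x t) \<longlongrightarrow> c * t + a * l) (at_left t)" by (auto intro!: tendsto_intros)
  then show "\<exists>l. ((\<lambda>t. c * t + a * x t) \<longlongrightarrow> l) (at_left t)" by blast
qed

lemma cadlag_uminus: "cadlag x \<Longrightarrow> cadlag (\<lambda>t. - x t)"
  using cadlag_affine[of x 0 "-1"] by simp

section \<open>Levy processes and the Markov property\<close>

locale cadlag_levy = levy_process +
  assumes all_cadlag: "\<And>\<omega>. cadlag (\<lambda>t. X t \<omega>)"
    and X0 [simp]: "\<And>\<omega>. X 0 \<omega> = 0"

lemma (in cadlag_levy) affine: "cadlag_levy M (\<lambda>t \<omega>. c * t + a * X t \<omega>)"
proof
  show "(\<lambda>\<omega>. c * t + a * X t \<omega>) \<in> borel_measurable M" if "0 \<le> t" for t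
    using measurable_X[OF that] by measurable
  show "AE \<omega> in M. c * 0 + a * X 0 \<omega> = 0" by simp
  show "AE \<omega> in M. cadlag (\<lambda>t. c * t + a * X t \<omega>)"
    by (intro AE_I2 cadlag_affine all_cadlag)
  fix n :: nat and t :: "nat \<Rightarrow> real" assume t: "0 \<le> t 0" "\<And>i. i < n \<Longrightarrow> t i \<le> t (Suc i)"
  have "indep_vars (\<lambda>_. borel) (\<lambda>i \<omega>. (\<lambda>y. c * (t (Suc i) - t i) + a * y) (X (t (Suc i)) \<omega> - X (t i) \<omega>)) {..<n}"
    by (rule indep_vars_compose2[OF indep_increments[OF t]]) auto
  then show "indep_vars (\<lambda>_. borel) (\<lambda>i \<omega>. c * t (Suc i) + a * X (t (Suc i)) \<omega> - (c * t i + a * X (t i) \<omega>)) {..<n}"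
    by (simp add: algebra_simps)
next
  fix s t :: real assume st: "0 \<le> s" "s \<le> t"
  have [measurable]: "X t \<in> borel_measurable M" "X s \<in> borel_measurable M" "X (t - s) \<in> borel_measurable M"
    using st by (auto intro!: measurable_X)
  let ?f = "\<lambda>y::real. c * (t - s) + a * y"
  have "distr M borel (\<lambda>\<omega>. c * t + a * X t \<omega> - (c * s + a * X s \<omega>)) = distr M borel (?f \<circ> (\<lambda>\<omega>. X t \<omega> - X s \<omega>))"
    by (intro distr_cong refl) (simp add: algebra_simps)
  also have "\<dots> = distr (distr M borel (\<lambda>\<omega>. X t \<omega> - X s \<omega>)) borel ?f"
    by (subst distr_distr) auto
  also have "\<dots> = distr (distr M borel (X (t - s))) borel ?f"
    by (simp add: stationary_increments[OF st])
  also have "\<dots> = distr M borel (?f \<circ> X (t - s))" by (subst distr_distr) auto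
  finally show "distr M borel (\<lambda>\<omega>. c * t + a * X t \<omega> - (c * s + a * X s \<omega>)) =
     distr M borel (\<lambda>\<omega>. c * (t - s) + a * X (t - s) \<omega>)" by (simp add: o_def)
next
  show "cadlag (\<lambda>t. c * t + a * X t \<omega>)" for \<omega> by (intro cadlag_affine all_cadlag)
qed simp

lemma sets_Collect_Ball_measurable:
  fixes h :: "'i \<Rightarrow> 'b \<Rightarrow> real"
  assumes "finite I" "\<And>i. i \<in> I \<Longrightarrow> h i \<in> borel_measurable N" "\<And>i. i \<in> I \<Longrightarrow> A i \<in> sets borel"
  shows "{w\<in>space N. \<forall>i\<in>I. h i w \<in> A i} \<in> sets N"
proof (rule sets.sets_Collect_finite_All[OF _ assms(1)])
  fix i assume "i \<in> I"
  have "{w\<in>space N. h i w \<in> A i} = h i -` A i \<inter> space N" by auto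
  then show "{w\<in>space N. h i w \<in> A i} \<in> sets N"
    using measurable_sets[OF assms(2)[OF \<open>i \<in> I\<close>] assms(3)[OF \<open>i \<in> I\<close>]] by simp
qed

context cadlag_levy begin

lemma increments_law:
  assumes t: "0 \<le> t" and u: "0 \<le> u 0" "\<And>i. i < q \<Longrightarrow> u i \<le> u (Suc i)" and q: "0 < q"
  shows "distr M (PiM {..<q} (\<lambda>_. borel)) (\<lambda>\<omega>. \<lambda>k\<in>{..<q}. X (t + u (Suc k)) \<omega> - X (t + u k) \<omega>)
     = PiM {..<q} (\<lambda>k. distr M borel (X (u (Suc k) - u k)))"
proof -
  have pos: "0 \<le> u i" if "i \<le> q" for i
    using that by (induction i) (use u in \<open>auto intro: order_trans\<close>)
  have [measurable]: "X (t + u k) \<in> borel_measurable M" if "k \<le> q" for k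
    using pos[OF that] t by (intro measurable_X) auto
  have "indep_vars (\<lambda>_. borel) (\<lambda>k \<omega>. X (t + u (Suc k)) \<omega> - X (t + u k) \<omega>) {..<q}"
    using indep_increments[of "\<lambda>i. t + u i" q] t u by auto
  then have "distr M (PiM {..<q} (\<lambda>_. borel)) (\<lambda>\<omega>. \<lambda>k\<in>{..<q}. X (t + u (Suc k)) \<omega> - X (t + u k) \<omega>)
      = PiM {..<q} (\<lambda>k. distr M borel (\<lambda>\<omega>. X (t + u (Suc k)) \<omega> - X (t + u k) \<omega>))"
    using q by (subst (asm) indep_vars_iff_distr_eq_PiM') auto
  also have "\<dots> = PiM {..<q} (\<lambda>k. distr M borel (X (u (Suc k) - u k)))"
    using stationary_increments[of "t + u k" "t + u (Suc k)" for k] t u(2) pos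
    by (intro PiM_cong refl) (auto simp: less_imp_le_nat)
  finally show ?thesis .
qed

lemma sorted_times:
  assumes "finite (J::real set)" "\<And>s. s \<in> J \<Longrightarrow> 0 \<le> s" "0 \<in> J" "b \<in> J" "\<And>s. s \<in> J \<Longrightarrow> s \<le> b"
  obtains u n where "u 0 = 0" "\<And>i. i < n \<Longrightarrow> u i \<le> u (Suc i)" "u (n::nat) = b"
    "\<And>s. s \<in> J \<Longrightarrow> \<exists>i\<le>n. u i = s"
proof -
  let ?l = "sorted_list_of_set J"
  have l: "set ?l = J" "sorted ?l" using assms(1) by auto
  have len: "0 < length ?l" using assms(3) l by (metis length_pos_if_in_set)
  define n where "n = length ?l - 1"
  have ex: "\<exists>i\<le>n. ?l ! i = s" if "s \<in> J" for s
    using that l(1) len unfolding n_def by (metis One_nat_def Suc_pred in_set_conv_nth less_Suc_eq_le)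
  show ?thesis
  proof (rule that[of "\<lambda>i. ?l ! i" n])
    show "?l ! i \<le> ?l ! Suc i" if "i < n" for i
      using that l(2) len unfolding n_def by (intro sorted_nth_mono) auto
    obtain i where "i \<le> n" "?l ! i = 0" using ex[OF assms(3)] by blast
    then have "?l ! 0 \<le> 0" using l(2) len unfolding n_def by (metis One_nat_def Suc_pred less_Suc_eq_le sorted_nth_mono zero_le)
    moreover have "0 \<le> ?l ! 0" using l(1) len assms(2) by (metis nth_mem)
    ultimately show "?l ! 0 = 0" by simp
    obtain j where "j \<le> n" "?l ! j = b" using ex[OF assms(4)] by blast
    then have "b \<le> ?l ! n" using l(2) len unfolding n_def
      by (metis One_nat_def diff_less zero_less_one sorted_nth_mono)
    moreover have "?l ! n \<le> b" using l(1) len assms(5) unfolding n_def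
      by (metis One_nat_def diff_less nth_mem zero_less_one)
    ultimately show "?l ! n = b" by simp
  qed (use ex in auto)
qed

text \<open>The times before and after \<open>t\<close> are merged into one increasing sequence; the two events then
  involve disjoint blocks of independent increments, and the second block has the law of the
  increments from time \<open>0\<close>.\<close>

lemma finite_dim_markov:
  assumes t: "0 \<le> t" and I: "finite I" "finite J"
    and f: "\<And>i. i \<in> I \<Longrightarrow> 0 \<le> f i \<and> f i \<le> t" and g: "\<And>j. j \<in> J \<Longrightarrow> 0 \<le> g j"
    and A: "\<And>i. i \<in> I \<Longrightarrow> A i \<in> sets borel" and B: "\<And>j. j \<in> J \<Longrightarrow> B j \<in> sets borel"
  shows "prob {\<omega>\<in>space M. (\<forall>i\<in>I. X (f i) \<omega> \<in> A i) \<and> (\<forall>j\<in>J. X (t + g j) \<omega> - X t \<omega> \<in> B j)}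
    = prob {\<omega>\<in>space M. \<forall>i\<in>I. X (f i) \<omega> \<in> A i} * prob {\<omega>\<in>space M. \<forall>j\<in>J. X (g j) \<omega> \<in> B j}"
proof -
  obtain u p where u: "u 0 = 0" "\<And>i. i < p \<Longrightarrow> u i \<le> u (Suc i)" "u (p::nat) = t"
    "\<And>s. s \<in> f ` I \<union> {0, t} \<Longrightarrow> \<exists>i\<le>p. u i = s"
  proof (rule sorted_times[of "f ` I \<union> {0,t}" t])
    show "finite (f ` I \<union> {0,t})" using I by simp
  qed (use f t in auto)
  define b where "b = Max (g ` J \<union> {0,1})"
  have b: "b \<in> g ` J \<union> {0,1}" "\<And>s. s \<in> g ` J \<union> {0,1} \<Longrightarrow> s \<le> b"
    unfolding b_def using I Max_in[of "g ` J \<union> {0,1}"] Max_ge[of "g ` J \<union> {0,1}"] by blast+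
  obtain v q where v: "v 0 = 0" "\<And>i. i < q \<Longrightarrow> v i \<le> v (Suc i)" "v (q::nat) = b"
    "\<And>s. s \<in> g ` J \<union> {0,1} \<Longrightarrow> \<exists>i\<le>q. v i = s"
  proof (rule sorted_times[of "g ` J \<union> {0,1}" b])
    show "finite (g ` J \<union> {0,1})" using I by simp
    show "s \<le> b" if "s \<in> g ` J \<union> {0,1}" for s using b(2)[OF that] .
  qed (use g b(1) in auto)
  have "1 \<le> b" using b(2)[of 1] by simp
  then have q: "0 < q" using v(1,3) by (cases q) auto
  define tt where "tt = (\<lambda>i. if i \<le> p then u i else t + v (i - p))"
  have tt_p: "tt (p + i) = t + v i" for i using u(3) v(1) by (cases i) (auto simp: tt_def)
  define \<xi> where "\<xi> = (\<lambda>i \<omega>. X (tt (Suc i)) \<omega> - X (tt i) \<omega>)"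
  have mono: "tt i \<le> tt (Suc i)" if "i < p + q" for i
  proof (cases "i < p")
    case True then show ?thesis using u(2) by (auto simp: tt_def)
  next
    case False
    then obtain k where k: "i = p + k" using le_Suc_ex not_less by blast
    show ?thesis using tt_p[of k] tt_p[of "Suc k"] v(2)[of k] that k by simp
  qed
  have ind: "indep_vars (\<lambda>_. borel) \<xi> {..<p + q}"
    unfolding \<xi>_def using mono u(1) by (intro indep_increments) (auto simp: tt_def)
  have m\<xi>: "\<xi> i \<in> borel_measurable M" if "i < p + q" for i
    using ind that by (auto simp: indep_vars_def)
  have "\<forall>i\<in>I. \<exists>k\<le>p. u k = f i" using u(4) by auto
  then obtain a where a: "\<And>i. i \<in> I \<Longrightarrow> a i \<le> p \<and> u (a i) = f i" by metis
  have "\<forall>j\<in>J. \<exists>k\<le>q. v k = g j" using v(4) by auto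
  then obtain c where c: "\<And>j. j \<in> J \<Longrightarrow> c j \<le> q \<and> v (c j) = g j" by metis
  have X1: "X (f i) \<omega> = (\<Sum>k<a i. \<xi> k \<omega>)" if "i \<in> I" for i \<omega>
    unfolding \<xi>_def using a[OF that] u(1) by (subst sum_lessThan_telescope[of "\<lambda>k. X (tt k) \<omega>"]) (auto simp: tt_def)
  have X2: "X (t + g j) \<omega> - X t \<omega> = (\<Sum>k<c j. \<xi> (p + k) \<omega>)" if "j \<in> J" for j \<omega>
    unfolding \<xi>_def using c[OF that] tt_p[of 0] v(1) tt_p
      sum_lessThan_telescope[of "\<lambda>k. X (tt (p + k)) \<omega>" "c j"] by simp
  have X3: "X (g j) \<omega> = (\<Sum>k<c j. X (0 + v (Suc k)) \<omega> - X (0 + v k) \<omega>)" if "j \<in> J" for j \<omega>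
    using c[OF that] v(1) sum_lessThan_telescope[of "\<lambda>k. X (v k) \<omega>" "c j"] by simp
  let ?A1 = "{..<p}" and ?A2 = "{p..<p+q}"
  let ?PA = "PiM ?A1 (\<lambda>_. borel :: real measure)" and ?PB = "PiM ?A2 (\<lambda>_. borel :: real measure)" and ?Q = "PiM {..<q} (\<lambda>_. borel :: real measure)"
  define EA where "EA = {w\<in>space ?PA. \<forall>i\<in>I. (\<Sum>k<a i. w k) \<in> A i}"
  define EB where "EB = {w\<in>space ?PB. \<forall>j\<in>J. (\<Sum>k<c j. w (p + k)) \<in> B j}"
  define EQ where "EQ = {w\<in>space ?Q. \<forall>j\<in>J. (\<Sum>k<c j. w k) \<in> B j}"
  have [measurable]: "EA \<in> sets ?PA" unfolding EA_def
    by (rule sets_Collect_Ball_measurable)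
      (use I(1) A a in \<open>fastforce intro!: borel_measurable_sum measurable_component_singleton\<close>)+
  have [measurable]: "EB \<in> sets ?PB" unfolding EB_def
    by (rule sets_Collect_Ball_measurable)
      (use I(2) B c in \<open>fastforce intro!: borel_measurable_sum measurable_component_singleton\<close>)+
  have [measurable]: "EQ \<in> sets ?Q" unfolding EQ_def
    by (rule sets_Collect_Ball_measurable)
      (use I(2) B c in \<open>fastforce intro!: borel_measurable_sum measurable_component_singleton\<close>)+
  let ?RA = "\<lambda>\<omega>. restrict (\<lambda>i. \<xi> i \<omega>) ?A1" and ?RB = "\<lambda>\<omega>. restrict (\<lambda>i. \<xi> i \<omega>) ?A2"
  have iv: "indep_var ?PA ?RA ?PB ?RB" by (rule indep_var_restrict[OF ind]) auto
  have eA: "?RA -` EA \<inter> space M = {\<omega>\<in>space M. \<forall>i\<in>I. X (f i) \<omega> \<in> A i}"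
  proof -
    have "(\<Sum>k<a i. ?RA \<omega> k) = X (f i) \<omega>" if "i \<in> I" for i \<omega>
      unfolding X1[OF that] using a[OF that] by (intro sum.cong) auto
    then show ?thesis unfolding EA_def by (auto simp: space_PiM simp del: restrict_apply)
  qed
  have eB: "?RB -` EB \<inter> space M = {\<omega>\<in>space M. \<forall>j\<in>J. X (t + g j) \<omega> - X t \<omega> \<in> B j}"
  proof -
    have "(\<Sum>k<c j. ?RB \<omega> (p + k)) = X (t + g j) \<omega> - X t \<omega>" if "j \<in> J" for j \<omega>
      unfolding X2[OF that] using c[OF that] by (intro sum.cong) auto
    then show ?thesis unfolding EB_def by (auto simp: space_PiM simp del: restrict_apply)
  qed
  have joint: "prob {\<omega>\<in>space M. (\<forall>i\<in>I. X (f i) \<omega> \<in> A i) \<and> (\<forall>j\<in>J. X (t + g j) \<omega> - X t \<omega> \<in> B j)}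
     = prob (?RA -` EA \<inter> space M) * prob (?RB -` EB \<inter> space M)"
  proof -
    have "{\<omega>\<in>space M. (\<forall>i\<in>I. X (f i) \<omega> \<in> A i) \<and> (\<forall>j\<in>J. X (t + g j) \<omega> - X t \<omega> \<in> B j)}
      = (\<lambda>x. (?RA x, ?RB x)) -` (EA \<times> EB) \<inter> space M" using eA eB by blast
    then show ?thesis using indep_varD[OF iv, of EA EB] by simp
  qed
  have law: "prob {\<omega>\<in>space M. \<forall>j\<in>J. X (r + g j) \<omega> - X r \<omega> \<in> B j} = measure (PiM {..<q} (\<lambda>k. distr M borel (X (v (Suc k) - v k)))) EQ"
    if r: "0 \<le> r" for r
  proof -
    let ?V = "\<lambda>\<omega>. \<lambda>k\<in>{..<q}. X (r + v (Suc k)) \<omega> - X (r + v k) \<omega>"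
    have pos: "0 \<le> v i" if "i \<le> q" for i
      using that by (induction i) (use v in \<open>auto intro: order_trans\<close>)
    have [measurable]: "?V \<in> measurable M ?Q"
      using pos r by (intro measurable_restrict borel_measurable_diff measurable_X) auto
    have "(\<Sum>k<c j. ?V \<omega> k) = X (r + g j) \<omega> - X r \<omega>" if "j \<in> J" for j \<omega>
    proof -
      have "(\<Sum>k<c j. ?V \<omega> k) = (\<Sum>k<c j. X (r + v (Suc k)) \<omega> - X (r + v k) \<omega>)"
        using c[OF that] by (intro sum.cong) auto
      then show ?thesis using c[OF that] v(1) sum_lessThan_telescope[of "\<lambda>k. X (r + v k) \<omega>" "c j"] by simp
    qed
    then have "?V -` EQ \<inter> space M = {\<omega>\<in>space M. \<forall>j\<in>J. X (r + g j) \<omega> - X r \<omega> \<in> B j}"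
      unfolding EQ_def by (auto simp: space_PiM simp del: restrict_apply)
    then have "prob {\<omega>\<in>space M. \<forall>j\<in>J. X (r + g j) \<omega> - X r \<omega> \<in> B j} = measure (distr M ?Q ?V) EQ"
      by (subst measure_distr) auto
    then show ?thesis using increments_law[of r v q] r v(1,2) q by simp
  qed
  show ?thesis unfolding joint eA eB using law[OF t] law[of 0] by simp
qed

text \<open>Indexing by all reals, with negative times clipped, keeps path space free of restrictions
  to a carrier.\<close>

definition pre :: "real \<Rightarrow> 'a \<Rightarrow> real \<Rightarrow> real" where "pre t \<omega> = (\<lambda>s. X (min (max 0 s) t) \<omega>)"
definition shift :: "real \<Rightarrow> 'a \<Rightarrow> real \<Rightarrow> real" where "shift t \<omega> = (\<lambda>s. X (t + max 0 s) \<omega> - X t \<omega>)"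

end

abbreviation path_space :: "(real \<Rightarrow> real) measure" where "path_space \<equiv> PiM UNIV (\<lambda>_. borel)"

context cadlag_levy begin

lemma pre_measurable [measurable]: "0 \<le> t \<Longrightarrow> pre t \<in> measurable M path_space"
  unfolding pre_def by (intro measurable_PiM_single') (auto intro!: measurable_X)

lemma shift_measurable [measurable]: "0 \<le> t \<Longrightarrow> shift t \<in> measurable M path_space"
  unfolding shift_def by (intro measurable_PiM_single' borel_measurable_diff measurable_X) (auto intro!: measurable_X borel_measurable_diff)

text \<open>Past and future are laid out on the two half lines, so that one comparison of finite-dimensional
  distributions gives both the independence and the stationarity.\<close>

definition past_future :: "real \<Rightarrow> 'a \<Rightarrow> real \<Rightarrow> real" where
  "past_future t \<omega> = (\<lambda>s. if s < 0 then X (min (-s) t) \<omega> else X (t + s) \<omega> - X t \<omega>)"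

definition glued :: "real \<Rightarrow> 'a \<times> 'a \<Rightarrow> real \<Rightarrow> real" where
  "glued t p = (\<lambda>s. if s < 0 then X (min (-s) t) (fst p) else X s (snd p))"

lemma past_future_measurable: "0 \<le> t \<Longrightarrow> past_future t \<in> measurable M path_space"
  unfolding past_future_def
proof (rule measurable_PiM_single')
  fix s assume t: "0 \<le> t"
  show "(\<lambda>\<omega>. if s < 0 then X (min (-s) t) \<omega> else X (t + s) \<omega> - X t \<omega>) \<in> borel_measurable M"
    using t by (cases "s < 0") (auto intro!: measurable_X borel_measurable_diff)
qed auto

lemma glued_measurable: "0 \<le> t \<Longrightarrow> glued t \<in> measurable (M \<Otimes>\<^sub>M M) path_space"
proof -
  assume t: "0 \<le> t"
  have m: "(\<lambda>x. X s (fst x)) \<in> borel_measurable (M \<Otimes>\<^sub>M M)" "(\<lambda>x. X s (snd x)) \<in> borel_measurable (M \<Otimes>\<^sub>M M)" if "0 \<le> s" for s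
    using measurable_X[OF that] by measurable
  show ?thesis unfolding glued_def
  proof (rule measurable_PiM_single')
    fix s show "(\<lambda>p. if s < 0 then X (min (-s) t) (fst p) else X s (snd p)) \<in> borel_measurable (M \<Otimes>\<^sub>M M)"
      using t m by (cases "s < 0") auto
  qed auto
qed

lemma markov_joint:
  assumes t: "0 \<le> t"
  shows "distr M path_space (past_future t) = distr (M \<Otimes>\<^sub>M M) path_space (glued t)"
proof (rule measure_eqI_PiM_infinite)
  interpret P: pair_prob_space M M ..
  note mf = past_future_measurable[OF t] and mg = glued_measurable[OF t]
  show "finite_measure (distr M path_space (past_future t))"
    by (intro prob_space.finite_measure prob_space_distr mf)
  fix A and J :: "real set" assume J: "finite J" and "J \<subseteq> UNIV" and A: "\<And>i. i \<in> J \<Longrightarrow> A i \<in> sets (borel::real measure)"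
  let ?E = "prod_emb UNIV (\<lambda>_. borel) J (Pi\<^sub>E J A)"
  have E: "?E \<in> sets path_space" using J A by (intro sets_PiM_I) auto
  have mem: "w \<in> ?E \<longleftrightarrow> (\<forall>s\<in>J. w s \<in> A s)" for w
    by (auto simp: prod_emb_def PiE_iff)
  define I1 where "I1 = {s\<in>J. s < 0}" define I2 where "I2 = {s\<in>J. \<not> s < 0}"
  have fin: "finite I1" "finite I2" using J by (auto simp: I1_def I2_def)
  let ?S1 = "{\<omega>\<in>space M. \<forall>i\<in>I1. X (min (-i) t) \<omega> \<in> A i}" and ?S2 = "{\<omega>\<in>space M. \<forall>j\<in>I2. X j \<omega> \<in> A j}"
  have S1: "?S1 \<in> sets M"
  proof (rule sets_Collect_Ball_measurable[OF fin(1)])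
    fix i assume "i \<in> I1"
    then show "X (min (-i) t) \<in> borel_measurable M" using t by (intro measurable_X) (auto simp: I1_def)
    show "A i \<in> sets borel" using A \<open>i \<in> I1\<close> by (simp add: I1_def)
  qed
  have S2: "?S2 \<in> sets M"
  proof (rule sets_Collect_Ball_measurable[OF fin(2)])
    fix i assume "i \<in> I2"
    then show "X i \<in> borel_measurable M" by (intro measurable_X) (auto simp: I2_def)
    show "A i \<in> sets borel" using A \<open>i \<in> I2\<close> by (simp add: I2_def)
  qed
  note S = S1 S2
  have "emeasure (distr M path_space (past_future t)) ?E = prob (past_future t -` ?E \<inter> space M)"
    using mf E by (simp add: emeasure_distr emeasure_eq_measure)
  also have "past_future t -` ?E \<inter> space M = {\<omega>\<in>space M. (\<forall>i\<in>I1. X (min (-i) t) \<omega> \<in> A i) \<and> (\<forall>j\<in>I2. X (t + j) \<omega> - X t \<omega> \<in> A j)}"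
    unfolding vimage_def mem I1_def I2_def past_future_def by fastforce
  also have "prob \<dots> = prob ?S1 * prob ?S2"
    using t A fin by (intro finite_dim_markov) (auto simp: I1_def I2_def)
  also have "ennreal \<dots> = emeasure M ?S1 * emeasure M ?S2"
    by (simp add: emeasure_eq_measure ennreal_mult)
  also have "\<dots> = emeasure (M \<Otimes>\<^sub>M M) (?S1 \<times> ?S2)"
    using S by (simp add: emeasure_pair_measure_Times)
  also have "?S1 \<times> ?S2 = glued t -` ?E \<inter> space (M \<Otimes>\<^sub>M M)"
    unfolding vimage_def mem I1_def I2_def glued_def by (fastforce simp: space_pair_measure)
  also have "emeasure (M \<Otimes>\<^sub>M M) \<dots> = emeasure (distr (M \<Otimes>\<^sub>M M) path_space (glued t)) ?E"
    using mg E by (simp add: emeasure_distr)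
  finally show "emeasure (distr M path_space (past_future t)) ?E = emeasure (distr (M \<Otimes>\<^sub>M M) path_space (glued t)) ?E" .
qed auto

lemma markov:
  assumes t: "0 \<le> t"
  shows "distr M (path_space \<Otimes>\<^sub>M path_space) (\<lambda>\<omega>. (pre t \<omega>, shift t \<omega>))
    = distr (M \<Otimes>\<^sub>M M) (path_space \<Otimes>\<^sub>M path_space) (\<lambda>(\<omega>1, \<omega>2). (pre t \<omega>1, shift 0 \<omega>2))"
proof -
  let ?h = "\<lambda>w::real\<Rightarrow>real. (\<lambda>s. w (- max 0 s), \<lambda>s. w (max 0 s))"
  have mh: "?h \<in> measurable path_space (path_space \<Otimes>\<^sub>M path_space)"
    by (intro measurable_Pair measurable_PiM_single') auto
  have 1: "?h (past_future t \<omega>) = (pre t \<omega>, shift t \<omega>)" for \<omega>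
    using t by (auto simp: past_future_def pre_def shift_def fun_eq_iff max_def)
  have 2: "?h (glued t x) = (case x of (\<omega>1, \<omega>2) \<Rightarrow> (pre t \<omega>1, shift 0 \<omega>2))" for x
    using t by (cases x) (auto simp: glued_def pre_def shift_def fun_eq_iff max_def)
  have "distr (distr M path_space (past_future t)) (path_space \<Otimes>\<^sub>M path_space) ?h
     = distr (distr (M \<Otimes>\<^sub>M M) path_space (glued t)) (path_space \<Otimes>\<^sub>M path_space) ?h"
    using markov_joint[OF t] by simp
  then show ?thesis
    unfolding distr_distr[OF mh past_future_measurable[OF t]] distr_distr[OF mh glued_measurable[OF t]] o_def 1 2 .
qed

text \<open>After the time \<open>t\<close> the path may be replaced by an independent copy \<open>snd x\<close> of the process.\<close>

lemma markov_pair: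
  assumes t: "0 \<le> t" and E: "E \<in> sets (path_space \<Otimes>\<^sub>M path_space)"
  shows "prob {\<omega>\<in>space M. (pre t \<omega>, shift t \<omega>) \<in> E}
      = measure (M \<Otimes>\<^sub>M M) {x\<in>space (M \<Otimes>\<^sub>M M). (pre t (fst x), shift 0 (snd x)) \<in> E}"
proof -
  have m: "(\<lambda>\<omega>. (pre t \<omega>, shift t \<omega>)) \<in> measurable M (path_space \<Otimes>\<^sub>M path_space)"
    "(\<lambda>(\<omega>1, \<omega>2). (pre t \<omega>1, shift 0 \<omega>2)) \<in> measurable (M \<Otimes>\<^sub>M M) (path_space \<Otimes>\<^sub>M path_space)"
    using t by measurable
  have 1: "(\<lambda>\<omega>. (pre t \<omega>, shift t \<omega>)) -` E \<inter> space M = {\<omega>\<in>space M. (pre t \<omega>, shift t \<omega>) \<in> E}"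
    by auto
  have 2: "(\<lambda>(\<omega>1, \<omega>2). (pre t \<omega>1, shift 0 \<omega>2)) -` E \<inter> space (M \<Otimes>\<^sub>M M)
      = {x\<in>space (M \<Otimes>\<^sub>M M). (pre t (fst x), shift 0 (snd x)) \<in> E}"
    by auto
  show ?thesis
    using arg_cong[OF markov[OF t], of "\<lambda>N. measure N E"]
    unfolding measure_distr[OF m(1) E] measure_distr[OF m(2) E] 1 2 .
qed

lemma markov_rect:
  assumes t: "0 \<le> t" and E: "A \<in> sets path_space" "B \<in> sets path_space"
  shows "prob {\<omega>\<in>space M. pre t \<omega> \<in> A \<and> shift t \<omega> \<in> B}
      = prob {\<omega>\<in>space M. pre t \<omega> \<in> A} * prob {\<omega>\<in>space M. shift 0 \<omega> \<in> B}"
proof -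
  interpret P: pair_prob_space M M ..
  have S: "{\<omega>\<in>space M. pre t \<omega> \<in> A} \<in> sets M" "{\<omega>\<in>space M. shift 0 \<omega> \<in> B} \<in> sets M"
    using t E by measurable
  have "prob {\<omega>\<in>space M. pre t \<omega> \<in> A \<and> shift t \<omega> \<in> B} =
    measure (M \<Otimes>\<^sub>M M) {x\<in>space (M \<Otimes>\<^sub>M M). (pre t (fst x), shift 0 (snd x)) \<in> A \<times> B}"
    using markov_pair[OF t, of "A \<times> B"] E by simp
  also have "{x\<in>space (M \<Otimes>\<^sub>M M). (pre t (fst x), shift 0 (snd x)) \<in> A \<times> B}
     = {\<omega>\<in>space M. pre t \<omega> \<in> A} \<times> {\<omega>\<in>space M. shift 0 \<omega> \<in> B}"
    by (auto simp: space_pair_measure)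
  also have "measure (M \<Otimes>\<^sub>M M) \<dots> = prob {\<omega>\<in>space M. pre t \<omega> \<in> A} * prob {\<omega>\<in>space M. shift 0 \<omega> \<in> B}"
    using S by (simp add: emeasure_pair_measure_Times measure_def enn2real_mult)
  finally show ?thesis .
qed

end

section \<open>Drift to infinity\<close>

lemma restrict_UNIV [simp]: "restrict f UNIV = f"
  by (simp add: restrict_def)

lemma sets_Collect_countable_Ball_on:
  assumes "countable J" "\<And>i. i \<in> J \<Longrightarrow> {w\<in>space N. P i w} \<in> sets N"
  shows "{w\<in>space N. \<forall>i\<in>J. P i w} \<in> sets N"
proof -
  have "{w\<in>space N. \<forall>i\<in>J. P i w} = space N - (\<Union>i\<in>J. space N - {w\<in>space N. P i w})" by auto
  also have "\<dots> \<in> sets N"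
    using assms by (intro sets.Diff sets.top sets.countable_UN'') auto
  finally show ?thesis .
qed

text \<open>Garsia's argument for the maximal ergodic inequality.  Let \<open>A\<close> be the event that the partial
  sums are unbounded above.  It is invariant under the shift \<open>\<theta>\<close>, so integrating
  \<open>w 0 \<ge> H n w - H n (\<theta> w)\<close>, valid where the running maximum \<open>H n\<close> is positive, over \<open>A\<close> gives a nonnegative
  integral of \<open>w 0\<close> over \<open>A\<close>.  But \<open>A\<close> is also independent of \<open>w 0\<close>, so this integral is the negative
  mean times the probability of \<open>A\<close>.\<close>

lemma random_walk_bdd_above:
  fixes \<mu> :: "real measure"
  assumes "prob_space \<mu>" and [measurable_cong]: "sets \<mu> = sets borel"
    and int: "integrable \<mu> (\<lambda>x. x)" and neg: "(\<integral>x. x \<partial>\<mu>) < 0"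
  shows "AE w in PiM (UNIV::nat set) (\<lambda>_. \<mu>). bdd_above (range (\<lambda>n. \<Sum>i<n. w i))"
proof -
  interpret prob_space \<mu> by fact
  interpret sequence_space \<mu> ..
  define P where "P = PiM (UNIV::nat set) (\<lambda>_. \<mu>)"
  have pP: "prob_space P" unfolding P_def by (intro prob_space_PiM assms)
  interpret SS: prob_space P by fact
  have sP[measurable_cong]: "sets P = sets (PiM UNIV (\<lambda>_. borel))"
    unfolding P_def by (intro sets_PiM_cong refl) (simp add: assms)
  have space[simp]: "space P = UNIV" using sets_eq_imp_space_eq[OF sP] by (simp add: space_PiM)
  define S where "S = (\<lambda>n (w::nat \<Rightarrow> real). \<Sum>i<n. w i)"
  define \<theta> where "\<theta> = (\<lambda>w::nat\<Rightarrow>real. \<lambda>i. w (Suc i))"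
  have [measurable]: "(\<lambda>w. w i) \<in> borel_measurable P" for i by measurable
  have [measurable]: "S n \<in> borel_measurable P" for n unfolding S_def by measurable
  have [measurable]: "\<theta> \<in> measurable P P"
  proof -
    have "\<theta> \<in> measurable P (PiM UNIV (\<lambda>_. borel))"
      unfolding \<theta>_def by (intro measurable_PiM_single') auto
    then show ?thesis using sP by (simp cong: measurable_cong_sets)
  qed
  have \<theta>P: "distr P P \<theta> = P"
  proof -
    have "distr (PiM UNIV (\<lambda>_. \<mu>)) (PiM UNIV (\<lambda>_. \<mu>)) (\<lambda>w. \<lambda>n\<in>UNIV. w (Suc n)) = PiM (UNIV::nat set) (\<lambda>_. \<mu>)"
      by (rule distr_PiM_reindex) (auto intro: assms)
    then show ?thesis by (simp add: P_def \<theta>_def)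
  qed
  have S_Suc: "S (Suc n) w = w 0 + S n (\<theta> w)" for n w
    unfolding S_def \<theta>_def by (rule sum.lessThan_Suc_shift)
  define A where "A = {w. \<not> bdd_above (range (\<lambda>n. S n w))}"
  have Aeq: "A = {w\<in>space P. \<forall>k::nat. \<exists>n. real k < S n w}"
    unfolding A_def bdd_above_def
    by (auto simp: not_le) (meson less_le_trans not_le reals_Archimedean2 less_imp_le)+
  have [measurable]: "A \<in> sets P" unfolding Aeq by measurable
  have A_\<theta>: "\<theta> w \<in> A \<longleftrightarrow> w \<in> A" for w
  proof -
    have 1: "range (\<lambda>n. S n w) = insert 0 ((\<lambda>n. w 0 + S n (\<theta> w)) ` UNIV)"
    proof (intro set_eqI iffI)
      fix y assume "y \<in> range (\<lambda>n. S n w)" then obtain n where "y = S n w" by auto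
      then show "y \<in> insert 0 ((\<lambda>n. w 0 + S n (\<theta> w)) ` UNIV)"
      proof (cases n)
        case 0 with \<open>y = S n w\<close> show ?thesis by (simp add: S_def)
      next
        case (Suc k) with \<open>y = S n w\<close> show ?thesis by (simp add: S_Suc)
      qed
    next
      fix y assume "y \<in> insert 0 ((\<lambda>n. w 0 + S n (\<theta> w)) ` UNIV)"
      then show "y \<in> range (\<lambda>n. S n w)"
      proof
        assume "y = 0" then have "y = S 0 w" by (simp add: S_def) then show ?thesis by blast
      next
        assume "y \<in> (\<lambda>n. w 0 + S n (\<theta> w)) ` UNIV"
        then obtain n where "y = S (Suc n) w" by (auto simp: S_Suc) then show ?thesis by blast
      qed
    qed
    have "bdd_above (range (\<lambda>n. S n w)) \<longleftrightarrow> bdd_above (range (\<lambda>n. S n (\<theta> w)))"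
      unfolding 1 bdd_above_insert
    proof
      assume "bdd_above (range (\<lambda>n. w 0 + S n (\<theta> w)))"
      then obtain K where "\<And>n. w 0 + S n (\<theta> w) \<le> K" by (auto simp: bdd_above_def)
      then show "bdd_above (range (\<lambda>n. S n (\<theta> w)))" by (intro bdd_aboveI[of _ "K - w 0"]) (auto simp: algebra_simps)
    next
      assume "bdd_above (range (\<lambda>n. S n (\<theta> w)))"
      then obtain K where "\<And>n. S n (\<theta> w) \<le> K" by (auto simp: bdd_above_def)
      then show "bdd_above (range (\<lambda>n. w 0 + S n (\<theta> w)))" by (intro bdd_aboveI[of _ "w 0 + K"]) auto
    qed
    then show ?thesis by (simp add: A_def)
  qed
  define H where "H = (\<lambda>n w. Max ((\<lambda>k. S k w) ` {..n}))"
  have [measurable]: "H n \<in> borel_measurable P" for n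
    unfolding H_def by (intro borel_measurable_Max) (auto simp: S_def)
  have H_ge: "S k w \<le> H n w" if "k \<le> n" for k n w
    unfolding H_def using that by (intro Max_ge) auto
  have H0: "0 \<le> H n w" for n w using H_ge[of 0 n w] by (simp add: S_def)
  have H_ex: "\<exists>k\<le>n. H n w = S k w" for n w
  proof -
    have "H n w \<in> (\<lambda>k. S k w) ` {..n}" unfolding H_def by (rule Max_in) auto
    then show ?thesis by auto
  qed
  have key: "H n w - H n (\<theta> w) \<le> w 0 * indicator {w. 0 < H n w} w" for n w
  proof (cases "0 < H n w")
    case True
    obtain k where k: "k \<le> n" "H n w = S k w" using H_ex by blast
    have "k \<noteq> 0" using True k by (cases k) (auto simp: S_def)
    then obtain l where l: "k = Suc l" by (cases k) auto
    have "H n w \<le> w 0 + H n (\<theta> w)" unfolding k(2) l S_Suc using k(1) l H_ge[of l n "\<theta> w"] by simp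
    then show ?thesis using True by simp
  next
    case False then show ?thesis using H0[of n "\<theta> w"] H0[of n w] by simp
  qed
  have intw: "integrable P (\<lambda>w. w i)" for i
  proof -
    have "integrable (distr P \<mu> (\<lambda>w. w i)) (\<lambda>x. x)"
      using PiM_component[of i] int by (simp add: P_def)
    then show ?thesis using borel_measurable_integrable[OF int] by (subst (asm) integrable_distr_eq) (auto simp: P_def)
  qed
  have intH: "integrable P (H n)" for n
  proof (rule Bochner_Integration.integrable_bound)
    show "integrable P (\<lambda>w. \<Sum>i<n. \<bar>w i\<bar>)" using intw by auto
    have "\<bar>H n w\<bar> \<le> (\<Sum>i<n. \<bar>w i\<bar>)" for w
    proof -
      obtain k where k: "k \<le> n" "H n w = S k w" using H_ex by blast
      have "\<bar>S k w\<bar> \<le> (\<Sum>i<k. \<bar>w i\<bar>)" unfolding S_def by (rule sum_abs)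
      also have "\<dots> \<le> (\<Sum>i<n. \<bar>w i\<bar>)" using k by (intro sum_mono2) auto
      finally show ?thesis using k by simp
    qed
    then show "AE w in P. norm (H n w) \<le> norm (\<Sum>i<n. \<bar>w i\<bar>)"
      by (auto intro!: AE_I2 order_trans[OF _ abs_ge_self])
  qed auto
  have intAH: "integrable P (\<lambda>w. indicator A w * H n w)" for n
    using integrable_real_mult_indicator[OF _ intH, of A] by (simp add: mult.commute)
  have intH\<theta>: "integrable P (\<lambda>w. indicator A (\<theta> w) * H n (\<theta> w))"
      "(\<integral>w. indicator A (\<theta> w) * H n (\<theta> w) \<partial>P) = (\<integral>w. indicator A w * H n w \<partial>P)" for n
  proof -
    have "integrable (distr P P \<theta>) (\<lambda>w. indicator A w * H n w)" using \<theta>P intAH by simp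
    then show "integrable P (\<lambda>w. indicator A (\<theta> w) * H n (\<theta> w))"
      by (subst (asm) integrable_distr_eq) auto
    have "(\<integral>w. indicator A w * H n w \<partial>distr P P \<theta>) = (\<integral>w. indicator A (\<theta> w) * H n (\<theta> w) \<partial>P)"
      by (subst integral_distr) auto
    then show "(\<integral>w. indicator A (\<theta> w) * H n (\<theta> w) \<partial>P) = (\<integral>w. indicator A w * H n w \<partial>P)"
      using \<theta>P by simp
  qed
  have pos: "0 \<le> (\<integral>w. indicator A w * (w 0 * indicator {w. 0 < H n w} w) \<partial>P)" for n
  proof -
    have "0 = (\<integral>w. indicator A w * H n w \<partial>P) - (\<integral>w. indicator A (\<theta> w) * H n (\<theta> w) \<partial>P)"
      by (simp add: intH\<theta>)
    also have "\<dots> = (\<integral>w. indicator A w * H n w - indicator A (\<theta> w) * H n (\<theta> w) \<partial>P)"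
      using intAH intH\<theta> by simp
    also have "\<dots> \<le> (\<integral>w. indicator A w * (w 0 * indicator {w. 0 < H n w} w) \<partial>P)"
    proof (rule integral_mono)
      show "integrable P (\<lambda>w. indicator A w * (w 0 * indicator {w. 0 < H n w} w))"
        by (rule Bochner_Integration.integrable_bound[OF intw[of 0]]) (auto simp: indicator_def)
      show "indicator A w * H n w - indicator A (\<theta> w) * H n (\<theta> w) \<le> indicator A w * (w 0 * indicator {w. 0 < H n w} w)" for w
        using key[of n w] A_\<theta>[of w] by (auto simp: indicator_def)
    qed (use intAH intH\<theta> in auto)
    finally show ?thesis .
  qed
  have lim: "(\<lambda>n. \<integral>w. indicator A w * (w 0 * indicator {w. 0 < H n w} w) \<partial>P) \<longlonglongrightarrow> (\<integral>w. indicator A w * w 0 \<partial>P)"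
  proof (rule integral_dominated_convergence[where w="\<lambda>w. \<bar>w 0\<bar>"])
    show "AE w in P. (\<lambda>n. indicator A w * (w 0 * indicator {w. 0 < H n w} w)) \<longlonglongrightarrow> indicator A w * w 0"
    proof (rule AE_I2)
      fix w show "(\<lambda>n. indicator A w * (w 0 * indicator {w. 0 < H n w} w)) \<longlonglongrightarrow> indicator A w * w 0"
      proof (cases "w \<in> A")
        case True
        then obtain n0 where n0: "real 0 < S n0 w" unfolding Aeq by blast
        have "\<forall>\<^sub>F n in sequentially. indicator A w * (w 0 * indicator {w. 0 < H n w} w) = indicator A w * w 0"
          using eventually_ge_at_top[of n0]
        proof eventually_elim
          case (elim n) then show ?case using H_ge[of n0 n w] n0 by simp
        qed
        then show ?thesis by (rule tendsto_eventually)
      qed simp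
    qed
  qed (use intw in \<open>auto simp: indicator_def\<close>)
  have "0 \<le> (\<integral>w. indicator A w * w 0 \<partial>P)"
    using LIMSEQ_le_const[OF lim] pos by blast
  also have "(\<integral>w. indicator A w * w 0 \<partial>P) = (\<integral>x. x \<partial>\<mu>) * SS.prob A"
  proof -
    interpret Q: pair_prob_space \<mu> P ..
    have it: "distr (\<mu> \<Otimes>\<^sub>M P) P (\<lambda>(s, \<omega>). case_nat s \<omega>) = P"
      using PiM_iter by (simp add: P_def)
    have mc[measurable]: "(\<lambda>(s, \<omega>). case_nat s \<omega>) \<in> measurable (\<mu> \<Otimes>\<^sub>M P) P"
      unfolding P_def by measurable
    have cA: "case_nat s \<omega> \<in> A \<longleftrightarrow> \<omega> \<in> A" for s \<omega>
      using A_\<theta>[of "case_nat s \<omega>"] by (simp add: \<theta>_def)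
    have "integrable P (\<lambda>w. indicator A w * w 0)"
      by (rule Bochner_Integration.integrable_bound[OF intw[of 0]]) (auto simp: indicator_def)
    then have "integrable (distr (\<mu> \<Otimes>\<^sub>M P) P (\<lambda>(s, \<omega>). case_nat s \<omega>)) (\<lambda>w. indicator A w * w 0)" by (simp add: it)
    then have i2: "integrable (\<mu> \<Otimes>\<^sub>M P) (\<lambda>(s,\<omega>). indicator A \<omega> * s)"
      by (subst (asm) integrable_distr_eq) (auto simp: case_prod_unfold indicator_def cA)
    have "(\<integral>w. indicator A w * w 0 \<partial>P) = (\<integral>w. indicator A w * w 0 \<partial>distr (\<mu> \<Otimes>\<^sub>M P) P (\<lambda>(s, \<omega>). case_nat s \<omega>))"
      by (simp add: it)
    also have "\<dots> = (\<integral>(s,\<omega>). indicator A \<omega> * s \<partial>(\<mu> \<Otimes>\<^sub>M P))"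
      by (subst integral_distr) (auto simp: case_prod_unfold indicator_def cA)
    also have "\<dots> = (\<integral>s. (\<integral>\<omega>. indicator A \<omega> * s \<partial>P) \<partial>\<mu>)"
      using Q.integral_fst'[OF i2] by simp
    finally show ?thesis by (simp add: mult.commute)
  qed
  finally have "SS.prob A = 0" using neg
    by (metis measure_nonneg mult_less_0_iff not_le order_le_less)
  then have "AE w in P. w \<notin> A" by (subst SS.prob_eq_0[symmetric]) auto
  then show ?thesis unfolding A_def S_def P_def[symmetric] by simp
qed

context cadlag_levy begin

lemma indep_grid:
  assumes "0 < \<delta>"
  shows "indep_vars (\<lambda>_. borel) (\<lambda>i \<omega>. X (\<delta> * real (Suc i)) \<omega> - X (\<delta> * real i) \<omega>) (UNIV::nat set)"
proof -
  let ?\<xi> = "\<lambda>i \<omega>. X (\<delta> * real (Suc i)) \<omega> - X (\<delta> * real i) \<omega>"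
  have fin: "indep_vars (\<lambda>_. borel) ?\<xi> {..<n}" for n
    using indep_increments[of "\<lambda>i. \<delta> * real i" n] assms by auto
  show ?thesis unfolding indep_vars_def2
  proof (intro conjI ballI)
    show "?\<xi> i \<in> borel_measurable M" for i using fin[of "Suc i"] by (auto simp: indep_vars_def)
    show "indep_sets (\<lambda>i. {?\<xi> i -` A \<inter> space M |A. A \<in> sets borel}) UNIV"
    proof (subst indep_sets_finite_index_sets, intro allI impI)
      fix J :: "nat set" assume J: "finite J"
      then have "J \<subseteq> {..<Suc (Max J)}" by (auto simp: less_Suc_eq_le)
      then show "indep_sets (\<lambda>i. {?\<xi> i -` A \<inter> space M |A. A \<in> sets borel}) J"
        using fin[of "Suc (Max J)"] unfolding indep_vars_def2 by (auto intro: indep_sets_mono_index)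
    qed
  qed
qed

lemma grid_measurable [measurable]: "0 \<le> t \<Longrightarrow> X t \<in> borel_measurable M" by (rule measurable_X)

lemma iid_grid:
  assumes "0 < \<delta>"
  shows "distr M (PiM UNIV (\<lambda>_::nat. borel)) (\<lambda>\<omega> i. X (\<delta> * real (Suc i)) \<omega> - X (\<delta> * real i) \<omega>)
    = PiM UNIV (\<lambda>_. distr M borel (X \<delta>))"
proof -
  have m: "(\<lambda>\<omega>. X (\<delta> * real (Suc i)) \<omega> - X (\<delta> * real i) \<omega>) \<in> borel_measurable M" for i
    using assms by (intro borel_measurable_diff measurable_X) auto
  have "distr M borel (\<lambda>\<omega>. X (\<delta> * real (Suc i)) \<omega> - X (\<delta> * real i) \<omega>) = distr M borel (X \<delta>)" for i
    using stationary_increments[of "\<delta> * real i" "\<delta> * real (Suc i)"] assms by (simp add: algebra_simps)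
  then show ?thesis
    using indep_grid[OF assms] indep_vars_iff_distr_eq_PiM[where I=UNIV and M'="\<lambda>_. borel" and X="\<lambda>i \<omega>. X (\<delta> * real (Suc i)) \<omega> - X (\<delta> * real i) \<omega>", OF _ m] by simp
qed

text \<open>Ottaviani's inequality: at the first grid time above \<open>a + b\<close> the process starts afresh, and with
  probability at least \<open>1/2\<close> it falls by at most \<open>b\<close> until the next integer.  Hence exceeding \<open>a + b\<close> on
  some grid is at most twice as likely as exceeding \<open>a\<close> at an integer, uniformly in the grid.\<close>

lemma bdd_above_from_integers:
  assumes "AE \<omega> in M. bdd_above (range (\<lambda>n. X (real n) \<omega>))"
  shows "AE \<omega> in M. bdd_above ((\<lambda>t. X t \<omega>) ` {0..})"
proof -
  define p where "p = (\<lambda>a. prob {\<omega>\<in>space M. \<exists>n. a \<le> X (real n) \<omega>})"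
  have [measurable]: "{\<omega>\<in>space M. \<exists>n. a \<le> X (real n) \<omega>} \<in> sets M" for a :: real by measurable
  have p0: "(\<lambda>k. p (real k)) \<longlonglongrightarrow> 0"
  proof -
    let ?E = "\<lambda>k::nat. {\<omega>\<in>space M. \<exists>n. real k \<le> X (real n) \<omega>}"
    have "(\<lambda>k. prob (?E k)) \<longlonglongrightarrow> prob (\<Inter>k. ?E k)"
      by (intro finite_Lim_measure_decseq) (auto simp: decseq_def, meson of_nat_mono order_trans)
    moreover have "AE \<omega> in M. \<omega> \<notin> (\<Inter>k. ?E k)"
      using assms
    proof eventually_elim
      case (elim \<omega>)
      then obtain K where K: "\<And>n. X (real n) \<omega> \<le> K" by (auto simp: bdd_above_def)
      obtain k :: nat where "K < real k" using reals_Archimedean2 by blast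
      then have "\<omega> \<notin> ?E k" using K by (auto simp: not_le intro: le_less_trans)
      then show ?case by blast
    qed
    then have "prob (\<Inter>k. ?E k) = 0" by (subst prob_eq_0) auto
    ultimately show ?thesis by (simp add: p_def)
  qed
  \<comment> \<open>cadlag paths are bounded on \<open>{0..1}\<close>, so a large \<open>b\<close> will do\<close>
  obtain b where b: "\<And>q. q \<in> \<rat> \<inter> {0..1} \<Longrightarrow> 1/2 \<le> prob {\<omega>\<in>space M. - b \<le> X q \<omega>}"
  proof -
    let ?G = "\<lambda>k::nat. {\<omega>\<in>space M. \<forall>q\<in>\<rat> \<inter> {0..1}. - real k \<le> X q \<omega>}"
    have G[measurable]: "?G k \<in> sets M" for k
    proof (rule sets_Collect_countable_Ball_on)
      show "countable (\<rat> \<inter> {0..1::real})" using countable_rat by blast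
      show "{\<omega>\<in>space M. - real k \<le> X q \<omega>} \<in> sets M" if "q \<in> \<rat> \<inter> {0..1}" for q
        using measurable_X[of q] that by auto
    qed
    have "(\<lambda>k. prob (?G k)) \<longlonglongrightarrow> prob (\<Union>k. ?G k)"
    proof (intro finite_Lim_measure_incseq incseq_SucI)
      fix k show "?G k \<subseteq> ?G (Suc k)" by force
    qed (use G in blast)
    moreover have "(\<Union>k. ?G k) = space M"
    proof (intro equalityI subsetI)
      fix \<omega> assume w: "\<omega> \<in> space M"
      obtain C where C: "\<And>s. s \<in> {0..1} \<Longrightarrow> \<bar>X s \<omega>\<bar> \<le> C" using cadlag_bounded[OF all_cadlag[of \<omega>], of 0 1] by blast
      obtain k :: nat where "C < real k" using reals_Archimedean2 by blast
      then have "\<omega> \<in> ?G k" using C w by (auto simp: abs_le_iff) (smt (verit))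
      then show "\<omega> \<in> (\<Union>k. ?G k)" by blast
    qed auto
    ultimately have "(\<lambda>k. prob (?G k)) \<longlonglongrightarrow> 1" by (simp add: prob_space)
    then have "\<forall>\<^sub>F k in sequentially. 1/2 < prob (?G k)" by (rule order_tendstoD) simp
    then obtain k where k: "1/2 < prob (?G k)" using eventually_happens'[of sequentially] by auto
    have "1/2 \<le> prob {\<omega>\<in>space M. - real k \<le> X q \<omega>}" if q: "q \<in> \<rat> \<inter> {0..1}" for q
    proof -
      have "prob (?G k) \<le> prob {\<omega>\<in>space M. - real k \<le> X q \<omega>}"
        using q measurable_X[of q] by (intro finite_measure_mono) auto
      then show ?thesis using k by simp
    qed
    then show ?thesis by (rule that)
  qed
  define D where "D = (\<lambda>a m. {\<omega>\<in>space M. \<exists>j::nat. a + b < X (real j / 2 ^ m) \<omega>})"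
  have [measurable]: "D a m \<in> sets M" for a m unfolding D_def by measurable
  have bound: "emeasure M (D a m) \<le> 2 * ennreal (p a)" for a m
  proof -
    define \<delta> :: real where "\<delta> = 1 / 2 ^ m"
    have \<delta>: "0 < \<delta>" "\<delta> \<in> \<rat>" by (auto simp: \<delta>_def)
    define A' where "A' = (\<lambda>j::nat. {w\<in>space path_space. a + b < w (real j * \<delta>) \<and> (\<forall>i<j. w (real i * \<delta>) \<le> a + b)})"
    define r where "r = (\<lambda>j::nat. real (nat \<lceil>real j * \<delta>\<rceil>) - real j * \<delta>)"
    define B' where "B' = (\<lambda>j. {w\<in>space path_space. - b \<le> w (r j)})"
    have r: "r j \<in> \<rat> \<inter> {0..1}" for j
    proof -
      have "r j \<in> \<rat>" unfolding r_def using \<delta>(2) by (intro Rats_diff Rats_mult) auto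
      moreover have "0 \<le> real j * \<delta>" using \<delta> by simp
      ultimately show ?thesis unfolding r_def by (auto simp: of_nat_ceiling) linarith
    qed
    have [measurable]: "A' j \<in> sets path_space" "B' j \<in> sets path_space" for j
      unfolding A'_def B'_def by measurable
    define A where "A = (\<lambda>j. {\<omega>\<in>space M. pre (real j * \<delta>) \<omega> \<in> A' j})"
    define AB where "AB = (\<lambda>j. {\<omega>\<in>space M. pre (real j * \<delta>) \<omega> \<in> A' j \<and> shift (real j * \<delta>) \<omega> \<in> B' j})"
    have [measurable]: "A j \<in> sets M" "AB j \<in> sets M" for j
    proof -
      have [simp]: "0 \<le> real j * \<delta>" using \<delta> by simp
      have [measurable]: "pre (real j * \<delta>) \<in> measurable M path_space" "shift (real j * \<delta>) \<in> measurable M path_space" by simp_all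
      show "A j \<in> sets M" "AB j \<in> sets M" unfolding A_def AB_def by measurable
    qed
    have A: "A j = {\<omega>\<in>space M. a + b < X (real j * \<delta>) \<omega> \<and> (\<forall>i<j. X (real i * \<delta>) \<omega> \<le> a + b)}" for j
      using \<delta>(1) by (auto simp: A_def A'_def pre_def space_PiM min_absorb1)
    have half: "emeasure M (A j) \<le> 2 * emeasure M (AB j)" for j
    proof -
      have "{\<omega> \<in> space M. shift 0 \<omega> \<in> B' j} = {\<omega>\<in>space M. - b \<le> X (r j) \<omega>}"
        using r[of j] by (auto simp: B'_def shift_def space_PiM)
      then have "prob (AB j) \<ge> prob (A j) * (1/2)"
        unfolding AB_def A_def using mult_left_mono[OF b[OF r[of j]], of "prob {\<omega>\<in>space M. pre (real j * \<delta>) \<omega> \<in> A' j}"] \<delta>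
        by (subst markov_rect) simp_all
      then have "ennreal (prob (A j)) \<le> ennreal (2 * prob (AB j))" by (intro ennreal_leI) simp
      then show ?thesis by (simp add: emeasure_eq_measure ennreal_mult)
    qed
    have disj: "disjoint_family A" unfolding disjoint_family_on_def A
    proof (intro ballI impI)
      fix i j :: nat assume "i \<noteq> j"
      then consider "i < j" | "j < i" by linarith
      then show "{\<omega> \<in> space M. a + b < X (real i * \<delta>) \<omega> \<and> (\<forall>k<i. X (real k * \<delta>) \<omega> \<le> a + b)} \<inter>
          {\<omega> \<in> space M. a + b < X (real j * \<delta>) \<omega> \<and> (\<forall>i<j. X (real i * \<delta>) \<omega> \<le> a + b)} = {}"
        by cases (auto simp: not_le[symmetric])
    qed
    have disj2: "disjoint_family AB"
      using disj unfolding disjoint_family_on_def A_def AB_def by blast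
    have "D a m = (\<Union>j. A j)"
    proof (intro equalityI subsetI)
      fix \<omega> assume "\<omega> \<in> D a m"
      then have w: "\<omega> \<in> space M" "\<exists>j::nat. a + b < X (real j * \<delta>) \<omega>" by (auto simp: D_def \<delta>_def)
      define j where "j = (LEAST j::nat. a + b < X (real j * \<delta>) \<omega>)"
      have "a + b < X (real j * \<delta>) \<omega>" unfolding j_def by (rule LeastI_ex[OF w(2)])
      moreover have "X (real i * \<delta>) \<omega> \<le> a + b" if "i < j" for i
        using not_less_Least[OF that[unfolded j_def]] by simp
      ultimately have "\<omega> \<in> A j" using w(1) unfolding A by blast
      then show "\<omega> \<in> (\<Union>j. A j)" by blast
    qed (auto simp: A D_def \<delta>_def)
    then have "emeasure M (D a m) = (\<Sum>j. emeasure M (A j))"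
      using disj by (simp add: suminf_emeasure image_subset_iff)
    also have "\<dots> \<le> (\<Sum>j. 2 * emeasure M (AB j))"
      by (intro suminf_le half) auto
    also have "\<dots> = 2 * emeasure M (\<Union>j. AB j)"
      using disj2 by (simp add: suminf_emeasure image_subset_iff)
    also have "emeasure M (\<Union>j. AB j) \<le> emeasure M {\<omega>\<in>space M. \<exists>n. a \<le> X (real n) \<omega>}"
    proof (rule emeasure_mono)
      show "(\<Union>j. AB j) \<subseteq> {\<omega>\<in>space M. \<exists>n. a \<le> X (real n) \<omega>}"
      proof
        fix \<omega> assume "\<omega> \<in> (\<Union>j. AB j)"
        then obtain j where "\<omega> \<in> AB j" by blast
        then have w: "\<omega> \<in> space M" "a + b < X (real j * \<delta>) \<omega>" "- b \<le> X (real j * \<delta> + r j) \<omega> - X (real j * \<delta>) \<omega>"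
          using A[of j] r[of j] unfolding AB_def A_def B'_def by (auto simp: shift_def)
        then have "a \<le> X (real (nat \<lceil>real j * \<delta>\<rceil>)) \<omega>" by (simp add: r_def)
        then show "\<omega> \<in> {\<omega>\<in>space M. \<exists>n. a \<le> X (real n) \<omega>}" using w(1) by blast
      qed
    qed measurable
    finally show ?thesis by (simp add: p_def emeasure_eq_measure mult_left_mono)
  qed
  define U where "U = (\<Inter>k::nat. \<Union>m. D (real k) m)"
  have [measurable]: "U \<in> sets M" unfolding U_def by measurable
  have Ub: "emeasure M U \<le> 2 * ennreal (p (real k))" for k
  proof -
    have "emeasure M U \<le> emeasure M (\<Union>m. D (real k) m)" unfolding U_def by (intro emeasure_mono) auto
    also have "\<dots> = (SUP m. emeasure M (D (real k) m))"
    proof (rule SUP_emeasure_incseq[symmetric])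
      show "incseq (D (real k))"
      proof (intro incseq_SucI subsetI)
        fix m \<omega> assume "\<omega> \<in> D (real k) m"
        then obtain j :: nat where "\<omega> \<in> space M" "real k + b < X (real j / 2 ^ m) \<omega>" by (auto simp: D_def)
        moreover have "real j / 2 ^ m = real (2 * j) / 2 ^ Suc m" by simp
        ultimately show "\<omega> \<in> D (real k) (Suc m)" unfolding D_def by (metis (mono_tags, lifting) mem_Collect_eq)
      qed
    qed auto
    also have "\<dots> \<le> 2 * ennreal (p (real k))" by (intro SUP_least bound)
    finally show ?thesis .
  qed
  have "prob U \<le> 2 * p (real k)" for k
    using Ub[of k] by (simp add: emeasure_eq_measure p_def ennreal_mult[symmetric] flip: ennreal_numeral)
  then have "prob U \<le> 0"
    using LIMSEQ_le_const[OF tendsto_mult_right_zero[OF p0, of 2], of "prob U"] by blast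
  then have "AE \<omega> in M. \<omega> \<notin> U" by (subst prob_eq_0[symmetric]) (auto simp: measure_le_0_iff)
  then show ?thesis using AE_space
  proof eventually_elim
    case (elim \<omega>)
    then obtain k :: nat where k: "\<And>m. \<omega> \<notin> D (real k) m" unfolding U_def by blast
    have "X s \<omega> \<le> real k + b" if "0 \<le> s" for s
    proof (rule LIMSEQ_le_const2[OF cadlag_dy[OF all_cadlag that]])
      have "X (dy m s) \<omega> \<le> real k + b" for m
      proof -
        have "0 \<le> s * 2 ^ m" using that by simp
        then have "dy m s = real (nat \<lceil>s * 2 ^ m\<rceil>) / 2 ^ m" by (simp add: dy_def)
        then show ?thesis using k[of m] elim(2) unfolding D_def by (auto simp: not_less)
      qed
      then show "\<exists>N. \<forall>n\<ge>N. X (dy n s) \<omega> \<le> real k + b" by blast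
    qed
    then show ?case by (intro bdd_aboveI[of _ "real k + b"]) auto
  qed
qed

lemma bdd_above_of_neg_mean:
  assumes "integrable M (X 1)" "expectation (X 1) < 0"
  shows "AE \<omega> in M. bdd_above ((\<lambda>t. X t \<omega>) ` {0..})"
proof (rule bdd_above_from_integers)
  let ?\<mu> = "distr M borel (X 1)"
  let ?\<xi> = "\<lambda>\<omega> i. X (1 * real (Suc i)) \<omega> - X (1 * real i) \<omega>"
  have mX: "X 1 \<in> borel_measurable M" by (rule measurable_X) simp
  have m: "?\<xi> \<in> measurable M (PiM UNIV (\<lambda>_::nat. borel))"
    by (intro measurable_PiM_single' borel_measurable_diff measurable_X) auto
  have "AE w in PiM (UNIV::nat set) (\<lambda>_. ?\<mu>). bdd_above (range (\<lambda>n. \<Sum>i<n. w i))"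
    using assms mX by (intro random_walk_bdd_above prob_space_distr) (auto simp: integrable_distr_eq integral_distr)
  then have "AE w in distr M (PiM UNIV (\<lambda>_::nat. borel)) ?\<xi>. bdd_above (range (\<lambda>n. \<Sum>i<n. w i))"
    by (subst iid_grid) auto
  from AE_distrD[OF m this] show "AE \<omega> in M. bdd_above (range (\<lambda>n. X (real n) \<omega>))"
  proof eventually_elim
    case (elim \<omega>)
    have "(\<Sum>i<n. ?\<xi> \<omega> i) = X (real n) \<omega>" for n
      by (subst sum_lessThan_telescope) simp
    then show ?case using elim by simp
  qed
qed

text \<open>Compare with a drift of half the mean: \<open>c * t - X t\<close> is a Levy process with negative mean.\<close>

lemma tendsto_infinity:
  assumes "0 < expectation (X 1)"
  shows "AE \<omega> in M. filterlim (\<lambda>t. X t \<omega>) at_top at_top"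
proof -
  have int: "integrable M (X 1)" using assms not_integrable_integral_eq by fastforce
  define c where "c = expectation (X 1) / 2"
  interpret Z: cadlag_levy M "\<lambda>t \<omega>. c * t + (-1) * X t \<omega>" by (rule affine)
  have "AE \<omega> in M. bdd_above ((\<lambda>t. c * t + (-1) * X t \<omega>) ` {0..})"
    using int assms by (intro Z.bdd_above_of_neg_mean) (auto simp: c_def prob_space)
  then show ?thesis
  proof eventually_elim
    case (elim \<omega>)
    then obtain K where K: "\<And>t. 0 \<le> t \<Longrightarrow> c * t - X t \<omega> \<le> K" by (auto simp: bdd_above_def)
    have "filterlim (\<lambda>t. - K + c * t) at_top at_top"
      using assms by (intro filterlim_tendsto_add_at_top[OF tendsto_const] filterlim_tendsto_pos_mult_at_top[OF tendsto_const])
        (auto simp: c_def filterlim_ident)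
    then show ?case
    proof (rule filterlim_at_top_mono)
      show "\<forall>\<^sub>F t in at_top. - K + c * t \<le> X t \<omega>"
        using eventually_ge_at_top[of 0] by eventually_elim (use K in force)
    qed
  qed
qed

end

section \<open>First passage over a level\<close>

lemma (in finite_measure) measure_limsup_ge:
  assumes [measurable]: "\<And>m::nat. E m \<in> sets M" and p: "\<And>m. p \<le> measure M (E m)"
  shows "p \<le> measure M {\<omega>\<in>space M. \<exists>\<^sub>\<infinity>m. \<omega> \<in> E m}"
proof -
  let ?U = "\<lambda>n. \<Union>m\<in>{n..}. E m"
  have "(\<lambda>n. measure M (?U n)) \<longlonglongrightarrow> measure M (\<Inter>n. ?U n)"
    by (intro finite_Lim_measure_decseq) (auto simp: decseq_def, meson atLeast_iff order_trans)
  moreover have "p \<le> measure M (?U n)" for n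
    using finite_measure_mono[of "E n" "?U n"] p[of n] by fastforce
  ultimately have "p \<le> measure M (\<Inter>n. ?U n)" by (intro LIMSEQ_le_const) auto
  also have "(\<Inter>n. ?U n) = {\<omega>\<in>space M. \<exists>\<^sub>\<infinity>m. \<omega> \<in> E m}"
    using sets.sets_into_space[OF assms(1)] by (fastforce simp: INFM_nat_le)
  finally show ?thesis .
qed

lemma separated_finite:
  fixes f :: "'i \<Rightarrow> real"
  assumes "\<And>i. i \<in> I \<Longrightarrow> f i \<in> {0..C}" "0 < \<eta>"
    "\<And>i k. i \<in> I \<Longrightarrow> k \<in> I \<Longrightarrow> i \<noteq> k \<Longrightarrow> \<eta> \<le> \<bar>f i - f k\<bar>"
  shows "finite I"
proof (rule finite_imageD)
  show "finite ((\<lambda>i. \<lfloor>f i / \<eta>\<rfloor>) ` I)"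
  proof (rule finite_subset)
    show "(\<lambda>i. \<lfloor>f i / \<eta>\<rfloor>) ` I \<subseteq> {0..\<lfloor>C / \<eta>\<rfloor>}"
      using assms(1,2) by (auto intro!: floor_mono divide_right_mono)
  qed simp
  show "inj_on (\<lambda>i. \<lfloor>f i / \<eta>\<rfloor>) I"
  proof (rule inj_onI, rule ccontr)
    fix i k assume ik: "i \<in> I" "k \<in> I" "\<lfloor>f i / \<eta>\<rfloor> = \<lfloor>f k / \<eta>\<rfloor>" "i \<noteq> k"
    have "\<bar>f i / \<eta> - f k / \<eta>\<bar> < 1" using ik(3) by linarith
    then have "\<bar>f i - f k\<bar> / \<eta> < 1" using assms(2) by (simp add: diff_divide_distrib[symmetric])
    then have "\<bar>f i - f k\<bar> < \<eta>" using assms(2) by (simp add: field_simps)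
    then show False using assms(3)[OF ik(1,2,4)] by simp
  qed
qed

lemma cadlag_borel_measurable:
  assumes "cadlag x" shows "(\<lambda>s. x (max 0 s)) \<in> borel_measurable borel"
proof (rule borel_measurable_LIMSEQ_real)
  show "(\<lambda>m. x (dy m (max 0 s))) \<longlonglongrightarrow> x (max 0 s)" for s
    by (rule cadlag_dy[OF assms]) simp
  show "(\<lambda>s. x (dy m (max 0 s))) \<in> borel_measurable borel" for m
    unfolding dy_def by (rule measurable_compose_countable[of "\<lambda>i s. x (real_of_int i / 2 ^ m)"]) measurable
qed

definition good_path :: "(real \<Rightarrow> real) \<Rightarrow> bool" where
  "good_path x \<longleftrightarrow> cadlag x \<and> x 0 = 0 \<and> (\<forall>t>0. x t \<le> Lim (at_left t) x) \<and> filterlim x at_top at_top"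

text \<open>First passage is taken on grids, where the Markov property at fixed times suffices; the passage
  times decrease to their limit, so that right continuity applies.\<close>

definition passage :: "nat \<Rightarrow> real \<Rightarrow> (real \<Rightarrow> real) \<Rightarrow> nat" where
  "passage m a x = (LEAST j. a < x (real j / 2 ^ m))"

lemma good_path_eventually_gt:
  assumes "good_path x"
  obtains C where "0 \<le> C" "\<And>t. C \<le> t \<Longrightarrow> a < x t"
proof -
  have "\<forall>\<^sub>F t in at_top. a < x t" using assms by (auto simp: good_path_def filterlim_at_top_dense)
  then obtain C where "\<And>t. C \<le> t \<Longrightarrow> a < x t" by (auto simp: eventually_at_top_linorder)
  then show ?thesis by (intro that[of "max 0 C"]) auto
qed

lemma passage_gt:
  assumes "good_path x" shows "a < x (real (passage m a x) / 2 ^ m)"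
proof -
  obtain C where C: "0 \<le> C" "\<And>t. C \<le> t \<Longrightarrow> a < x t" using good_path_eventually_gt[OF assms] by blast
  obtain j :: nat where "C * 2 ^ m \<le> real j" using real_arch_simple by blast
  then have "C \<le> real j / 2 ^ m" by (simp add: field_simps)
  then have "a < x (real j / 2 ^ m)" by (rule C)
  then show ?thesis unfolding passage_def by (rule LeastI)
qed

lemma passage_le: "a < x (real j / 2 ^ m) \<Longrightarrow> passage m a x \<le> j"
  unfolding passage_def by (rule Least_le)

text \<open>Without positive jumps a level cannot be jumped over: the overshoot at the grid passage times
  vanishes in the limit.\<close>

lemma passage_limit:
  assumes x: "good_path x" and a: "0 \<le> a"
  obtains T where "0 \<le> T" "(\<lambda>m. real (passage m a x) / 2 ^ m) \<longlonglongrightarrow> T" "\<And>m. T \<le> real (passage m a x) / 2 ^ m"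
    "x T = a" "\<And>s. 0 \<le> s \<Longrightarrow> s < T \<Longrightarrow> x s \<le> a"
proof -
  let ?T = "\<lambda>m. real (passage m a x) / 2 ^ m"
  have c: "cadlag x" using x by (simp add: good_path_def)
  have dec: "decseq ?T"
  proof (rule decseq_SucI)
    fix m
    have "a < x (real (2 * passage m a x) / 2 ^ Suc m)" using passage_gt[OF x, of a m] by simp
    then have "passage (Suc m) a x \<le> 2 * passage m a x" by (rule passage_le)
    then have "real (passage (Suc m) a x) \<le> real (2 * passage m a x)" by (simp only: of_nat_le_iff)
    then show "?T (Suc m) \<le> ?T m" by (simp add: field_simps)
  qed
  obtain T where T: "?T \<longlonglongrightarrow> T" "\<And>m. T \<le> ?T m"
    using decseq_convergent[OF dec, of 0] by auto
  have T0: "0 \<le> T" using LIMSEQ_le_const[OF T(1), of 0] by auto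
  have before: "x s \<le> a" if s: "0 \<le> s" "s < T" for s
  proof (rule LIMSEQ_le_const2[OF cadlag_dy[OF c s(1)]])
    have "\<forall>\<^sub>F m in sequentially. dy m s < T" by (rule order_tendstoD(2)[OF dy_tendsto s(2)])
    then have "\<forall>\<^sub>F m in sequentially. x (dy m s) \<le> a"
    proof eventually_elim
      case (elim m)
      have "0 \<le> s * 2 ^ m" using s by simp
      then have d: "dy m s = real (nat \<lceil>s * 2 ^ m\<rceil>) / 2 ^ m" by (simp add: dy_def)
      have "dy m s < ?T m" using elim T(2)[of m] by simp
      then have "nat \<lceil>s * 2 ^ m\<rceil> < passage m a x" unfolding d by (simp add: divide_less_cancel)
      then show ?case unfolding d using passage_le[of a x _ m] by (meson not_le)
    qed
    then show "\<exists>N. \<forall>n\<ge>N. x (dy n s) \<le> a" by (simp add: eventually_sequentially)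
  qed
  have lim: "(\<lambda>m. x (?T m)) \<longlonglongrightarrow> x T" by (rule cadlag_seq_right[OF c T0 T(1)]) (rule T(2))
  have "a \<le> x T"
    by (rule LIMSEQ_le_const[OF lim]) (use passage_gt[OF x] in \<open>auto intro: less_imp_le\<close>)
  moreover have "x T \<le> a"
  proof (cases "T = 0")
    case True then show ?thesis using x a by (simp add: good_path_def)
  next
    case False
    then have T1: "0 < T" using T0 by simp
    have "\<forall>\<^sub>F s in at_left T. x s \<le> a"
      unfolding eventually_at_left_field using T1 before by (intro exI[of _ 0]) auto
    then have "Lim (at_left T) x \<le> a"
      by (intro tendsto_upperbound[OF cadlag_left[OF c T1]]) auto
    then show ?thesis using x T1 by (auto simp: good_path_def intro: order_trans)
  qed
  ultimately show ?thesis using that[OF T0 T] before by auto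
qed

locale spectrally_negative = cadlag_levy +
  assumes good: "\<And>\<omega>. good_path (\<lambda>t. X t \<omega>)"
begin

definition T :: "nat \<Rightarrow> real \<Rightarrow> 'a \<Rightarrow> real" where
  "T m a \<omega> = real (passage m a (\<lambda>t. X t \<omega>)) / 2 ^ m"

lemma strong_markov:
  assumes \<Gamma>[measurable]: "\<Gamma> \<in> sets path_space"
  shows "{\<omega>\<in>space M. shift (T m a \<omega>) \<omega> \<in> \<Gamma>} \<in> sets M"
    and "prob {\<omega>\<in>space M. shift (T m a \<omega>) \<omega> \<in> \<Gamma>} = prob {\<omega>\<in>space M. shift 0 \<omega> \<in> \<Gamma>}"
proof -
  define A' where "A' = (\<lambda>j::nat. {w\<in>space path_space. a < w (real j / 2 ^ m) \<and> (\<forall>i<j. w (real i / 2 ^ m) \<le> a)})"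
  have A'[measurable]: "A' j \<in> sets path_space" for j unfolding A'_def by measurable
  define A where "A = (\<lambda>j. {\<omega>\<in>space M. pre (real j / 2 ^ m) \<omega> \<in> A' j})"
  define B where "B = (\<lambda>j. {\<omega>\<in>space M. pre (real j / 2 ^ m) \<omega> \<in> A' j \<and> shift (real j / 2 ^ m) \<omega> \<in> \<Gamma>})"
  have [measurable]: "pre (real j / 2 ^ m) \<in> measurable M path_space" "shift (real j / 2 ^ m) \<in> measurable M path_space" for j
    by simp_all
  have [measurable]: "A j \<in> sets M" "B j \<in> sets M" for j unfolding A_def B_def by measurable
  have A: "A j = {\<omega>\<in>space M. passage m a (\<lambda>t. X t \<omega>) = j}" for j
  proof -
    have "A j = {\<omega>\<in>space M. a < X (real j / 2 ^ m) \<omega> \<and> (\<forall>i<j. X (real i / 2 ^ m) \<omega> \<le> a)}"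
      by (auto simp: A_def A'_def pre_def space_PiM min_absorb1 divide_right_mono)
    also have "\<dots> = {\<omega>\<in>space M. passage m a (\<lambda>t. X t \<omega>) = j}"
    proof (intro Collect_cong conj_cong refl iffI conjI allI impI)
      fix \<omega> assume h: "a < X (real j / 2 ^ m) \<omega> \<and> (\<forall>i<j. X (real i / 2 ^ m) \<omega> \<le> a)"
      then have "passage m a (\<lambda>t. X t \<omega>) \<le> j" using passage_le[of a "\<lambda>t. X t \<omega>"] by simp
      moreover have "\<not> passage m a (\<lambda>t. X t \<omega>) < j" using h passage_gt[OF good[of \<omega>], of a m] by force
      ultimately show "passage m a (\<lambda>t. X t \<omega>) = j" by simp
    next
      fix \<omega> assume h: "passage m a (\<lambda>t. X t \<omega>) = j"
      then show "a < X (real j / 2 ^ m) \<omega>" using passage_gt[OF good[of \<omega>], of a m] by simp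
      fix i assume "i < j"
      then show "X (real i / 2 ^ m) \<omega> \<le> a" using h passage_le[of a "\<lambda>t. X t \<omega>" i m] by force
    qed
    finally show ?thesis .
  qed
  have B: "B j = {\<omega>\<in>space M. passage m a (\<lambda>t. X t \<omega>) = j \<and> shift (T m a \<omega>) \<omega> \<in> \<Gamma>}" for j
  proof -
    have "B j = A j \<inter> {\<omega>\<in>space M. shift (real j / 2 ^ m) \<omega> \<in> \<Gamma>}" unfolding A_def B_def by blast
    then show ?thesis unfolding A T_def by auto
  qed
  have eq: "{\<omega>\<in>space M. shift (T m a \<omega>) \<omega> \<in> \<Gamma>} = (\<Union>j. B j)" unfolding B by blast
  then show "{\<omega>\<in>space M. shift (T m a \<omega>) \<omega> \<in> \<Gamma>} \<in> sets M" by simp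
  have dA: "disjoint_family A" unfolding A disjoint_family_on_def by auto
  have dB: "disjoint_family B" unfolding B disjoint_family_on_def by auto
  have PB: "prob (B j) = prob (A j) * prob {\<omega>\<in>space M. shift 0 \<omega> \<in> \<Gamma>}" for j
    unfolding A_def B_def by (rule markov_rect) auto
  have "(\<lambda>j. prob (B j)) sums prob (\<Union>j. B j)" using dB by (intro finite_measure_UNION) auto
  moreover have "(\<lambda>j. prob (A j)) sums prob (\<Union>j. A j)" using dA by (intro finite_measure_UNION) auto
  then have "(\<lambda>j. prob (B j)) sums (prob (\<Union>j. A j) * prob {\<omega>\<in>space M. shift 0 \<omega> \<in> \<Gamma>})"
    unfolding PB by (rule sums_mult2)
  moreover have "(\<Union>j. A j) = space M" unfolding A by blast
  ultimately show "prob {\<omega>\<in>space M. shift (T m a \<omega>) \<omega> \<in> \<Gamma>} = prob {\<omega>\<in>space M. shift 0 \<omega> \<in> \<Gamma>}"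
    unfolding eq using sums_unique2 by (fastforce simp: prob_space)
qed

text \<open>By the strong Markov property each of the levels \<open>1 / (i + 1)\<close> sees \<open>\<Gamma>\<close> after its passage with the
  same probability \<open>p\<close>.  Since an upper limit of events of probability at least \<open>p\<close> has probability at
  least \<open>p\<close>, with probability \<open>p\<close> infinitely many of these levels see \<open>\<Gamma>\<close>, each along infinitely many
  grids.\<close>

lemma event_null_by_levels:
  assumes \<Gamma>[measurable]: "\<Gamma> \<in> sets path_space"
    and fin: "\<And>\<omega>. \<omega> \<in> space M \<Longrightarrow> finite {i::nat. \<exists>\<^sub>\<infinity>m. shift (T m (1 / real (Suc i)) \<omega>) \<omega> \<in> \<Gamma>}"
  shows "prob {\<omega>\<in>space M. shift 0 \<omega> \<in> \<Gamma>} = 0"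
proof -
  let ?p = "prob {\<omega>\<in>space M. shift 0 \<omega> \<in> \<Gamma>}"
  define E where "E = (\<lambda>i m. {\<omega>\<in>space M. shift (T m (1 / real (Suc i)) \<omega>) \<omega> \<in> \<Gamma>})"
  have [measurable]: "E i m \<in> sets M" for i m unfolding E_def by (rule strong_markov(1)[OF \<Gamma>])
  define V where "V = (\<lambda>i. {\<omega>\<in>space M. \<exists>\<^sub>\<infinity>m. \<omega> \<in> E i m})"
  have [measurable]: "V i \<in> sets M" for i unfolding V_def INFM_nat_le by measurable
  have "?p \<le> prob (V i)" for i
    unfolding V_def by (rule measure_limsup_ge) (auto simp: E_def strong_markov(2)[OF \<Gamma>] strong_markov(1)[OF \<Gamma>])
  then have "?p \<le> prob {\<omega>\<in>space M. \<exists>\<^sub>\<infinity>i. \<omega> \<in> V i}" by (intro measure_limsup_ge) auto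
  also have "{\<omega>\<in>space M. \<exists>\<^sub>\<infinity>i. \<omega> \<in> V i} = {}"
  proof -
    have "finite {i. \<omega> \<in> V i}" if w: "\<omega> \<in> space M" for \<omega>
      using fin[OF w] w by (simp add: V_def E_def)
    then show ?thesis by (auto simp: frequently_cofinite)
  qed
  finally show ?thesis using measure_nonneg[of M "{\<omega>\<in>space M. shift 0 \<omega> \<in> \<Gamma>}"] by simp
qed

lemma passage_after:
  assumes lim: "(\<lambda>m. T m a \<omega>) \<longlonglongrightarrow> T0" and ge: "\<And>m. T0 \<le> T m a \<omega>" and "0 \<le> T0" "0 \<le> s"
  shows "(\<lambda>m. X (T m a \<omega> + s) \<omega>) \<longlonglongrightarrow> X (T0 + s) \<omega>"
  using assms by (intro cadlag_seq_right[OF all_cadlag]) (auto intro!: tendsto_intros)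

text \<open>Otherwise infinitely many levels below \<open>1\<close> would each hold up the running maximum for a time \<open>\<eta>\<close>,
  while the path exceeds \<open>1\<close> from some time on.\<close>

lemma immediately_positive:
  assumes \<eta>: "0 < \<eta>"
  shows "AE \<omega> in M. \<exists>s. 0 < s \<and> s < \<eta> \<and> 0 < X s \<omega>"
proof -
  define \<Gamma> where "\<Gamma> = {w\<in>space path_space. \<forall>q\<in>\<rat> \<inter> {0<..<\<eta>}. w q \<le> 0}"
  have \<Gamma>[measurable]: "\<Gamma> \<in> sets path_space" unfolding \<Gamma>_def
    by (rule sets_Collect_countable_Ball_on) (auto intro: countable_subset[OF _ countable_rat])
  have "prob {\<omega>\<in>space M. shift 0 \<omega> \<in> \<Gamma>} = 0"
  proof (rule event_null_by_levels[OF \<Gamma>])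
    fix \<omega> assume "\<omega> \<in> space M"
    let ?x = "\<lambda>t. X t \<omega>" and ?a = "\<lambda>i. 1 / real (Suc i)"
    let ?I = "{i::nat. \<exists>\<^sub>\<infinity>m. shift (T m (?a i) \<omega>) \<omega> \<in> \<Gamma>}"
    have "\<exists>S. 0 \<le> S \<and> (\<lambda>m. T m (?a i) \<omega>) \<longlonglongrightarrow> S \<and> (\<forall>m. S \<le> T m (?a i) \<omega>) \<and> ?x S = ?a i \<and> (\<forall>s. 0 \<le> s \<longrightarrow> s < S \<longrightarrow> ?x s \<le> ?a i)" for i
    proof (rule passage_limit[OF good[of \<omega>], of "?a i"])
      fix S assume "0 \<le> S" "(\<lambda>m. real (passage m (?a i) ?x) / 2 ^ m) \<longlonglongrightarrow> S" "\<And>m. S \<le> real (passage m (?a i) ?x) / 2 ^ m"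
        "?x S = ?a i" "\<And>s. 0 \<le> s \<Longrightarrow> s < S \<Longrightarrow> ?x s \<le> ?a i"
      then show ?thesis unfolding T_def by blast
    qed simp
    then obtain S where S: "\<And>i. 0 \<le> S i" "\<And>i. (\<lambda>m. T m (?a i) \<omega>) \<longlonglongrightarrow> S i" "\<And>i m. S i \<le> T m (?a i) \<omega>"
      "\<And>i. ?x (S i) = ?a i" "\<And>i s. 0 \<le> s \<Longrightarrow> s < S i \<Longrightarrow> ?x s \<le> ?a i" by metis
    have flat: "?x (S i + s) \<le> ?a i" if i: "i \<in> ?I" and s: "0 \<le> s" "s < \<eta>" for i s
    proof -
      have q: "?x (S i + q) \<le> ?a i" if q: "q \<in> \<rat> \<inter> {0<..<\<eta>}" for q
      proof (rule ccontr)
        assume "\<not> ?thesis"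
        moreover have "(\<lambda>m. X (T m (?a i) \<omega> + q) \<omega> - X (T m (?a i) \<omega> + 0) \<omega>) \<longlonglongrightarrow> X (S i + q) \<omega> - X (S i + 0) \<omega>"
          using q by (intro tendsto_diff passage_after[OF S(2) S(3) S(1)]) auto
        ultimately have "\<forall>\<^sub>F m in sequentially. 0 < X (T m (?a i) \<omega> + q) \<omega> - X (T m (?a i) \<omega> + 0) \<omega>"
          by (intro order_tendstoD(1)) (auto simp: S(4))
        then have "\<forall>\<^sub>F m in sequentially. shift (T m (?a i) \<omega>) \<omega> \<notin> \<Gamma>"
        proof eventually_elim
          case (elim m) then show ?case using q by (auto simp: \<Gamma>_def shift_def not_le max_def)
        qed
        then show False using i by (simp add: frequently_def cofinite_eq_sequentially)
      qed
      obtain q' where q': "\<And>n::nat. q' n \<in> \<rat>" "\<And>n. s < q' n" "\<And>n. q' n < \<eta>" and ql: "q' \<longlonglongrightarrow> s"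
        using rational_sequence_right[OF s(2)] by blast
      have "(\<lambda>n. ?x (S i + q' n)) \<longlonglongrightarrow> ?x (S i + s)"
        using S(1)[of i] s q'(2) ql by (intro cadlag_seq_right[OF all_cadlag]) (auto intro!: tendsto_intros simp: less_imp_le)
      moreover have "?x (S i + q' n) \<le> ?a i" for n using q'[of n] s by (intro q) auto
      ultimately show ?thesis by (intro LIMSEQ_le_const2) auto
    qed
    have sep: "S i + \<eta> \<le> S k" if "i \<in> ?I" "?a i < ?a k" for i k
    proof (rule ccontr)
      assume n: "\<not> ?thesis"
      show False
      proof (cases "S k < S i")
        case True then show False using S(5)[OF S(1) True] S(4)[of k] that by simp
      next
        case False then show False using flat[OF that(1), of "S k - S i"] n S(4)[of k] that by simp
      qed
    qed
    obtain C where C: "0 \<le> C" "\<And>t. C \<le> t \<Longrightarrow> 1 < ?x t" using good_path_eventually_gt[OF good[of \<omega>]] by blast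
    show "finite ?I"
    proof (rule separated_finite[of _ S C \<eta>])
      show "S i \<in> {0..C}" for i
      proof -
        have "?x (S i) \<le> 1" by (simp add: S(4))
        then show ?thesis using S(1)[of i] C(2)[of "S i"] by force
      qed
      fix i k assume ik: "i \<in> ?I" "k \<in> ?I" "i \<noteq> k"
      then have "?a i < ?a k \<or> ?a k < ?a i" by (auto simp: field_simps)
      then show "\<eta> \<le> \<bar>S i - S k\<bar>" using sep[OF ik(1), of k] sep[OF ik(2), of i] by auto
    qed (rule \<eta>)
  qed
  then have "AE \<omega> in M. shift 0 \<omega> \<notin> \<Gamma>" by (subst (asm) prob_eq_0) auto
  then show ?thesis using AE_space
  proof eventually_elim
    case (elim \<omega>)
    then obtain q where "q \<in> \<rat> \<inter> {0<..<\<eta>}" "\<not> shift 0 \<omega> q \<le> 0" by (auto simp: \<Gamma>_def space_PiM)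
    then show ?case by (intro exI[of _ q]) (auto simp: shift_def max_def)
  qed
qed

text \<open>Otherwise infinitely many distinct heights \<open>1 / (i + 1) + y\<close> would each be occupied for at least
  a time \<open>d\<close> within one bounded time interval.\<close>

lemma level_null:
  "AE \<omega> in M. emeasure lborel {s. 0 \<le> s \<and> X s \<omega> = y} = 0"
proof -
  have main: "AE \<omega> in M. emeasure lborel {s\<in>{0..N}. X s \<omega> = y} < ennreal d" if d: "0 < d" and N: "0 \<le> N" for N d :: real
  proof -
    define Q where "Q = {p\<in>space (path_space \<Otimes>\<^sub>M (lborel::real measure)). snd p \<in> {0..N} \<and>
      (\<forall>k::nat. \<exists>m0. \<forall>m\<ge>m0. \<bar>fst p (dy m (snd p)) - y\<bar> < 1 / real (Suc k))}"
    have [measurable]: "(\<lambda>p. fst p (dy m (snd p))) \<in> borel_measurable (path_space \<Otimes>\<^sub>M (lborel::real measure))" for m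
    proof -
      have "(\<lambda>z. fst z (real_of_int \<lceil>(snd z :: real) * 2 ^ m\<rceil> / 2 ^ m)) \<in> borel_measurable (path_space \<Otimes>\<^sub>M lborel)"
        by (rule measurable_compose_countable[of "\<lambda>i z. fst z (real_of_int i / 2 ^ m)"]) measurable
      then show ?thesis by (simp add: dy_def)
    qed
    have Q: "Q \<in> sets (path_space \<Otimes>\<^sub>M lborel)" unfolding Q_def by measurable
    define \<Gamma> where "\<Gamma> = {w\<in>space path_space. ennreal d \<le> emeasure lborel (Pair w -` Q)}"
    have \<Gamma>: "\<Gamma> \<in> sets path_space"
    proof -
      have [measurable]: "(\<lambda>w. emeasure lborel (Pair w -` Q)) \<in> borel_measurable path_space"
        by (rule lborel.measurable_emeasure_Pair[OF Q])
      show ?thesis unfolding \<Gamma>_def by measurable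
    qed
    have slice: "Pair (shift t \<omega>) -` Q = {s\<in>{0..N}. X (t + s) \<omega> - X t \<omega> = y}" if t: "0 \<le> t" for t \<omega>
    proof -
      have "(\<forall>k::nat. \<exists>m0. \<forall>m\<ge>m0. \<bar>shift t \<omega> (dy m s) - y\<bar> < 1 / real (Suc k)) \<longleftrightarrow> X (t + s) \<omega> - X t \<omega> = y" if s: "0 \<le> s" for s
      proof -
        have c: "(\<lambda>m. shift t \<omega> (dy m s)) \<longlonglongrightarrow> X (t + s) \<omega> - X t \<omega>"
        proof -
          have "0 \<le> dy m s" for m using dy_ge[of s m] s by simp
          then show ?thesis unfolding shift_def using s t dy_ge[of s]
            by (intro tendsto_diff tendsto_const cadlag_seq_right[OF all_cadlag]) (auto intro!: tendsto_intros dy_tendsto)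
        qed
        have "(\<forall>k::nat. \<exists>m0. \<forall>m\<ge>m0. \<bar>shift t \<omega> (dy m s) - y\<bar> < 1 / real (Suc k)) \<longleftrightarrow> (\<lambda>m. shift t \<omega> (dy m s)) \<longlonglongrightarrow> y"
          unfolding LIMSEQ_iff real_norm_def
        proof (intro iffI allI impI)
          fix r :: real assume h: "\<forall>k::nat. \<exists>m0. \<forall>m\<ge>m0. \<bar>shift t \<omega> (dy m s) - y\<bar> < 1 / real (Suc k)" and "0 < r"
          then obtain k :: nat where k: "1 / real (Suc k) < r" using nat_approx_posE by blast
          obtain m0 where "\<forall>m\<ge>m0. \<bar>shift t \<omega> (dy m s) - y\<bar> < 1 / real (Suc k)" using h by blast
          then show "\<exists>no. \<forall>n\<ge>no. \<bar>shift t \<omega> (dy n s) - y\<bar> < r"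
            using k by (meson less_trans)
        next
          fix k :: nat assume "\<forall>r>0. \<exists>no. \<forall>n\<ge>no. \<bar>shift t \<omega> (dy n s) - y\<bar> < r"
          then show "\<exists>m0. \<forall>m\<ge>m0. \<bar>shift t \<omega> (dy m s) - y\<bar> < 1 / real (Suc k)" by (meson of_nat_0_less_iff zero_less_Suc zero_less_divide_1_iff)
        qed
        then show ?thesis using c LIMSEQ_unique by blast
      qed
      then show ?thesis by (auto simp: Q_def space_pair_measure space_PiM)
    qed
    have "prob {\<omega>\<in>space M. shift 0 \<omega> \<in> \<Gamma>} = 0"
    proof (rule event_null_by_levels[OF \<Gamma>])
      fix \<omega> assume "\<omega> \<in> space M"
      let ?x = "\<lambda>t. X t \<omega>" and ?a = "\<lambda>i. 1 / real (Suc i)"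
      let ?I = "{i::nat. \<exists>\<^sub>\<infinity>m. shift (T m (?a i) \<omega>) \<omega> \<in> \<Gamma>}"
      obtain C where C: "0 \<le> C" "\<And>t. C \<le> t \<Longrightarrow> 1 < ?x t" using good_path_eventually_gt[OF good[of \<omega>]] by blast
      have xm: "(\<lambda>s. ?x (t + max 0 s)) \<in> borel_measurable borel" if "0 \<le> t" for t
      proof -
        have "(\<lambda>s. ?x (max 0 (t + max 0 s))) \<in> borel_measurable borel"
          using cadlag_borel_measurable[OF all_cadlag, of \<omega>] by measurable
        then show ?thesis using that by simp
      qed
      have lm: "{s\<in>{0..N'}. ?x (t + s) - b = z} \<in> sets borel" if "0 \<le> t" for t b z N'
      proof -
        have "{s\<in>{0..N'}. ?x (t + s) - b = z} = {s\<in>space borel. s \<in> {0..N'} \<and> ?x (t + max 0 s) - b = z}"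
          by (auto simp: max_def)
        also have "\<dots> \<in> sets borel" using xm[OF that] by measurable
        finally show ?thesis .
      qed
      have lm0: "{s\<in>{0..N'}. ?x s = z} \<in> sets borel" for z N' using lm[of 0 N' 0 z] by simp
      have occ: "ennreal d \<le> emeasure lborel {s\<in>{0..C + N}. ?x s = ?a i + y}" if i: "i \<in> ?I" for i
      proof -
        obtain S where S: "0 \<le> S" "(\<lambda>m. T m (?a i) \<omega>) \<longlonglongrightarrow> S" "\<And>m. S \<le> T m (?a i) \<omega>" "?x S = ?a i"
          unfolding T_def by (rule passage_limit[OF good[of \<omega>], of "?a i"]) auto
        have "S \<le> C" using C(2)[of S] S(4) by (cases "S \<le> C") (auto simp: field_simps)
        define B where "B = {s\<in>{0..C + N}. ?x s = ?a i + y}"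
        have B: "B \<in> sets borel" unfolding B_def by (rule lm0)
        define E where "E = (\<lambda>m. {s\<in>{0..N}. X (T m (?a i) \<omega> + s) \<omega> - X (T m (?a i) \<omega>) \<omega> = y})"
        have T0: "0 \<le> T m (?a i) \<omega>" for m by (simp add: T_def)
        have inf: "\<exists>\<^sub>\<infinity>m. ennreal d \<le> emeasure lborel (E m)"
          using i slice[OF T0] by (auto simp: \<Gamma>_def E_def elim!: INFM_mono)
        then obtain r :: "nat \<Rightarrow> nat" where r: "strict_mono r" "\<And>n. ennreal d \<le> emeasure lborel (E (r n))"
          using infinite_enumerate[of "{m. ennreal d \<le> emeasure lborel (E m)}"] by (auto simp: frequently_cofinite)
        define L where "L = restrict_space lborel {0..N}"
        interpret L: finite_measure L
          by standard (simp add: L_def emeasure_restrict_space space_restrict_space N)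
        have sL: "A \<in> sets borel \<Longrightarrow> A \<subseteq> {0..N} \<Longrightarrow> A \<in> sets L" for A
          by (auto simp: L_def sets_restrict_space)
        have eL: "A \<subseteq> {0..N} \<Longrightarrow> A \<in> sets borel \<Longrightarrow> emeasure L A = emeasure lborel A" for A
          by (simp add: L_def emeasure_restrict_space)
        have Eb: "E m \<in> sets borel" for m unfolding E_def by (rule lm[OF T0])
        have ES: "E m \<subseteq> {0..N}" for m by (auto simp: E_def)
        have "d \<le> measure L {s\<in>space L. \<exists>\<^sub>\<infinity>n. s \<in> E (r n)}"
        proof (rule L.measure_limsup_ge)
          show "E (r n) \<in> sets L" for n using sL Eb ES by blast
          show "d \<le> measure L (E (r n))" for n
            using r(2)[of n] eL[OF ES Eb, of "r n"] L.emeasure_eq_measure[of "E (r n)"]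
            by (metis ennreal_le_iff measure_nonneg)
        qed
        also have "\<dots> \<le> measure L {s\<in>{0..N}. ?x (S + s) - 0 = ?a i + y}"
        proof (rule L.finite_measure_mono)
          show "{s\<in>space L. \<exists>\<^sub>\<infinity>n. s \<in> E (r n)} \<subseteq> {s\<in>{0..N}. ?x (S + s) - 0 = ?a i + y}"
          proof clarsimp
            fix s assume s: "s \<in> space L" "\<exists>\<^sub>\<infinity>n. s \<in> E (r n)"
            then have sN: "0 \<le> s" "s \<le> N" by (auto simp: L_def space_restrict_space)
            have "(\<lambda>m. X (T m (?a i) \<omega> + s) \<omega> - X (T m (?a i) \<omega> + 0) \<omega>) \<longlonglongrightarrow> X (S + s) \<omega> - X (S + 0) \<omega>"
              by (intro tendsto_diff passage_after[OF S(2) S(3) S(1)] sN) auto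
            from LIMSEQ_subseq_LIMSEQ[OF this r(1)]
            have l: "(\<lambda>n. X (T (r n) (?a i) \<omega> + s) \<omega> - X (T (r n) (?a i) \<omega>) \<omega>) \<longlonglongrightarrow> X (S + s) \<omega> - X S \<omega>"
              by (simp add: o_def)
            have "X (S + s) \<omega> - X S \<omega> = y"
            proof (rule ccontr)
              assume "X (S + s) \<omega> - X S \<omega> \<noteq> y"
              from tendsto_imp_eventually_ne[OF l this] s(2) show False
                by (auto simp: frequently_def cofinite_eq_sequentially E_def elim: eventually_mono)
            qed
            then show "0 \<le> s \<and> s \<le> N \<and> X (S + s) \<omega> = 1 / (1 + real i) + y" using S(4) sN by simp
          qed
        qed (intro sL lm S, auto)
        finally have "ennreal d \<le> emeasure L {s\<in>{0..N}. ?x (S + s) - 0 = ?a i + y}"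
          by (simp add: L.emeasure_eq_measure ennreal_leI)
        also have "\<dots> = emeasure lborel {s\<in>{0..N}. ?x (S + s) - 0 = ?a i + y}"
          by (intro eL lm S) auto
        also have "\<dots> \<le> emeasure lborel ((+) S -` B)"
        proof (rule emeasure_mono)
          show "{s\<in>{0..N}. ?x (S + s) - 0 = ?a i + y} \<subseteq> (+) S -` B"
            using S(1) \<open>S \<le> C\<close> by (auto simp: B_def)
          have "(+) S \<in> borel_measurable borel" by measurable
          from measurable_sets[OF this B] show "(+) S -` B \<in> sets lborel" by simp
        qed
        also have "\<dots> = emeasure (distr lborel borel ((+) S)) B"
          using B by (subst emeasure_distr) auto
        also have "\<dots> = emeasure lborel {s\<in>{0..C + N}. ?x s = ?a i + y}"
          unfolding lborel_distr_plus B_def ..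
        finally show ?thesis .
      qed
      show "finite ?I"
      proof (rule ccontr)
        assume "infinite ?I"
        obtain n :: nat where n: "(C + N) / d < real n" using reals_Archimedean2 by blast
        obtain F where F: "finite F" "card F = n" "F \<subseteq> ?I"
          using infinite_arbitrarily_large[OF \<open>infinite ?I\<close>] by blast
        define b where "b = (\<lambda>i. ?a i + y)"
        have b_inj: "b i = b k \<Longrightarrow> i = k" for i k by (simp add: b_def)
        define L where "L = (\<lambda>i. {s\<in>{0..C + N}. ?x s = b i})"
        have Lm: "L i \<in> sets lborel" for i unfolding sets_lborel L_def by (rule lm0)
        have disj: "disjoint_family_on L F" unfolding disjoint_family_on_def L_def using b_inj by fastforce
        have Lsub: "(\<Union>i\<in>F. L i) \<subseteq> {0..C + N}" unfolding L_def by blast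
        have "ennreal (real n * d) = (\<Sum>i\<in>F. ennreal d)" using F d by (simp add: ennreal_mult ennreal_of_nat_eq_real_of_nat)
        also have "\<dots> \<le> (\<Sum>i\<in>F. emeasure lborel (L i))" using F occ unfolding L_def b_def by (intro sum_mono) blast
        also have "\<dots> = emeasure lborel (\<Union>i\<in>F. L i)"
          using Lm by (intro sum_emeasure[OF _ disj F(1)]) blast
        also have "\<dots> \<le> emeasure lborel {0..C + N}" by (intro emeasure_mono Lsub) simp
        also have "\<dots> = ennreal (C + N)" using C N by simp
        finally have "real n * d \<le> C + N" using C N by (subst (asm) ennreal_le_iff) auto
        then show False using n d by (simp add: field_simps)
      qed
    qed
    then have "AE \<omega> in M. shift 0 \<omega> \<notin> \<Gamma>" using \<Gamma> by (subst (asm) prob_eq_0) auto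
    then show ?thesis
    proof eventually_elim
      case (elim \<omega>) then show ?case using slice[of 0 \<omega>] by (simp add: \<Gamma>_def space_PiM not_le)
    qed
  qed
  have "AE \<omega> in M. \<forall>N k::nat. emeasure lborel {s\<in>{0..real N}. X s \<omega> = y} < ennreal (1 / real (Suc k))"
    unfolding AE_all_countable by (intro allI main) auto
  then show ?thesis
  proof eventually_elim
    case (elim \<omega>)
    have z: "emeasure lborel {s\<in>{0..real N}. X s \<omega> = y} = 0" for N
    proof (rule ccontr)
      assume nz: "emeasure lborel {s\<in>{0..real N}. X s \<omega> = y} \<noteq> 0"
      have "emeasure lborel {s\<in>{0..real N}. X s \<omega> = y} < ennreal 1" using elim[rule_format, of N 0] by simp
      then obtain e where e: "emeasure lborel {s\<in>{0..real N}. X s \<omega> = y} = ennreal e" "0 \<le> e"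
        by (metis ennreal_cases less_irrefl order_less_imp_not_less top.not_eq_extremum ennreal_less_top)
      then have "0 < e" using nz by (cases "e = 0") auto
      then obtain k :: nat where "1 / real (Suc k) < e" using nat_approx_posE by blast
      then have "ennreal (1 / real (Suc k)) \<le> ennreal e" by (intro ennreal_leI) simp
      then show False using elim[rule_format, of N k] e(1) by simp
    qed
    have b: "{s\<in>{0..real N}. X s \<omega> = y} \<in> sets lborel" for N
    proof -
      have "{s\<in>{0..real N}. X s \<omega> = y} = {s\<in>space borel. s \<in> {0..real N} \<and> X (max 0 s) \<omega> = y}" by (auto simp: max_def)
      also have "\<dots> \<in> sets borel" using cadlag_borel_measurable[OF all_cadlag, of \<omega>] by measurable
      finally show ?thesis by simp
    qed
    have "{s. 0 \<le> s \<and> X s \<omega> = y} = (\<Union>N. {s\<in>{0..real N}. X s \<omega> = y})"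
      using real_arch_simple by auto
    also have "emeasure lborel \<dots> = 0"
      by (rule emeasure_UN_eq_0) (use z b in auto)
    finally show ?case .
  qed
qed

end

section \<open>Local maxima at a common level\<close>

text \<open>The supremum over \<open>{a..b}\<close>, taken along rational fractions and in the extended reals so that it is
  measurable on the space of all paths.\<close>

definition path_sup :: "real \<Rightarrow> real \<Rightarrow> (real \<Rightarrow> real) \<Rightarrow> ereal" where
  "path_sup a b x = (SUP q\<in>\<rat> \<inter> {0..1}. ereal (x (a + (b - a) * q)))"

lemma path_sup_measurable [measurable]: "path_sup a b \<in> borel_measurable path_space"
  unfolding path_sup_def
  by (intro borel_measurable_SUP) (auto intro: countable_subset[OF _ countable_rat])

lemma path_sup_cadlag:
  assumes x: "cadlag x" and ab: "0 \<le> a" "a \<le> b"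
  shows "path_sup a b x = (SUP s\<in>{a..b}. ereal (x s))"
proof (rule antisym)
  show "path_sup a b x \<le> (SUP s\<in>{a..b}. ereal (x s))"
    unfolding path_sup_def
  proof (rule SUP_mono)
    fix q :: real assume q: "q \<in> \<rat> \<inter> {0..1}"
    have "(b - a) * q \<le> (b - a) * 1" using ab q by (intro mult_left_mono) auto
    then have "a + (b - a) * q \<in> {a..b}" using ab q by auto
    then show "\<exists>m\<in>{a..b}. ereal (x (a + (b - a) * q)) \<le> ereal (x m)" by (intro bexI[of _ "a + (b - a) * q"]) auto
  qed
  show "(SUP s\<in>{a..b}. ereal (x s)) \<le> path_sup a b x"
  proof (rule SUP_least)
    fix s assume s: "s \<in> {a..b}"
    have up: "ereal (x (a + (b - a) * q)) \<le> path_sup a b x" if "q \<in> \<rat> \<inter> {0..1}" for q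
      unfolding path_sup_def using that by (intro SUP_upper)
    show "ereal (x s) \<le> path_sup a b x"
    proof (cases "s = b")
      case True then show ?thesis using up[of 1] by simp
    next
      case False
      then have ab': "a < b" using s by auto
      define u where "u = (s - a) / (b - a)"
      have u: "0 \<le> u" "u < 1" "s = a + (b - a) * u" using s False ab' by (auto simp: u_def field_simps)
      obtain q' where q': "\<And>n::nat. q' n \<in> \<rat>" "\<And>n. u < q' n" "\<And>n. q' n < 1" and ql: "q' \<longlonglongrightarrow> u"
        using rational_sequence_right[OF u(2)] by blast
      have "(\<lambda>n. x (a + (b - a) * q' n)) \<longlonglongrightarrow> x s"
        using s ab u(3) q'(2) ab' ql by (intro cadlag_seq_right[OF x]) (auto intro!: tendsto_intros mult_left_mono less_imp_le)
      then have lim: "(\<lambda>n. ereal (x (a + (b - a) * q' n))) \<longlonglongrightarrow> ereal (x s)" by simp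
      have "ereal (x (a + (b - a) * q' n)) \<le> path_sup a b x" for n
        using q'[of n] u(1) by (intro up) auto
      then show ?thesis by (intro LIMSEQ_le_const2[OF lim]) blast
    qed
  qed
qed

lemma path_sup_real:
  assumes x: "cadlag x" and ab: "0 \<le> a" "a \<le> b"
  shows "\<exists>v. path_sup a b x = ereal v"
proof -
  obtain C where C: "\<And>s. s \<in> {a..b} \<Longrightarrow> \<bar>x s\<bar> \<le> C" using cadlag_bounded[OF x ab(1)] by blast
  have "path_sup a b x \<le> ereal C" unfolding path_sup_cadlag[OF assms]
    by (intro SUP_least) (use C in \<open>force simp: abs_le_iff\<close>)
  moreover have "ereal (x a) \<le> path_sup a b x" unfolding path_sup_cadlag[OF assms]
    using ab by (intro SUP_upper) auto
  ultimately show ?thesis by (cases "path_sup a b x") auto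
qed

lemma path_sup_mono:
  assumes "cadlag x" "0 \<le> a'" "a' \<le> a" "a \<le> b" "b \<le> b'"
  shows "path_sup a b x \<le> path_sup a' b' x"
  using assms by (simp add: path_sup_cadlag SUP_subset_mono)

text \<open>The second condition, on the interval enlarged by \<open>\<eta>\<close> on both sides, makes the supremum over
  \<open>{c + \<eta>..d}\<close> that of a local maximum.  Without it ties can have positive probability: if \<open>X\<close> is a
  unit drift minus a Poisson process and \<open>d = b + 1\<close>, a single jump just after \<open>b\<close> makes the value at
  \<open>d\<close> equal to that at \<open>b\<close>.\<close>

definition no_ties :: "(real \<Rightarrow> real) \<Rightarrow> bool" where
  "no_ties x \<longleftrightarrow> (\<forall>a b c d \<eta> :: rat. 0 \<le> a \<longrightarrow> a \<le> b \<longrightarrow> b \<le> c \<longrightarrow> 0 < \<eta> \<longrightarrow> c + \<eta> \<le> d \<longrightarrow>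
     \<not> (path_sup (of_rat (c + \<eta>)) (of_rat d) x = path_sup (of_rat a) (of_rat b) x
        \<and> path_sup (of_rat c) (of_rat (d + \<eta>)) x \<le> path_sup (of_rat a) (of_rat b) x))"

definition no_max_at_zero :: "(real \<Rightarrow> real) \<Rightarrow> bool" where
  "no_max_at_zero x \<longleftrightarrow> (\<forall>c d \<eta> :: rat. 0 \<le> c \<longrightarrow> 0 < \<eta> \<longrightarrow> c + \<eta> \<le> d \<longrightarrow>
     \<not> (path_sup (of_rat (c + \<eta>)) (of_rat d) x = 0 \<and> path_sup (of_rat c) (of_rat (d + \<eta>)) x \<le> 0))"

lemma path_sup_eq:
  assumes x: "cadlag x" and l: "0 \<le> a" "a < l \<or> a = 0" "a \<le> l" "l \<le> b" and v: "limit_val x l v" and le: "\<And>s. s \<in> {a..b} \<Longrightarrow> x s \<le> v"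
  shows "path_sup a b x = ereal v"
proof -
  have ab: "a \<le> b" using l by simp
  show ?thesis unfolding path_sup_cadlag[OF x l(1) ab]
  proof (rule antisym)
    show "(SUP s\<in>{a..b}. ereal (x s)) \<le> ereal v" using le by (intro SUP_least) auto
    show "ereal v \<le> (SUP s\<in>{a..b}. ereal (x s))"
    proof (rule ereal_le_epsilon2)
      fix e :: real assume e: "0 < e"
      obtain s where s: "0 \<le> s" "l - (if a < l then l - a else 1) < s" "s \<le> l" "\<bar>x s - v\<bar> < e"
      proof -
        have "0 < (if a < l then l - a else 1)" "0 \<le> l" using l by auto
        from limit_val_approx[OF x this(2) v e this(1)] show ?thesis using that by blast
      qed
      have "s \<in> {a..b}" using s l by (auto split: if_splits)
      then have "ereal (x s) \<le> (SUP s\<in>{a..b}. ereal (x s))" by (intro SUP_upper)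
      moreover have "ereal v \<le> ereal (x s) + ereal e" using s(4) by simp
      ultimately show "ereal v \<le> (SUP s\<in>{a..b}. ereal (x s)) + ereal e"
        using add_right_mono order_trans by blast
    qed
  qed
qed

lemma rational_window:
  assumes "0 \<le> a" "a < l" "l < (e::real)"
  obtains c d h :: rat where "0 \<le> c" "0 < h" "c + h \<le> d"
    "a < of_rat c" "of_rat c + of_rat h < l" "l < of_rat d" "of_rat d + of_rat h < e"
    "(0::real) < of_rat h" "(0::real) \<le> of_rat c"
proof -
  obtain c where c: "a < of_rat c" "of_rat c < l" using of_rat_dense assms(2) by blast
  obtain d where d: "l < of_rat d" "of_rat d < e" using of_rat_dense assms(3) by blast
  have "0 < min (l - of_rat c) (e - of_rat d)" using c d by simp
  then obtain h where h: "0 < real_of_rat h" "of_rat h < min (l - of_rat c) (e - of_rat d)" using of_rat_dense by blast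
  have "real_of_rat 0 \<le> of_rat c" using c assms(1) unfolding of_rat_0 by linarith
  moreover have "real_of_rat 0 < of_rat h" using h by simp
  moreover have "real_of_rat (c + h) \<le> of_rat d" using h d by (simp add: of_rat_add)
  ultimately show ?thesis using c d h by (intro that[of c h d]) (simp_all only: of_rat_less_eq of_rat_less, auto)
qed

lemma no_ties_unique:
  assumes nt: "no_ties x" and x: "cadlag x" and l: "0 \<le> l1" "l1 < l2" "l2 < e"
    and v: "limit_val x l1 v" "limit_val x l2 v" and le: "\<And>s. 0 \<le> s \<Longrightarrow> s \<le> e \<Longrightarrow> x s \<le> v"
  shows False
proof -
  obtain c d h where w: "0 \<le> c" "0 < h" "c + h \<le> d" "l1 < of_rat c" "of_rat c + of_rat h < l2" "l2 < of_rat d"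
    "of_rat d + of_rat h < e" "0 < real_of_rat h" "0 \<le> real_of_rat c"
    using rational_window[OF l] .
  have "path_sup (of_rat (c + h)) (of_rat d) x = ereal v" "path_sup (of_rat c) (of_rat (d + h)) x = ereal v"
    unfolding of_rat_add
    by (intro path_sup_eq[OF x _ _ _ _ v(2)] le; use w in \<open>auto simp del: zero_less_of_rat_iff zero_le_of_rat_iff\<close>)+
  moreover have "path_sup (of_rat 0) (of_rat c) x = ereal v"
    unfolding of_rat_0
    by (intro path_sup_eq[OF x _ _ _ _ v(1)] le; use w l in \<open>auto simp del: zero_less_of_rat_iff zero_le_of_rat_iff\<close>)
  ultimately show False using nt w(1-3) unfolding no_ties_def by (metis order_refl)
qed

lemma no_max_at_zero_contra:
  assumes nt: "no_max_at_zero x" and x: "cadlag x" and l: "0 \<le> \<rho>" "\<rho> < l" "l < e"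
    and v: "limit_val x l 0" and le: "\<And>s. \<rho> \<le> s \<Longrightarrow> s \<le> e \<Longrightarrow> x s \<le> 0"
  shows False
proof -
  obtain c d h where w: "0 \<le> c" "0 < h" "c + h \<le> d" "\<rho> < of_rat c" "of_rat c + of_rat h < l" "l < of_rat d"
    "of_rat d + of_rat h < e" "0 < real_of_rat h" "0 \<le> real_of_rat c"
    using rational_window[OF l] .
  have "path_sup (of_rat (c + h)) (of_rat d) x = ereal 0" "path_sup (of_rat c) (of_rat (d + h)) x = ereal 0"
    unfolding of_rat_add
    by (intro path_sup_eq[OF x _ _ _ _ v] le; use w in \<open>auto simp del: zero_less_of_rat_iff zero_le_of_rat_iff\<close>)+
  then show False using nt w(1-3) unfolding no_max_at_zero_def by (metis order_refl zero_ereal_def)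
qed

locale diffuse_levy = cadlag_levy +
  assumes levels_null: "\<And>y. AE \<omega> in M. emeasure lborel {s. 0 \<le> s \<and> X s \<omega> = y} = 0"
begin

lemma joint_measurable: "(\<lambda>p. X (max 0 (fst p)) (snd p)) \<in> borel_measurable (borel \<Otimes>\<^sub>M M)"
proof (rule borel_measurable_LIMSEQ_real)
  show "(\<lambda>m. X (dy m (max 0 (fst p))) (snd p)) \<longlonglongrightarrow> X (max 0 (fst p)) (snd p)" for p
    by (rule cadlag_dy[OF all_cadlag]) simp
  fix m
  have [measurable]: "(\<lambda>p. X (max 0 (real_of_int i / 2 ^ m)) (snd p)) \<in> borel_measurable (borel \<Otimes>\<^sub>M M)" for i
    by (rule measurable_compose[OF measurable_snd measurable_X]) simp
  have "(\<lambda>p. X (max 0 (real_of_int \<lceil>max 0 (fst p :: real) * 2 ^ m\<rceil> / 2 ^ m)) (snd p)) \<in> borel_measurable (borel \<Otimes>\<^sub>M M)"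
    by (rule measurable_compose_countable[of "\<lambda>i p. X (max 0 (real_of_int i / 2 ^ m)) (snd p)"]) measurable
  moreover have "max 0 (real_of_int \<lceil>max 0 s * 2 ^ m\<rceil> / 2 ^ m) = dy m (max 0 s)" for s
  proof -
    have "0 \<le> dy m (max 0 s)" using dy_ge[of "max 0 s" m] by simp
    then show ?thesis by (simp add: dy_def)
  qed
  ultimately show "(\<lambda>p. X (dy m (max 0 (fst p))) (snd p)) \<in> borel_measurable (borel \<Otimes>\<^sub>M M)" by simp
qed

abbreviation "sp a b \<omega> \<equiv> path_sup a b (\<lambda>t. X t \<omega>)"

lemma path_sup_shift:
  assumes "0 \<le> t" "0 \<le> a" "a \<le> b"
  shows "sp (t + a) (t + b) \<omega> = ereal (X t \<omega>) + path_sup a b (shift t \<omega>)"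
proof -
  have "path_sup (t + a) (t + b) (\<lambda>t. X t \<omega>) = (SUP q\<in>\<rat> \<inter> {0..1}. ereal (X t \<omega>) + ereal (shift t \<omega> (a + (b - a) * q)))"
    unfolding path_sup_def
  proof (rule SUP_cong)
    fix q :: real assume "q \<in> \<rat> \<inter> {0..1}"
    then have "0 \<le> a + (b - a) * q" using assms by auto
    then show "ereal (X (t + a + (t + b - (t + a)) * q) \<omega>) = ereal (X t \<omega>) + ereal (shift t \<omega> (a + (b - a) * q))"
      by (simp add: shift_def add.assoc)
  qed simp
  also have "\<dots> = ereal (X t \<omega>) + path_sup a b (shift t \<omega>)"
    unfolding path_sup_def by (rule SUP_ereal_add_right) (auto intro!: exI[of _ 0])
  finally show ?thesis .
qed

lemma path_sup_shift0: "0 \<le> a \<Longrightarrow> a \<le> b \<Longrightarrow> path_sup a b (shift 0 \<omega>) = sp a b \<omega>"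
  using path_sup_shift[of 0 a b \<omega>] by (simp add: zero_ereal_def[symmetric])

lemma path_sup_pre: 
  assumes "0 \<le> a" "a \<le> b" shows "path_sup a b (pre b \<omega>) = sp a b \<omega>"
  unfolding path_sup_def
proof (rule SUP_cong)
  fix q :: real assume q: "q \<in> \<rat> \<inter> {0..1}"
  have "(b - a) * q \<le> (b - a) * 1" using assms q by (intro mult_left_mono) auto
  moreover have "0 \<le> a + (b - a) * q" using assms q by auto
  ultimately show "ereal (pre b \<omega> (a + (b - a) * q)) = ereal (X (a + (b - a) * q) \<omega>)"
    by (simp add: pre_def min_absorb1)
qed simp

lemma sp_measurable [measurable]:
  assumes "0 \<le> a" "a \<le> b" shows "(\<lambda>\<omega>. sp a b \<omega>) \<in> borel_measurable M"
proof -
  have "(\<lambda>\<omega>. path_sup a b (shift 0 \<omega>)) \<in> borel_measurable M"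
    by (rule measurable_compose[OF shift_measurable path_sup_measurable]) simp
  then show ?thesis using path_sup_shift0[OF assms] by simp
qed

text \<open>On the event, \<open>y\<close> is also the supremum over \<open>{c + h..d + h}\<close> for every \<open>h\<close> in \<open>{0..\<eta>}\<close>, that is,
  \<open>X (c + h)\<close> plus an independent variable whose law does not depend on \<open>h\<close>.  Averaged over \<open>h\<close>, the
  probability that this sum equals \<open>y\<close> is the mean time spent at a random independent height, which is
  zero.\<close>

lemma local_max_at_level_null:
  assumes c: "0 \<le> c" "0 < \<eta>" "c + \<eta> \<le> d"
  shows "prob {\<omega>\<in>space M. sp (c + \<eta>) d \<omega> = ereal y \<and> sp c (d + \<eta>) \<omega> \<le> ereal y} = 0"
proof -
  interpret P: pair_prob_space M M ..
  let ?E = "{\<omega>\<in>space M. sp (c + \<eta>) d \<omega> = ereal y \<and> sp c (d + \<eta>) \<omega> \<le> ereal y}"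
  let ?W = "\<lambda>\<omega>. sp 0 (d - c) \<omega>"
  have cd: "0 \<le> d - c" using c by simp
  have E[measurable]: "?E \<in> sets M"
  proof -
    have [measurable]: "(\<lambda>\<omega>. sp (c+\<eta>) d \<omega>) \<in> borel_measurable M" "(\<lambda>\<omega>. sp c (d+\<eta>) \<omega>) \<in> borel_measurable M" using c by auto
    show ?thesis by measurable
  qed
  define G where "G = {p\<in>space (lborel \<Otimes>\<^sub>M (M \<Otimes>\<^sub>M M)). fst p \<in> {0..\<eta>} \<and>
     ereal (X (c + max 0 (fst p)) (fst (snd p))) + ?W (snd (snd p)) = ereal y}"
  have G: "G \<in> sets (lborel \<Otimes>\<^sub>M (M \<Otimes>\<^sub>M M))"
  proof -
    have "(\<lambda>p. X (max 0 (c + max 0 (fst p))) (fst (snd p))) \<in> borel_measurable (lborel \<Otimes>\<^sub>M (M \<Otimes>\<^sub>M M))"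
    proof -
      have "(\<lambda>p. (c + max 0 (fst p), fst (snd p))) \<in> measurable (lborel \<Otimes>\<^sub>M (M \<Otimes>\<^sub>M M)) (borel \<Otimes>\<^sub>M M)" by measurable
      from measurable_compose[OF this joint_measurable] show ?thesis by simp
    qed
    then have [measurable]: "(\<lambda>p. X (c + max 0 (fst p)) (fst (snd p))) \<in> borel_measurable (lborel \<Otimes>\<^sub>M (M \<Otimes>\<^sub>M M))" using c by simp
    have [measurable]: "(\<lambda>p. ?W (snd (snd p))) \<in> borel_measurable (lborel \<Otimes>\<^sub>M (M \<Otimes>\<^sub>M M))"
      using sp_measurable[OF order_refl cd] by measurable
    show ?thesis unfolding G_def by measurable
  qed
  have lower: "ennreal (prob ?E) \<le> emeasure (M \<Otimes>\<^sub>M M) (Pair h -` G)" if h: "h \<in> {0..\<eta>}" for h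
  proof -
    define F where "F = {(w1, w2)\<in>space (path_space \<Otimes>\<^sub>M path_space). ereal (w1 (c + h)) + path_sup 0 (d - c) w2 = ereal y}"
    have F: "F \<in> sets (path_space \<Otimes>\<^sub>M path_space)"
    proof -
      have "{p\<in>space (path_space \<Otimes>\<^sub>M path_space). ereal (fst p (c + h)) + path_sup 0 (d - c) (snd p) = ereal y} \<in> sets (path_space \<Otimes>\<^sub>M path_space)"
        by measurable
      then show ?thesis by (simp add: F_def case_prod_unfold)
    qed
    have ch: "0 \<le> c + h" using c h by simp
    have "?E \<subseteq> {\<omega>\<in>space M. (pre (c + h) \<omega>, shift (c + h) \<omega>) \<in> F}"
    proof
      fix \<omega> assume w: "\<omega> \<in> ?E"
      have "sp (c + h) (d + h) \<omega> = ereal y"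
      proof (rule antisym)
        show "sp (c + h) (d + h) \<omega> \<le> ereal y"
          using w path_sup_mono[OF all_cadlag, of c "c + h" "d + h" "d + \<eta>" \<omega>] c h by (auto intro: order_trans)
        show "ereal y \<le> sp (c + h) (d + h) \<omega>"
          using w path_sup_mono[OF all_cadlag, of "c + h" "c + \<eta>" d "d + h" \<omega>] c h by auto
      qed
      then show "\<omega> \<in> {\<omega>\<in>space M. (pre (c + h) \<omega>, shift (c + h) \<omega>) \<in> F}"
        using w path_sup_shift[OF ch order_refl cd, of \<omega>] ch
        by (auto simp: F_def space_pair_measure space_PiM pre_def algebra_simps)
    qed
    then have "prob ?E \<le> prob {\<omega>\<in>space M. (pre (c + h) \<omega>, shift (c + h) \<omega>) \<in> F}"
    proof (rule finite_measure_mono)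
      have "(\<lambda>\<omega>. (pre (c + h) \<omega>, shift (c + h) \<omega>)) \<in> measurable M (path_space \<Otimes>\<^sub>M path_space)" using ch by measurable
      from measurable_sets[OF this F] show "{\<omega>\<in>space M. (pre (c + h) \<omega>, shift (c + h) \<omega>) \<in> F} \<in> sets M"
        by (simp add: vimage_def Int_def conj_commute)
    qed
    also have "\<dots> = measure (M \<Otimes>\<^sub>M M) {x\<in>space (M \<Otimes>\<^sub>M M). (pre (c + h) (fst x), shift 0 (snd x)) \<in> F}"
      by (rule markov_pair[OF ch F])
    also have "{x\<in>space (M \<Otimes>\<^sub>M M). (pre (c + h) (fst x), shift 0 (snd x)) \<in> F} = Pair h -` G"
      using ch h path_sup_shift0[OF order_refl cd]
      by (auto simp: F_def G_def space_pair_measure space_PiM pre_def)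
    finally show ?thesis by (simp add: P.emeasure_eq_measure ennreal_leI)
  qed
  have "ennreal (prob ?E) * ennreal \<eta> = (\<integral>\<^sup>+h. ennreal (prob ?E) * indicator {0..\<eta>} h \<partial>lborel)"
    using c by (subst nn_integral_cmult_indicator) auto
  also have "\<dots> \<le> (\<integral>\<^sup>+h. emeasure (M \<Otimes>\<^sub>M M) (Pair h -` G) \<partial>lborel)"
    using lower by (intro nn_integral_mono) (auto simp: indicator_def)
  also have "\<dots> = emeasure (lborel \<Otimes>\<^sub>M (M \<Otimes>\<^sub>M M)) G"
    by (rule P.emeasure_pair_measure_alt[symmetric, OF G])
  also have "\<dots> = 0"
  proof -
    interpret Q: pair_sigma_finite lborel "M \<Otimes>\<^sub>M M" ..
    have "emeasure (lborel \<Otimes>\<^sub>M (M \<Otimes>\<^sub>M M)) G = (\<integral>\<^sup>+x. emeasure lborel ((\<lambda>h. (h, x)) -` G) \<partial>(M \<Otimes>\<^sub>M M))"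
      by (rule Q.emeasure_pair_measure_alt2[OF G])
    also have "\<dots> = (\<integral>\<^sup>+\<omega>2. (\<integral>\<^sup>+\<omega>1. emeasure lborel ((\<lambda>h. (h, (\<omega>1, \<omega>2))) -` G) \<partial>M) \<partial>M)"
      by (rule P.nn_integral_snd[symmetric]) (rule Q.measurable_emeasure_Pair2[OF G])
    also have "\<dots> = (\<integral>\<^sup>+\<omega>2. 0 \<partial>M)"
    proof (rule nn_integral_cong)
      fix \<omega>2 assume w2: "\<omega>2 \<in> space M"
      obtain z where z: "?W \<omega>2 = ereal z" using path_sup_real[OF all_cadlag, of 0 "d - c" \<omega>2] cd by auto
      have "AE \<omega>1 in M. emeasure lborel ((\<lambda>h. (h, (\<omega>1, \<omega>2))) -` G) = 0"
        using levels_null[of "y - z"]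
      proof eventually_elim
        case (elim \<omega>1)
        have S: "{s. 0 \<le> s \<and> X s \<omega>1 = y - z} \<in> sets lborel"
        proof -
          have "{s. 0 \<le> s \<and> X s \<omega>1 = y - z} = {s\<in>space borel. 0 \<le> s \<and> X (max 0 s) \<omega>1 = y - z}" by (auto simp: max_def)
          also have "\<dots> \<in> sets borel" using cadlag_borel_measurable[OF all_cadlag, of \<omega>1] by measurable
          finally show ?thesis by simp
        qed
        have "(\<lambda>h. (h, (\<omega>1, \<omega>2))) -` G \<subseteq> (+) c -` {s. 0 \<le> s \<and> X s \<omega>1 = y - z}"
          using c by (auto simp: G_def z)
        then have "emeasure lborel ((\<lambda>h. (h, (\<omega>1, \<omega>2))) -` G) \<le> emeasure lborel ((+) c -` {s. 0 \<le> s \<and> X s \<omega>1 = y - z})"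
        proof (rule emeasure_mono)
          have "(+) c \<in> borel_measurable borel" by measurable
          from measurable_sets[OF this S[unfolded sets_lborel]]
          show "(+) c -` {s. 0 \<le> s \<and> X s \<omega>1 = y - z} \<in> sets lborel" by (simp only: space_borel Int_UNIV_right sets_lborel)
        qed
        also have "\<dots> = emeasure (distr lborel borel ((+) c)) {s. 0 \<le> s \<and> X s \<omega>1 = y - z}"
          using S by (subst emeasure_distr) auto
        also have "\<dots> = 0" unfolding lborel_distr_plus by (rule elim)
        finally show ?case by simp
      qed
      then have "(\<integral>\<^sup>+\<omega>1. emeasure lborel ((\<lambda>h. (h, (\<omega>1, \<omega>2))) -` G) \<partial>M) = (\<integral>\<^sup>+\<omega>1. 0 \<partial>M)"
        by (rule nn_integral_cong_AE)
      then show "(\<integral>\<^sup>+\<omega>1. emeasure lborel ((\<lambda>h. (h, (\<omega>1, \<omega>2))) -` G) \<partial>M) = 0" by simp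
    qed
    finally show ?thesis by simp
  qed
  finally have "ennreal (prob ?E) * ennreal \<eta> = 0" by simp
  then show ?thesis using c by (simp add: measure_le_0_iff)
qed

text \<open>Given the past of \<open>b\<close>, the supremum over \<open>{a..b}\<close> is a prescribed height for the process after \<open>b\<close>.\<close>

lemma tie_null:
  assumes a: "0 \<le> a" "a \<le> b" "b \<le> c" "0 < \<eta>" "c + \<eta> \<le> d"
  shows "prob {\<omega>\<in>space M. sp (c + \<eta>) d \<omega> = sp a b \<omega> \<and> sp c (d + \<eta>) \<omega> \<le> sp a b \<omega>} = 0"
proof -
  interpret P: pair_prob_space M M ..
  have b: "0 \<le> b" using a by simp
  define F where "F = {p\<in>space (path_space \<Otimes>\<^sub>M path_space).
     ereal (fst p b) + path_sup (c - b + \<eta>) (d - b) (snd p) = path_sup a b (fst p) \<and>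
     ereal (fst p b) + path_sup (c - b) (d - b + \<eta>) (snd p) \<le> path_sup a b (fst p)}"
  have F: "F \<in> sets (path_space \<Otimes>\<^sub>M path_space)"
  proof -
    have [measurable]: "(\<lambda>p. path_sup a b (fst p)) \<in> borel_measurable (path_space \<Otimes>\<^sub>M path_space)"
      "(\<lambda>p. ereal (fst p b) + path_sup (c - b + \<eta>) (d - b) (snd p)) \<in> borel_measurable (path_space \<Otimes>\<^sub>M path_space)"
      "(\<lambda>p. ereal (fst p b) + path_sup (c - b) (d - b + \<eta>) (snd p)) \<in> borel_measurable (path_space \<Otimes>\<^sub>M path_space)"
      by measurable
    show ?thesis unfolding F_def
      by (intro sets.sets_Collect_conj borel_measurable_eq borel_measurable_le) measurable
  qed
  have eq1: "sp (c + \<eta>) d \<omega> = ereal (X b \<omega>) + path_sup (c - b + \<eta>) (d - b) (shift b \<omega>)" for \<omega>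
    using path_sup_shift[OF b, of "c - b + \<eta>" "d - b" \<omega>] a by (simp add: algebra_simps)
  have eq2: "sp c (d + \<eta>) \<omega> = ereal (X b \<omega>) + path_sup (c - b) (d - b + \<eta>) (shift b \<omega>)" for \<omega>
    using path_sup_shift[OF b, of "c - b" "d - b + \<eta>" \<omega>] a by (simp add: algebra_simps)
  have preb: "pre b \<omega> b = X b \<omega>" for \<omega> using b by (simp add: pre_def)
  have "prob {\<omega>\<in>space M. sp (c + \<eta>) d \<omega> = sp a b \<omega> \<and> sp c (d + \<eta>) \<omega> \<le> sp a b \<omega>}
    = prob {\<omega>\<in>space M. (pre b \<omega>, shift b \<omega>) \<in> F}"
    unfolding eq1 eq2 F_def using path_sup_pre[OF a(1,2)] preb
    by (intro arg_cong[of _ _ prob]) (auto simp: space_pair_measure space_PiM)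
  also have "\<dots> = measure (M \<Otimes>\<^sub>M M) {x\<in>space (M \<Otimes>\<^sub>M M). (pre b (fst x), shift 0 (snd x)) \<in> F}" (is "_ = measure _ ?S")
    by (rule markov_pair[OF b F])
  also have "\<dots> = 0"
  proof -
    have S: "?S \<in> sets (M \<Otimes>\<^sub>M M)"
    proof -
      have "(\<lambda>x. (pre b (fst x), shift 0 (snd x))) \<in> measurable (M \<Otimes>\<^sub>M M) (path_space \<Otimes>\<^sub>M path_space)" using b by measurable
      from measurable_sets[OF this F] show ?thesis by (simp add: vimage_def Int_def conj_commute)
    qed
    have "emeasure (M \<Otimes>\<^sub>M M) ?S = (\<integral>\<^sup>+\<omega>1. emeasure M (Pair \<omega>1 -` ?S) \<partial>M)"
      by (rule emeasure_pair_measure_alt[OF S])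
    also have "\<dots> = (\<integral>\<^sup>+\<omega>1. 0 \<partial>M)"
    proof (rule nn_integral_cong)
      fix \<omega>1 assume w1: "\<omega>1 \<in> space M"
      obtain v where v: "sp a b \<omega>1 = ereal v" using path_sup_real[OF all_cadlag, of a b \<omega>1] a by auto
      have 1: "ereal (X b \<omega>1) + s = ereal v \<longleftrightarrow> s = ereal (v - X b \<omega>1)"
        and 2: "ereal (X b \<omega>1) + s \<le> ereal v \<longleftrightarrow> s \<le> ereal (v - X b \<omega>1)" for s
        by (cases s; auto)+
      have "Pair \<omega>1 -` ?S = {\<omega>\<in>space M. sp (c - b + \<eta>) (d - b) \<omega> = ereal (v - X b \<omega>1) \<and> sp (c - b) (d - b + \<eta>) \<omega> \<le> ereal (v - X b \<omega>1)}"
        using w1 a path_sup_pre[OF a(1,2)] preb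
        by (auto simp: F_def space_pair_measure space_PiM v path_sup_shift0 1 2)
      then show "emeasure M (Pair \<omega>1 -` ?S) = 0"
        using local_max_at_level_null[of "c - b" \<eta> "d - b" "v - X b \<omega>1"] a by (simp add: emeasure_eq_measure)
    qed
    finally show ?thesis by (simp add: measure_def)
  qed
  finally show ?thesis .
qed

lemma AE_no_ties: "AE \<omega> in M. no_ties (\<lambda>t. X t \<omega>)"
  unfolding no_ties_def AE_all_countable
proof (intro allI AE_impI)
  fix a b c d \<eta> :: rat assume h: "0 \<le> a" "a \<le> b" "b \<le> c" "0 < \<eta>" "c + \<eta> \<le> d"
  have h': "0 \<le> real_of_rat a" "real_of_rat a \<le> of_rat b" "real_of_rat b \<le> of_rat c" "0 < real_of_rat \<eta>" "real_of_rat c + of_rat \<eta> \<le> of_rat d"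
    using h by (simp_all add: of_rat_less_eq of_rat_less zero_le_of_rat_iff flip: of_rat_add)
  let ?E = "{\<omega>\<in>space M. sp (of_rat c + of_rat \<eta>) (of_rat d) \<omega> = sp (of_rat a) (of_rat b) \<omega> \<and> sp (of_rat c) (of_rat d + of_rat \<eta>) \<omega> \<le> sp (of_rat a) (of_rat b) \<omega>}"
  have "?E \<in> sets M"
  proof -
    have [measurable]: "(\<lambda>\<omega>. sp (of_rat c + of_rat \<eta>) (of_rat d) \<omega>) \<in> borel_measurable M"
      "(\<lambda>\<omega>. sp (of_rat c) (of_rat d + of_rat \<eta>) \<omega>) \<in> borel_measurable M"
      "(\<lambda>\<omega>. sp (of_rat a) (of_rat b) \<omega>) \<in> borel_measurable M" by (rule sp_measurable; use h' in linarith)+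
    show ?thesis by measurable
  qed
  then have "AE \<omega> in M. \<omega> \<notin> ?E" using tie_null[OF h'] by (subst prob_eq_0[symmetric]) auto
  then show "AE \<omega> in M. \<not> (sp (of_rat (c + \<eta>)) (of_rat d) \<omega> = sp (of_rat a) (of_rat b) \<omega>
        \<and> sp (of_rat c) (of_rat (d + \<eta>)) \<omega> \<le> sp (of_rat a) (of_rat b) \<omega>)"
    using AE_space by eventually_elim (simp add: of_rat_add)
qed

lemma AE_no_max_at_zero: "AE \<omega> in M. no_max_at_zero (\<lambda>t. X t \<omega>)"
  unfolding no_max_at_zero_def AE_all_countable
proof (intro allI AE_impI)
  fix c d \<eta> :: rat assume h: "0 \<le> c" "0 < \<eta>" "c + \<eta> \<le> d"
  have h': "0 \<le> real_of_rat c" "0 < real_of_rat \<eta>" "real_of_rat c + of_rat \<eta> \<le> of_rat d"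
    using h by (simp_all add: of_rat_less_eq of_rat_less zero_le_of_rat_iff flip: of_rat_add)
  let ?E = "{\<omega>\<in>space M. sp (of_rat c + of_rat \<eta>) (of_rat d) \<omega> = ereal 0 \<and> sp (of_rat c) (of_rat d + of_rat \<eta>) \<omega> \<le> ereal 0}"
  have "?E \<in> sets M"
  proof -
    have [measurable]: "(\<lambda>\<omega>. sp (of_rat c + of_rat \<eta>) (of_rat d) \<omega>) \<in> borel_measurable M"
      "(\<lambda>\<omega>. sp (of_rat c) (of_rat d + of_rat \<eta>) \<omega>) \<in> borel_measurable M" by (rule sp_measurable; use h' in linarith)+
    show ?thesis by measurable
  qed
  then have "AE \<omega> in M. \<omega> \<notin> ?E" using local_max_at_level_null[OF h'] by (subst prob_eq_0[symmetric]) auto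
  then show "AE \<omega> in M. \<not> (sp (of_rat (c + \<eta>)) (of_rat d) \<omega> = 0 \<and> sp (of_rat c) (of_rat (d + \<eta>)) \<omega> \<le> 0)"
    using AE_space by eventually_elim (simp add: of_rat_add zero_ereal_def)
qed

end

lemma (in diffuse_levy) diffuse_uminus: "diffuse_levy M (\<lambda>t \<omega>. - X t \<omega>)"
proof -
  interpret N: cadlag_levy M "\<lambda>t \<omega>. 0 * t + (-1) * X t \<omega>" by (rule affine)
  have "cadlag_levy M (\<lambda>t \<omega>. - X t \<omega>)" using N.cadlag_levy_axioms by simp
  moreover have "AE \<omega> in M. emeasure lborel {s. 0 \<le> s \<and> - X s \<omega> = y} = 0" for y
  proof -
    have "{s. 0 \<le> s \<and> - X s \<omega> = y} = {s. 0 \<le> s \<and> X s \<omega> = - y}" for \<omega> by auto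
    then show ?thesis using levels_null[of "- y"] by simp
  qed
  ultimately show ?thesis by (intro diffuse_levy.intro diffuse_levy_axioms.intro) 
qed

sublocale spectrally_negative \<subseteq> diffuse_levy
  by standard (rule level_null)

section \<open>Functionals of a path and of its discrete skeleton\<close>

text \<open>Subtracting the chord makes the walk end where it starts, so that it can be rotated.\<close>

definition bridge :: "nat \<Rightarrow> (nat \<Rightarrow> real) \<Rightarrow> nat \<Rightarrow> real" where
  "bridge k S j = S j - real j / real k * S k"

definition maxima :: "nat \<Rightarrow> (nat \<Rightarrow> real) \<Rightarrow> nat set" where
  "maxima k S = {j. j < k \<and> (\<forall>i<k. bridge k S i \<le> bridge k S j)}"

definition argmax_lo :: "nat \<Rightarrow> (nat \<Rightarrow> real) \<Rightarrow> nat" where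
  "argmax_lo k S = (if k = 0 then 0 else Min (maxima k S))"

text \<open>One more than the last position of the maximum: the upper functionals have to dominate the \<open>k\<close>
  values \<open>1, \<dots>, k\<close>, the lower ones are dominated by \<open>0, \<dots>, k - 1\<close>.\<close>

definition argmax_hi :: "nat \<Rightarrow> (nat \<Rightarrow> real) \<Rightarrow> nat" where
  "argmax_hi k S = (if k = 0 then 0 else Suc (Max (maxima k S)))"

definition rank_lo :: "nat \<Rightarrow> (nat \<Rightarrow> real) \<Rightarrow> nat" where
  "rank_lo k S = card {j. j < k \<and> bridge k S j < 0}"

definition rank_hi :: "nat \<Rightarrow> (nat \<Rightarrow> real) \<Rightarrow> nat" where
  "rank_hi k S = card {j. j < k \<and> bridge k S j \<le> 0}"

lemma finite_maxima [simp]: "finite (maxima k S)"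
  by (simp add: maxima_def)

lemma maxima_nonempty:
  assumes "0 < k" shows "maxima k S \<noteq> {}"
proof -
  have "finite (bridge k S ` {..<k})" "bridge k S ` {..<k} \<noteq> {}" using assms by auto
  from Max_in[OF this] obtain j where "j < k" "bridge k S j = Max (bridge k S ` {..<k})" by auto
  then have "j \<in> maxima k S" by (auto simp: maxima_def)
  then show ?thesis by blast
qed

definition is_argsup :: "(real \<Rightarrow> real) \<Rightarrow> real \<Rightarrow> real \<Rightarrow> real \<Rightarrow> bool" where
  "is_argsup z \<sigma> l v \<longleftrightarrow> 0 \<le> l \<and> l \<le> \<sigma> \<and> limit_val z l v \<and> (\<forall>t. 0 \<le> t \<longrightarrow> t < \<sigma> \<longrightarrow> z t \<le> v)"

lemma dy_nat: "0 \<le> t \<Longrightarrow> dy m t = real (nat \<lceil>t * 2 ^ m\<rceil>) / 2 ^ m"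
  by (simp add: dy_def)

text \<open>A position that maximises the discrete bridge also nearly maximises \<open>z\<close>, because the chord tends
  to \<open>0\<close> uniformly.\<close>

lemma argmax_accumulates:
  assumes z: "cadlag z" and T: "(\<lambda>m. real (k m) / 2 ^ m) \<longlonglongrightarrow> \<sigma>" "\<And>m. real (k m) / 2 ^ m \<le> \<sigma>" and \<sigma>: "0 < \<sigma>"
    and zT: "(\<lambda>m. z (real (k m) / 2 ^ m)) \<longlonglongrightarrow> 0"
    and r: "strict_mono (r::nat\<Rightarrow>nat)" and j: "\<And>n. j (r n) \<in> maxima (k (r n)) (\<lambda>i. z (real i / 2 ^ r n))"
    and l: "(\<lambda>n. real (j (r n)) / 2 ^ r n) \<longlonglongrightarrow> l" and v: "limit_val z l v" "(\<lambda>n. z (real (j (r n)) / 2 ^ r n)) \<longlonglongrightarrow> v"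
  shows "is_argsup z \<sigma> l v"
  unfolding is_argsup_def
proof (intro conjI allI impI)
  have jk: "j (r n) < k (r n)" for n using j[of n] by (auto simp: maxima_def)
  show "0 \<le> l" by (rule LIMSEQ_le_const[OF l]) auto
  show "l \<le> \<sigma>"
  proof (rule LIMSEQ_le_const2[OF l], intro exI[of _ 0] allI impI)
    fix n
    have "real (j (r n)) / 2 ^ r n \<le> real (k (r n)) / 2 ^ r n" using jk[of n] by (simp add: divide_right_mono)
    then show "real (j (r n)) / 2 ^ r n \<le> \<sigma>" using T(2)[of "r n"] by simp
  qed
  show "limit_val z l v" by fact
  fix t assume t: "0 \<le> t" "t < \<sigma>"
  obtain u where u: "t < u" "u < \<sigma>" using dense[OF t(2)] by blast
  have "\<forall>\<^sub>F m in sequentially. dy m t < u" by (rule order_tendstoD(2)[OF dy_tendsto u(1)])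
  moreover have "\<forall>\<^sub>F m in sequentially. u < real (k m) / 2 ^ m" by (rule order_tendstoD(1)[OF T(1) u(2)])
  ultimately have "\<forall>\<^sub>F m in sequentially. dy m t < real (k m) / 2 ^ m" by eventually_elim simp
  then have "\<forall>\<^sub>F n in sequentially. dy (r n) t < real (k (r n)) / 2 ^ r n"
    using r by (rule eventually_subseq[rotated])
  then have ev: "\<forall>\<^sub>F n in sequentially. z (dy (r n) t) \<le> z (real (j (r n)) / 2 ^ r n) + 2 * \<bar>z (real (k (r n)) / 2 ^ r n)\<bar>"
  proof eventually_elim
    case (elim n)
    let ?i = "nat \<lceil>t * 2 ^ r n\<rceil>" and ?k = "k (r n)" and ?j = "j (r n)" and ?S = "\<lambda>i. z (real i / 2 ^ r n)"
    have ik: "?i < ?k" using elim unfolding dy_nat[OF t(1)] by (simp add: divide_less_cancel)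
    have "bridge ?k ?S ?i \<le> bridge ?k ?S ?j" using j[of n] ik by (auto simp: maxima_def)
    then have b: "?S ?i \<le> ?S ?j + real ?i / real ?k * ?S ?k - real ?j / real ?k * ?S ?k" by (simp add: bridge_def)
    have c: "\<bar>real q / real ?k * ?S ?k\<bar> \<le> \<bar>?S ?k\<bar>" if "q < ?k" for q
    proof -
      have "real q / real ?k \<le> 1" using that by simp
      then have "\<bar>real q / real ?k\<bar> * \<bar>?S ?k\<bar> \<le> 1 * \<bar>?S ?k\<bar>" by (intro mult_right_mono) auto
      then show ?thesis by (simp add: abs_mult)
    qed
    have "z a \<le> y + p - q \<Longrightarrow> \<bar>p\<bar> \<le> w \<Longrightarrow> \<bar>q\<bar> \<le> w \<Longrightarrow> z a \<le> y + 2 * w" for a y p q w by linarith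
    from this[OF b c[OF ik] c[OF jk[of n]]] show ?case unfolding dy_nat[OF t(1)] .
  qed
  have "(\<lambda>n. z (dy (r n) t)) \<longlonglongrightarrow> z t"
    using LIMSEQ_subseq_LIMSEQ[OF cadlag_dy[OF z t(1)] r] by (simp add: o_def)
  moreover have "(\<lambda>n. z (real (j (r n)) / 2 ^ r n) + 2 * \<bar>z (real (k (r n)) / 2 ^ r n)\<bar>) \<longlonglongrightarrow> v + 2 * \<bar>0\<bar>"
    using LIMSEQ_subseq_LIMSEQ[OF zT r] by (intro tendsto_intros v) (simp add: o_def)
  ultimately have "z t \<le> v + 2 * \<bar>0\<bar>" by (intro tendsto_le[OF _ _ _ ev]) auto
  then show "z t \<le> v" by simp
qed

lemma argmax_converges:
  assumes z: "cadlag z" and T: "(\<lambda>m. real (k m) / 2 ^ m) \<longlonglongrightarrow> \<sigma>" "\<And>m. real (k m) / 2 ^ m \<le> \<sigma>" and \<sigma>: "0 < \<sigma>"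
    and zT: "(\<lambda>m. z (real (k m) / 2 ^ m)) \<longlonglongrightarrow> 0"
    and j: "\<forall>\<^sub>F m in sequentially. j m \<in> maxima (k m) (\<lambda>i. z (real i / 2 ^ m))"
    and uniq: "\<And>l v. is_argsup z \<sigma> l v \<Longrightarrow> l = g"
  shows "(\<lambda>m. real (j m) / 2 ^ m) \<longlonglongrightarrow> g"
proof (rule ccontr)
  let ?s = "\<lambda>m. real (j m) / 2 ^ m"
  let ?J = "\<lambda>m. j m \<in> maxima (k m) (\<lambda>i. z (real i / 2 ^ m))"
  assume "\<not> ?thesis"
  then obtain e where e: "0 < e" "\<not> (\<forall>\<^sub>F m in sequentially. dist (?s m) g < e)" by (auto simp: tendsto_iff)
  then have "\<exists>\<^sub>F m in sequentially. \<not> dist (?s m) g < e" by (simp add: frequently_def)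
  then have "\<exists>\<^sub>F m in sequentially. \<not> dist (?s m) g < e \<and> ?J m"
    using j by (rule frequently_eventually_frequently)
  then have "infinite {m. \<not> dist (?s m) g < e \<and> ?J m}"
    by (simp add: frequently_cofinite flip: cofinite_eq_sequentially)
  from infinite_enumerate[OF this] obtain r :: "nat \<Rightarrow> nat" where
    r: "strict_mono r" "\<And>n. \<not> dist (?s (r n)) g < e" "\<And>n. ?J (r n)" by blast
  have range: "?s (r n) \<in> {0..\<sigma>}" for n
  proof -
    have "j (r n) < k (r n)" using r(3)[of n] by (auto simp: maxima_def)
    then have "?s (r n) \<le> real (k (r n)) / 2 ^ r n" by (simp add: divide_right_mono)
    then show ?thesis using T(2)[of "r n"] by simp
  qed
  obtain q l v where q: "strict_mono (q::nat\<Rightarrow>nat)" "(\<lambda>n. ?s (r (q n))) \<longlonglongrightarrow> l" "limit_val z l v" "(\<lambda>n. z (?s (r (q n)))) \<longlonglongrightarrow> v"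
    using cadlag_subseq_compact[of z 0 "\<lambda>n. ?s (r n)" \<sigma>, OF z order_refl range] by blast
  have "is_argsup z \<sigma> l v"
    using q r(3) strict_mono_o[OF r(1) q(1)]
    by (intro argmax_accumulates[OF z T \<sigma> zT, of "\<lambda>n. r (q n)" j]) (auto simp: o_def)
  then have "l = g" by (rule uniq)
  then have "\<forall>\<^sub>F n in sequentially. dist (?s (r (q n))) g < e" using q(2) e(1) by (auto simp: tendsto_iff)
  then show False using r(2) by simp
qed

definition nice_path :: "(real \<Rightarrow> real) \<Rightarrow> bool" where
  "nice_path x \<longleftrightarrow> good_path x \<and> no_ties x \<and> no_ties (\<lambda>t. - x t) \<and> no_max_at_zero (\<lambda>t. - x t)
     \<and> (\<forall>\<eta>>0. \<exists>s. 0 < s \<and> s < \<eta> \<and> 0 < x s) \<and> emeasure lborel {s. 0 \<le> s \<and> x s = 0} = 0"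

definition last_nonpos :: "nat \<Rightarrow> (real \<Rightarrow> real) \<Rightarrow> nat" where
  "last_nonpos m x = Max {j. x (real j / 2 ^ m) \<le> 0}"

lemma last_nonpos:
  assumes "good_path x"
  shows "finite {j. x (real j / 2 ^ m) \<le> 0}" "x (real (last_nonpos m x) / 2 ^ m) \<le> 0"
    "\<And>j. x (real j / 2 ^ m) \<le> 0 \<Longrightarrow> j \<le> last_nonpos m x"
proof -
  obtain C where C: "0 \<le> C" "\<And>t. C \<le> t \<Longrightarrow> 0 < x t" using good_path_eventually_gt[OF assms] by blast
  have "{j. x (real j / 2 ^ m) \<le> 0} \<subseteq> {.. nat \<lceil>C * 2 ^ m\<rceil>}"
  proof
    fix j assume "j \<in> {j. x (real j / 2 ^ m) \<le> 0}"
    then have "\<not> C \<le> real j / 2 ^ m" using C(2) by force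
    then have "real j < C * 2 ^ m" by (simp add: field_simps)
    then show "j \<in> {.. nat \<lceil>C * 2 ^ m\<rceil>}" by simp linarith
  qed
  then show fin: "finite {j. x (real j / 2 ^ m) \<le> 0}" by (rule finite_subset) simp
  have "0 \<in> {j. x (real j / 2 ^ m) \<le> 0}" using assms by (simp add: good_path_def)
  then have "last_nonpos m x \<in> {j. x (real j / 2 ^ m) \<le> 0}" unfolding last_nonpos_def using Max_in[OF fin] by blast
  then show "x (real (last_nonpos m x) / 2 ^ m) \<le> 0" by simp
  show "j \<le> last_nonpos m x" if "x (real j / 2 ^ m) \<le> 0" for j
    unfolding last_nonpos_def using fin that by (intro Max_ge) auto
qed

context
  fixes x :: "real \<Rightarrow> real"
  assumes gp: "good_path x"
begin

lemma good_path_cadlag: "cadlag x" and good_path_zero: "x 0 = 0"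
  and good_path_jump: "0 < t \<Longrightarrow> x t \<le> Lim (at_left t) x"
  using gp by (auto simp: good_path_def)

lemma bdd_nonpos_times: "bdd_above (nonpos_times x)"
proof -
  obtain C where C: "0 \<le> C" "\<And>t. C \<le> t \<Longrightarrow> 0 < x t" using good_path_eventually_gt[OF gp] by blast
  show ?thesis
  proof (rule bdd_aboveI[of _ C])
    fix t assume "t \<in> nonpos_times x" then show "t \<le> C" using C(2)[of t] by (force simp: nonpos_times_def)
  qed
qed

lemma zero_nonpos_times: "0 \<in> nonpos_times x" by (simp add: nonpos_times_def good_path_zero)

lemma sigma_nonneg: "0 \<le> sigma_time x"
  unfolding sigma_time_def by (rule cSup_upper[OF zero_nonpos_times bdd_nonpos_times])

lemma sigma_upper: "0 \<le> t \<Longrightarrow> x t \<le> 0 \<Longrightarrow> t \<le> sigma_time x"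
  unfolding sigma_time_def by (rule cSup_upper[OF _ bdd_nonpos_times]) (simp add: nonpos_times_def)

lemma pos_after_sigma: "sigma_time x < t \<Longrightarrow> 0 < x t"
  using sigma_upper[of t] sigma_nonneg by force

lemma at_sigma: "x (sigma_time x) = 0"
proof (rule antisym)
  let ?\<sigma> = "sigma_time x"
  show "x ?\<sigma> \<le> 0"
  proof (rule ccontr)
    assume n: "\<not> x ?\<sigma> \<le> 0"
    then have s0: "0 < ?\<sigma>" using good_path_zero sigma_nonneg by (cases "?\<sigma> = 0") auto
    then have "0 < Lim (at_left ?\<sigma>) x" using n good_path_jump[OF s0] by simp
    from order_tendstoD(1)[OF cadlag_left[OF good_path_cadlag s0] this]
    obtain b where b: "b < ?\<sigma>" "\<And>y. b < y \<Longrightarrow> y < ?\<sigma> \<Longrightarrow> 0 < x y"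
      unfolding eventually_at_left_field by blast
    have "?\<sigma> \<le> max b 0" unfolding sigma_time_def
    proof (rule cSup_least)
      fix t assume t: "t \<in> nonpos_times x"
      then have "t \<le> ?\<sigma>" "x t \<le> 0" using sigma_upper by (auto simp: nonpos_times_def)
      then have "t < ?\<sigma>" using n by (cases "t = ?\<sigma>") auto
      then show "t \<le> max b 0" using b(2)[of t] \<open>x t \<le> 0\<close> by force
    qed (use zero_nonpos_times in auto)
    then show False using b s0 by simp
  qed
  have "(\<lambda>n. ?\<sigma> + 1 / real (Suc n)) \<longlonglongrightarrow> ?\<sigma> + 0" by (intro tendsto_intros LIMSEQ_Suc[OF lim_1_over_n])
  then have "(\<lambda>n. x (?\<sigma> + 1 / real (Suc n))) \<longlonglongrightarrow> x ?\<sigma>"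
    by (intro cadlag_seq_right[OF good_path_cadlag sigma_nonneg]) auto
  then show "0 \<le> x ?\<sigma>"
    by (rule LIMSEQ_le_const) (auto intro!: exI[of _ 0] less_imp_le pos_after_sigma)
qed

end

context
  fixes x :: "real \<Rightarrow> real"
  assumes np: "nice_path x"
begin

private lemma gp: "good_path x" using np by (simp add: nice_path_def)
private lemma c: "cadlag x" and x0: "x 0 = 0" and jump_le: "0 < t \<Longrightarrow> x t \<le> Lim (at_left t) x"
  using gp by (auto simp: good_path_def)

private abbreviation "\<sigma> \<equiv> sigma_time x"
private abbreviation "K m \<equiv> last_nonpos m x"
private abbreviation "T m \<equiv> real (last_nonpos m x) / 2 ^ m"

text \<open>The path is positive after \<open>\<sigma>\<close> and vanishes at \<open>\<sigma>\<close>; if it were nonnegative just before \<open>\<sigma>\<close>, it would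
  have a local minimum at height \<open>0\<close>.  This is what makes the last nonpositive grid times converge.\<close>

lemma negative_before_sigma:
  assumes "0 < \<sigma>" "0 < \<rho>"
  shows "\<exists>t. 0 \<le> t \<and> \<sigma> - \<rho> < t \<and> t < \<sigma> \<and> x t < 0"
proof (rule ccontr)
  assume n: "\<not> ?thesis"
  define a where "a = (max 0 (\<sigma> - \<rho>) + \<sigma>) / 2"
  have a: "0 \<le> a" "\<sigma> - \<rho> < a" "a < \<sigma>" using assms by (auto simp: a_def max_def)
  have le: "- x s \<le> 0" if "a \<le> s" "s \<le> \<sigma> + 1" for s
  proof (cases s \<sigma> rule: linorder_cases)
    case less then show ?thesis using n that a by force
  next
    case equal then show ?thesis using at_sigma[OF gp] by simp
  next
    case greater then show ?thesis using pos_after_sigma[OF gp, of s] by simp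
  qed
  show False
  proof (rule no_max_at_zero_contra[of "\<lambda>t. - x t" a \<sigma> "\<sigma> + 1"])
    show "no_max_at_zero (\<lambda>t. - x t)" using np by (simp add: nice_path_def)
    show "limit_val (\<lambda>t. - x t) \<sigma> 0" using at_sigma[OF gp] by (simp add: limit_val_def)
  qed (use a le cadlag_uminus[OF c] in auto)
qed

lemma left_limit_at_sigma:
  assumes s: "0 < \<sigma>" shows "Lim (at_left \<sigma>) x = 0"
proof (rule antisym)
  show "0 \<le> Lim (at_left \<sigma>) x" using jump_le[OF s] at_sigma[OF gp] by simp
  show "Lim (at_left \<sigma>) x \<le> 0"
  proof (rule ccontr)
    assume "\<not> ?thesis"
    then have "0 < Lim (at_left \<sigma>) x" by simp
    from order_tendstoD(1)[OF cadlag_left[OF c s] this]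
    obtain b where b: "b < \<sigma>" "\<And>y. b < y \<Longrightarrow> y < \<sigma> \<Longrightarrow> 0 < x y"
      unfolding eventually_at_left_field by blast
    then show False using negative_before_sigma[OF s, of "\<sigma> - b"] by force
  qed
qed

lemma T_le: "T m \<le> \<sigma>"
  using last_nonpos(2)[OF gp, of m] by (intro sigma_upper[OF gp]) auto

lemma T_tendsto: "T \<longlonglongrightarrow> \<sigma>"
proof (rule LIMSEQ_I)
  fix \<rho> :: real assume \<rho>: "0 < \<rho>"
  have "\<forall>\<^sub>F m in sequentially. \<sigma> - \<rho> < T m"
  proof (cases "\<sigma> = 0")
    case True
    have "\<sigma> - \<rho> < T m" for m
    proof -
      have "0 \<le> T m" by simp
      then show ?thesis using True \<rho> by linarith
    qed
    then show ?thesis by simp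
  next
    case False
    then have s: "0 < \<sigma>" using sigma_nonneg[OF gp] by simp
    obtain t where t: "0 \<le> t" "\<sigma> - \<rho> < t" "x t < 0" using negative_before_sigma[OF s \<rho>] by blast
    have "\<forall>\<^sub>F m in sequentially. x (dy m t) < 0" by (rule order_tendstoD(2)[OF cadlag_dy[OF c t(1)] t(3)])
    then show ?thesis
    proof eventually_elim
      case (elim m)
      then have "nat \<lceil>t * 2 ^ m\<rceil> \<le> K m" unfolding dy_nat[OF t(1)] by (intro last_nonpos(3)[OF gp]) simp
      then have "dy m t \<le> T m" unfolding dy_nat[OF t(1)] by (simp add: divide_right_mono)
      then show ?case using dy_ge[of t m] t by simp
    qed
  qed
  then obtain N where N: "\<And>m. N \<le> m \<Longrightarrow> \<sigma> - \<rho> < T m" by (auto simp: eventually_sequentially)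
  show "\<exists>no. \<forall>n\<ge>no. norm (T n - \<sigma>) < \<rho>"
  proof (intro exI[of _ N] allI impI)
    fix n assume "N \<le> n" then show "norm (T n - \<sigma>) < \<rho>" using N[of n] T_le[of n] by (simp add: abs_if)
  qed
qed

lemma xT_tendsto: "(\<lambda>m. x (T m)) \<longlonglongrightarrow> 0"
proof (cases "\<sigma> = 0")
  case True
  then have "T m = 0" for m using T_le[of m] by (intro antisym) auto
  then show ?thesis using x0 by simp
next
  case False
  then have s: "0 < \<sigma>" using sigma_nonneg[OF gp] by simp
  show ?thesis
  proof (rule LIMSEQ_I)
    fix e :: real assume e: "0 < e"
    have "\<forall>\<^sub>F s in at_left \<sigma>. dist (x s) 0 < e"
      using cadlag_left[OF c s] e unfolding left_limit_at_sigma[OF s] by (auto simp: tendsto_iff)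
    then obtain b where b: "b < \<sigma>" "\<And>y. b < y \<Longrightarrow> y < \<sigma> \<Longrightarrow> \<bar>x y\<bar> < e"
      unfolding eventually_at_left_field by auto
    have "\<forall>\<^sub>F m in sequentially. b < T m" by (rule order_tendstoD(1)[OF T_tendsto b(1)])
    then have "\<forall>\<^sub>F m in sequentially. norm (x (T m) - 0) < e"
    proof eventually_elim
      case (elim m)
      show ?case
      proof (cases "T m = \<sigma>")
        case True then show ?thesis using at_sigma[OF gp] e by simp
      next
        case False then show ?thesis using b(2)[OF elim] T_le[of m] by simp
      qed
    qed
    then show "\<exists>no. \<forall>n\<ge>no. norm (x (T n) - 0) < e" by (simp add: eventually_sequentially)
  qed
qed

lemma K_pos: "0 < \<sigma> \<Longrightarrow> \<forall>\<^sub>F m in sequentially. 0 < K m"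
proof -
  assume "0 < \<sigma>"
  from order_tendstoD(1)[OF T_tendsto this] show ?thesis by eventually_elim (auto simp: zero_less_divide_iff)
qed

lemma K_zero: "\<sigma> = 0 \<Longrightarrow> K m = 0"
proof -
  assume "\<sigma> = 0"
  then have "T m \<le> 0" using T_le[of m] by simp
  moreover have "(0::real) < 2 ^ m" by simp
  ultimately show "K m = 0" by (simp add: field_simps)
qed

lemma argmax_lo_hi_converge:
  assumes z: "cadlag z" and s: "0 < \<sigma>" and zT: "(\<lambda>m. z (T m)) \<longlonglongrightarrow> 0"
    and uniq: "\<And>l v. is_argsup z \<sigma> l v \<Longrightarrow> l = g"
  shows "(\<lambda>m. real (argmax_lo (K m) (\<lambda>i. z (real i / 2 ^ m))) / 2 ^ m) \<longlonglongrightarrow> g"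
    and "(\<lambda>m. real (argmax_hi (K m) (\<lambda>i. z (real i / 2 ^ m))) / 2 ^ m) \<longlonglongrightarrow> g"
proof -
  note conv = argmax_converges[OF z T_tendsto T_le s zT _ uniq]
  show "(\<lambda>m. real (argmax_lo (K m) (\<lambda>i. z (real i / 2 ^ m))) / 2 ^ m) \<longlonglongrightarrow> g"
  proof (rule conv)
    show "\<forall>\<^sub>F m in sequentially. argmax_lo (K m) (\<lambda>i. z (real i / 2 ^ m)) \<in> maxima (K m) (\<lambda>i. z (real i / 2 ^ m))"
      using K_pos[OF s]
    proof eventually_elim
      case (elim m) then show ?case unfolding argmax_lo_def using Min_in[OF finite_maxima maxima_nonempty[OF elim]] by simp
    qed
  qed
  have "(\<lambda>m. real (Max (maxima (K m) (\<lambda>i. z (real i / 2 ^ m)))) / 2 ^ m) \<longlonglongrightarrow> g"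
  proof (rule conv)
    show "\<forall>\<^sub>F m in sequentially. Max (maxima (K m) (\<lambda>i. z (real i / 2 ^ m))) \<in> maxima (K m) (\<lambda>i. z (real i / 2 ^ m))"
      using K_pos[OF s] by eventually_elim (rule Max_in[OF finite_maxima maxima_nonempty])
  qed
  moreover have "(\<lambda>m::nat. 1 / 2 ^ m :: real) \<longlonglongrightarrow> 0" using LIMSEQ_realpow_zero[of "1/2::real"] by (simp add: power_divide)
  ultimately have "(\<lambda>m. real (Max (maxima (K m) (\<lambda>i. z (real i / 2 ^ m)))) / 2 ^ m + 1 / 2 ^ m) \<longlonglongrightarrow> g + 0"
    by (rule tendsto_add)
  then have l: "(\<lambda>m. real (Max (maxima (K m) (\<lambda>i. z (real i / 2 ^ m)))) / 2 ^ m + 1 / 2 ^ m) \<longlonglongrightarrow> g" by simp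
  show "(\<lambda>m. real (argmax_hi (K m) (\<lambda>i. z (real i / 2 ^ m))) / 2 ^ m) \<longlonglongrightarrow> g"
  proof (rule Lim_transform_eventually[OF l])
    show "\<forall>\<^sub>F m in sequentially. real (Max (maxima (K m) (\<lambda>i. z (real i / 2 ^ m)))) / 2 ^ m + 1 / 2 ^ m
        = real (argmax_hi (K m) (\<lambda>i. z (real i / 2 ^ m))) / 2 ^ m"
      using K_pos[OF s] by eventually_elim (simp add: argmax_hi_def add_divide_distrib)
  qed
qed

lemma argsup_pos:
  assumes s: "0 < \<sigma>" and a: "is_argsup x \<sigma> l v" shows "0 < v"
proof -
  obtain t where "0 < t" "t < \<sigma>" "0 < x t" using np s by (auto simp: nice_path_def)
  then show ?thesis using a unfolding is_argsup_def by (meson less_imp_le less_le_trans)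
qed

lemma argsup_le:
  assumes s: "0 < \<sigma>" and a: "is_argsup x \<sigma> l v" "is_argsup x \<sigma> l' v'" shows "v \<le> v'"
proof -
  have u: "x t \<le> v'" if "0 \<le> t" "t < \<sigma>" for t using a(2) that by (auto simp: is_argsup_def)
  have l: "0 \<le> l" "l \<le> \<sigma>" "limit_val x l v" using a(1) by (auto simp: is_argsup_def)
  consider "v = x l" | "0 < l" "v = Lim (at_left l) x" using l(3) by (auto simp: limit_val_def)
  then show ?thesis
  proof cases
    case 1
    have "l \<noteq> \<sigma>" using argsup_pos[OF s a(1)] 1 at_sigma[OF gp] by auto
    then show ?thesis using u l 1 by simp
  next
    case 2
    have "\<forall>\<^sub>F t in at_left l. x t \<le> v'"
      unfolding eventually_at_left_field using 2 l u by (intro exI[of _ 0]) auto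
    then show ?thesis unfolding 2(2) by (intro tendsto_upperbound[OF cadlag_left[OF c 2(1)]]) auto
  qed
qed

text \<open>The value is positive, hence the two positions are local maxima even if one of them is \<open>\<sigma>\<close>.\<close>

lemma argsup_unique:
  assumes s: "0 < \<sigma>" and a: "is_argsup x \<sigma> l v" "is_argsup x \<sigma> l' v'" shows "l = l'"
proof -
  have aux: False if a: "is_argsup x \<sigma> l v" "is_argsup x \<sigma> l' v'" and less: "l < l'" for l l' v v'
  proof -
    have v: "v = v'" using argsup_le[OF s a] argsup_le[OF s a(2,1)] by simp
    have v0: "x \<sigma> < v" using argsup_pos[OF s a(1)] at_sigma[OF gp] by simp
    have "(x \<longlongrightarrow> x \<sigma>) (at_right \<sigma>)" using c s by (simp add: cadlag_def)
    from order_tendstoD(2)[OF this v0] obtain b where b: "\<sigma> < b" "\<And>y. \<sigma> < y \<Longrightarrow> y < b \<Longrightarrow> x y < v"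
      unfolding eventually_at_right_field by blast
    define e where "e = (\<sigma> + b) / 2"
    have e: "\<sigma> < e" "e < b" using b(1) by (auto simp: e_def)
    show False
    proof (rule no_ties_unique[of x l l' e v])
      show "no_ties x" using np by (simp add: nice_path_def)
      show "cadlag x" by (rule c)
      show "0 \<le> l" "l < l'" "l' < e" "limit_val x l v" "limit_val x l' v" using a less e v by (auto simp: is_argsup_def)
      fix t assume t: "0 \<le> t" "t \<le> e"
      show "x t \<le> v"
      proof (cases t \<sigma> rule: linorder_cases)
        case less then show ?thesis using a(1) t by (auto simp: is_argsup_def)
      next
        case equal then show ?thesis using v0 by simp
      next
        case greater then show ?thesis using b(2)[of t] t e by simp
      qed
    qed
  qed
  show ?thesis using aux[OF a] aux[OF a(2,1)] by (cases l l' rule: linorder_cases) auto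
qed

lemma running_sup_upper: "0 \<le> s \<Longrightarrow> s \<le> t \<Longrightarrow> x s \<le> running_sup x t"
proof -
  assume s: "0 \<le> s" "s \<le> t"
  obtain C where C: "\<And>s. s \<in> {0..t} \<Longrightarrow> \<bar>x s\<bar> \<le> C" using cadlag_bounded[OF c, of 0 t] by blast
  have "bdd_above (x ` {0..t})" by (rule bdd_aboveI2[of _ _ C]) (use C in \<open>force simp: abs_le_iff\<close>)
  then show ?thesis unfolding running_sup_def using s by (intro cSUP_upper) auto
qed

lemma running_inf_lower: "0 \<le> s \<Longrightarrow> s \<le> t \<Longrightarrow> running_inf x t \<le> x s"
proof -
  assume s: "0 \<le> s" "s \<le> t"
  obtain C where C: "\<And>s. s \<in> {0..t} \<Longrightarrow> \<bar>x s\<bar> \<le> C" using cadlag_bounded[OF c, of 0 t] by blast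
  have "bdd_below (x ` {0..t})" by (rule bdd_belowI2[of _ "- C"]) (use C in \<open>force simp: abs_le_iff\<close>)
  then show ?thesis unfolding running_inf_def using s by (intro cINF_lower) auto
qed

text \<open>The supremum before \<open>\<sigma>\<close> may be a left limit only.  The running supremum is still attained at times
  approaching it, namely at the first times at which the path reaches a level just below.\<close>

lemma G_right_argsup:
  assumes s: "0 < \<sigma>" and a: "is_argsup x \<sigma> l v" shows "G_right x = l"
proof -
  let ?D = "{t. 0 \<le> t \<and> t < \<sigma> \<and> x t = running_sup x t}"
  have v0: "0 < v" by (rule argsup_pos[OF s a])
  have l: "0 \<le> l" "l \<le> \<sigma>" "limit_val x l v" "\<And>t. 0 \<le> t \<Longrightarrow> t < \<sigma> \<Longrightarrow> x t \<le> v" using a by (auto simp: is_argsup_def)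
  have l0: "0 < l" using l(1,3) x0 v0 by (cases "l = 0") (auto simp: limit_val_def)
  have upper: "t \<le> l" if t: "t \<in> ?D" for t
  proof (rule ccontr)
    assume "\<not> t \<le> l" then have lt: "l < t" by simp
    have "v \<le> running_sup x t"
    proof (rule field_le_epsilon)
      fix e :: real assume "0 < e"
      obtain q where "0 \<le> q" "q \<le> l" "\<bar>x q - v\<bar> < e" using limit_val_approx[OF c l(1,3) \<open>0 < e\<close>, of 1] by auto
      then show "v \<le> running_sup x t + e" using running_sup_upper[of q t] lt by simp
    qed
    then have "x t = v" using t l(4)[of t] by auto
    then have "is_argsup x \<sigma> t v" using t l(4) by (auto simp: is_argsup_def limit_val_def)
    then have "t = l" using argsup_unique[OF s _ a] by blast
    then show False using lt by simp
  qed
  have lower: "\<exists>t\<in>?D. g < t" if g: "g < l" "0 \<le> g" for g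
  proof -
    define u where "u = running_sup x g"
    have u0: "0 \<le> u" using running_sup_upper[of 0 g] g x0 by (simp add: u_def)
    have uv: "u < v"
    proof (rule ccontr)
      assume "\<not> u < v" then have vu: "v \<le> u" by simp
      have "\<exists>q\<in>{0..g}. v - 1 / real (Suc n) < x q" for n
      proof -
        have "v - 1 / real (Suc n) < v" by simp
        also have "v \<le> (SUP q\<in>{0..g}. x q)" using vu unfolding u_def running_sup_def .
        finally have "v - 1 / real (Suc n) < (SUP q\<in>{0..g}. x q)" .
        moreover obtain C where C: "\<And>s. s \<in> {0..g} \<Longrightarrow> \<bar>x s\<bar> \<le> C" using cadlag_bounded[OF c, of 0 g] by blast
        have "bdd_above (x ` {0..g})" by (rule bdd_aboveI2[of _ _ C]) (use C in \<open>force simp: abs_le_iff\<close>)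
        ultimately show ?thesis using g by (subst (asm) less_cSUP_iff) auto
      qed
      then obtain q where q: "\<And>n. q n \<in> {0..g}" "\<And>n. v - 1 / real (Suc n) < x (q n)" by metis
      obtain r t w where r: "strict_mono (r::nat\<Rightarrow>nat)" "t \<in> {0..g}" "limit_val x t w" "(\<lambda>n. x (q (r n))) \<longlonglongrightarrow> w"
        using cadlag_subseq_compact[of x 0 q g, OF c order_refl q(1)] by blast
      have "(\<lambda>n. v - 1 / real (Suc n)) \<longlonglongrightarrow> v - 0" by (intro tendsto_intros LIMSEQ_Suc[OF lim_1_over_n])
      from LIMSEQ_subseq_LIMSEQ[OF this r(1)] have "(\<lambda>n. v - 1 / real (Suc (r n))) \<longlonglongrightarrow> v" by (simp add: o_def)
      then have "v \<le> w" by (rule LIMSEQ_le[OF _ r(4)]) (use q(2) in \<open>blast intro: less_imp_le\<close>)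
      then have "is_argsup x \<sigma> t w" using r l g unfolding is_argsup_def by (auto intro: order_trans)
      then have "t = l" using argsup_unique[OF s _ a] by blast
      then show False using r(2) g by simp
    qed
    obtain y where y: "u < y" "y < v" using dense[OF uv] by blast
    obtain q where q: "0 \<le> q" "q \<le> l" "\<bar>x q - v\<bar> < v - y" using limit_val_approx[OF c l(1,3), of "v - y" 1] y by auto
    have xq: "y < x q" using q(3) by linarith
    have "q \<noteq> \<sigma>" using xq y u0 at_sigma[OF gp] by auto
    then have q\<sigma>: "q < \<sigma>" using q l by simp
    \<comment> \<open>the first time at level \<open>y\<close>, which lies after \<open>g\<close> because \<open>y\<close> exceeds the supremum up to \<open>g\<close>\<close>
    define t where "t = Inf {r. 0 \<le> r \<and> y \<le> x r}"
    have bb: "bdd_below {r. 0 \<le> r \<and> y \<le> x r}" by (rule bdd_belowI[of _ 0]) auto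
    have ne: "q \<in> {r. 0 \<le> r \<and> y \<le> x r}" using q xq by simp
    have tq: "t \<le> q" unfolding t_def by (rule cInf_lower[OF ne bb])
    have t0: "0 \<le> t" unfolding t_def using ne by (intro cInf_greatest) auto
    have before: "x r < y" if "0 \<le> r" "r < t" for r
      using cInf_lower[OF _ bb, of r] that unfolding t_def by force
    have xt1: "y \<le> x t"
    proof (rule ccontr)
      assume "\<not> y \<le> x t"
      then have xy: "x t < y" by simp
      have "(x \<longlongrightarrow> x t) (at_right t)" using c t0 by (simp add: cadlag_def)
      from order_tendstoD(2)[OF this xy] obtain b where b: "t < b" "\<And>r. t < r \<Longrightarrow> r < b \<Longrightarrow> x r < y"
        unfolding eventually_at_right_field by blast
      have "b \<le> t" unfolding t_def
      proof (rule cInf_greatest)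
        fix r assume r: "r \<in> {r. 0 \<le> r \<and> y \<le> x r}"
        then have "t \<le> r" unfolding t_def by (intro cInf_lower[OF _ bb])
        then show "b \<le> r" using r xy b(2)[of r] by (cases "r = t") force+
      qed (use ne in auto)
      then show False using b by simp
    qed
    have tp: "0 < t" using t0 xt1 x0 y u0 by (cases "t = 0") auto
    have "x t \<le> y"
    proof -
      have "\<forall>\<^sub>F r in at_left t. x r \<le> y"
        unfolding eventually_at_left_field using tp before by (intro exI[of _ 0]) (auto intro: less_imp_le)
      then have "Lim (at_left t) x \<le> y" by (intro tendsto_upperbound[OF cadlag_left[OF c tp]]) auto
      then show ?thesis using jump_le[OF tp] by simp
    qed
    then have xt: "x t = y" using xt1 by simp
    have "running_sup x t = y" unfolding running_sup_def
    proof (rule cSup_eq_maximum)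
      show "y \<in> x ` {0..t}" using xt t0 by (intro image_eqI[of _ _ t]) auto
      fix w assume "w \<in> x ` {0..t}"
      then obtain r where "0 \<le> r" "r \<le> t" "w = x r" by auto
      then show "w \<le> y" using before[of r] xt by (cases "r = t") auto
    qed
    then have "t \<in> ?D" using t0 tq q\<sigma> xt by simp
    moreover have "g < t"
    proof (rule ccontr)
      assume "\<not> g < t" then have "x t \<le> u" unfolding u_def using t0 by (intro running_sup_upper) auto
      then show False using xt y by simp
    qed
    ultimately show ?thesis by blast
  qed
  have "Sup ?D = l"
  proof (rule cSup_eq_non_empty)
    show "?D \<noteq> {}" using lower[OF l0 order_refl] by blast
    show "t \<le> l" if "t \<in> ?D" for t by (rule upper[OF that])
    fix b assume b: "\<And>t. t \<in> ?D \<Longrightarrow> t \<le> b"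
    show "l \<le> b"
    proof (rule ccontr)
      assume "\<not> l \<le> b"
      then obtain t where "t \<in> ?D" "max 0 b < t" using lower[of "max 0 b"] l0 by auto
      then show False using b[of t] by simp
    qed
  qed
  then show ?thesis using s by (simp add: G_right_def)
qed

lemma arginf:
  assumes s: "0 < \<sigma>" and a: "is_argsup (\<lambda>t. - x t) \<sigma> l v"
  shows "x l = - v" "0 < l" "l < \<sigma>" "v > 0"
proof -
  have lw: "limit_val x l (- v)" using a limit_val_uminus[OF c, of l "-v"] by (simp add: is_argsup_def)
  have l: "0 \<le> l" "l \<le> \<sigma>" "\<And>t. 0 \<le> t \<Longrightarrow> t < \<sigma> \<Longrightarrow> - v \<le> x t"
    using a by (auto simp: is_argsup_def intro: minus_le_iff[THEN iffD1])
  obtain t where "0 \<le> t" "t < \<sigma>" "x t < 0" using negative_before_sigma[OF s zero_less_one] by blast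
  then show v0: "v > 0" using l(3)[of t] by simp
  have "l \<noteq> \<sigma>"
  proof
    assume "l = \<sigma>" then have "v = 0" using lw at_sigma[OF gp] left_limit_at_sigma[OF s] by (auto simp: limit_val_def)
    then show False using v0 by simp
  qed
  then show l\<sigma>: "l < \<sigma>" using l(2) by simp
  show l0: "0 < l" using l(1) lw x0 v0 by (cases "l = 0") (auto simp: limit_val_def)
  have "x l \<le> - v" using lw jump_le[OF l0] by (auto simp: limit_val_def)
  then show "x l = - v" using l(3)[of l] l(1) l\<sigma> by simp
qed

lemma F_right_arginf:
  assumes s: "0 < \<sigma>" and a: "is_argsup (\<lambda>t. - x t) \<sigma> l v" shows "F_right x = l"
proof -
  let ?D = "{t. 0 \<le> t \<and> t < \<sigma> \<and> x t = running_inf x t}"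
  note al = arginf[OF s a]
  have low: "- v \<le> x t" if "0 \<le> t" "t < \<sigma>" for t
    using a that by (auto simp: is_argsup_def intro: minus_le_iff[THEN iffD1])
  have uniq: "t \<le> l" if t: "0 \<le> t" "t < \<sigma>" "x t = - v" for t
  proof (rule ccontr)
    assume "\<not> t \<le> l"
    show False
    proof (rule no_ties_unique[of "\<lambda>t. - x t" l t \<sigma> v])
      show "no_ties (\<lambda>t. - x t)" using np by (simp add: nice_path_def)
      show "cadlag (\<lambda>t. - x t)" by (rule cadlag_uminus[OF c])
      fix q assume q: "0 \<le> q" "q \<le> \<sigma>"
      show "- x q \<le> v" using low[of q] q at_sigma[OF gp] al(4) by (cases "q = \<sigma>") auto
    qed (use \<open>\<not> t \<le> l\<close> t al in \<open>auto simp: limit_val_def\<close>)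
  qed
  have "Sup ?D = l"
  proof (rule cSup_eq_maximum)
    have "running_inf x l = - v" unfolding running_inf_def
    proof (rule cInf_eq_minimum)
      show "- v \<in> x ` {0..l}" using al by (intro image_eqI[of _ _ l]) auto
    qed (use low al in auto)
    then show "l \<in> ?D" using al by simp
    fix t assume t: "t \<in> ?D"
    show "t \<le> l"
    proof (cases "t \<le> l")
      case False
      then have "x t \<le> - v" using running_inf_lower[of l t] t al by simp
      then show ?thesis using uniq[of t] t low[of t] by simp
    qed
  qed
  then show ?thesis using s by (simp add: F_right_def)
qed

lemma skeleton_G_right:
  shows "(\<lambda>m. real (argmax_lo (K m) (\<lambda>i. x (real i / 2 ^ m))) / 2 ^ m) \<longlonglongrightarrow> G_right x"
    and "(\<lambda>m. real (argmax_hi (K m) (\<lambda>i. x (real i / 2 ^ m))) / 2 ^ m) \<longlonglongrightarrow> G_right x"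
proof -
  have 1: "(\<lambda>m. real (argmax_lo (K m) (\<lambda>i. x (real i / 2 ^ m))) / 2 ^ m) \<longlonglongrightarrow> G_right x
    \<and> (\<lambda>m. real (argmax_hi (K m) (\<lambda>i. x (real i / 2 ^ m))) / 2 ^ m) \<longlonglongrightarrow> G_right x"
  proof (cases "\<sigma> = 0")
    case True
    then show ?thesis using K_zero[OF True] by (simp add: argmax_lo_def argmax_hi_def G_right_def)
  next
    case False
    then have s: "0 < \<sigma>" using sigma_nonneg[OF gp] by simp
    have u: "l = G_right x" if "is_argsup x \<sigma> l v" for l v using G_right_argsup[OF s that] by simp
    show ?thesis by (intro conjI argmax_lo_hi_converge[OF c s xT_tendsto u])
  qed
  then show "(\<lambda>m. real (argmax_lo (K m) (\<lambda>i. x (real i / 2 ^ m))) / 2 ^ m) \<longlonglongrightarrow> G_right x"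
    "(\<lambda>m. real (argmax_hi (K m) (\<lambda>i. x (real i / 2 ^ m))) / 2 ^ m) \<longlonglongrightarrow> G_right x" by auto
qed

lemma skeleton_F_right:
  shows "(\<lambda>m. real (argmax_lo (K m) (\<lambda>i. - x (real i / 2 ^ m))) / 2 ^ m) \<longlonglongrightarrow> F_right x"
    and "(\<lambda>m. real (argmax_hi (K m) (\<lambda>i. - x (real i / 2 ^ m))) / 2 ^ m) \<longlonglongrightarrow> F_right x"
proof -
  have 1: "(\<lambda>m. real (argmax_lo (K m) (\<lambda>i. - x (real i / 2 ^ m))) / 2 ^ m) \<longlonglongrightarrow> F_right x
    \<and> (\<lambda>m. real (argmax_hi (K m) (\<lambda>i. - x (real i / 2 ^ m))) / 2 ^ m) \<longlonglongrightarrow> F_right x"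
  proof (cases "\<sigma> = 0")
    case True
    then show ?thesis using K_zero[OF True] by (simp add: argmax_lo_def argmax_hi_def F_right_def)
  next
    case False
    then have s: "0 < \<sigma>" using sigma_nonneg[OF gp] by simp
    have "(\<lambda>m. - x (T m)) \<longlonglongrightarrow> 0" using tendsto_minus[OF xT_tendsto] by simp
    moreover have u: "l = F_right x" if "is_argsup (\<lambda>t. - x t) \<sigma> l v" for l v using F_right_arginf[OF s that] by simp
    ultimately show ?thesis by (intro conjI argmax_lo_hi_converge[OF cadlag_uminus[OF c] s _ u])
  qed
  then show "(\<lambda>m. real (argmax_lo (K m) (\<lambda>i. - x (real i / 2 ^ m))) / 2 ^ m) \<longlonglongrightarrow> F_right x"
    "(\<lambda>m. real (argmax_hi (K m) (\<lambda>i. - x (real i / 2 ^ m))) / 2 ^ m) \<longlonglongrightarrow> F_right x" by auto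
qed

lemma zero_set_null: "AE s in lborel. \<not> (0 \<le> s \<and> x s = 0)"
proof (rule AE_I)
  show "{s \<in> space lborel. \<not> \<not> (0 \<le> s \<and> x s = 0)} \<subseteq> {s. 0 \<le> s \<and> x s = 0}" by auto
  show "emeasure lborel {s. 0 \<le> s \<and> x s = 0} = 0" using np by (simp add: nice_path_def)
  have "{s. 0 \<le> s \<and> x s = 0} = {s\<in>space borel. 0 \<le> s \<and> x (max 0 s) = 0}" by (auto simp: max_def)
  also have "\<dots> \<in> sets borel" using cadlag_borel_measurable[OF c] by measurable
  finally show "{s. 0 \<le> s \<and> x s = 0} \<in> sets lborel" by simp
qed

lemma occupation_measurable:
  "(\<lambda>s. indicator {0..\<sigma>} s * indicator {s. x s \<le> 0} s :: real) \<in> borel_measurable lborel"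
  "(\<lambda>s. indicator {0..\<sigma>} s * indicator {s. 0 \<le> x s} s :: real) \<in> borel_measurable lborel"
proof -
  note [measurable] = cadlag_borel_measurable[OF c]
  have "(\<lambda>s. indicator {0..\<sigma>} s * indicator {s. x (max 0 s) \<le> 0} s :: real) \<in> borel_measurable lborel"
    "(\<lambda>s. indicator {0..\<sigma>} s * indicator {s. 0 \<le> x (max 0 s)} s :: real) \<in> borel_measurable lborel" by measurable
  moreover have "(\<lambda>s. indicator {0..\<sigma>} s * indicator {s. x (max 0 s) \<le> 0} s :: real) = (\<lambda>s. indicator {0..\<sigma>} s * indicator {s. x s \<le> 0} s)"
    "(\<lambda>s. indicator {0..\<sigma>} s * indicator {s. 0 \<le> x (max 0 s)} s :: real) = (\<lambda>s. indicator {0..\<sigma>} s * indicator {s. 0 \<le> x s} s)"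
    by (auto simp: fun_eq_iff indicator_def max_def)
  ultimately show "(\<lambda>s. indicator {0..\<sigma>} s * indicator {s. x s \<le> 0} s :: real) \<in> borel_measurable lborel"
    "(\<lambda>s. indicator {0..\<sigma>} s * indicator {s. 0 \<le> x s} s :: real) \<in> borel_measurable lborel" by (simp_all only:)
qed

lemma N_plus_minus: "N_plus x = \<sigma> - N_minus x"
proof -
  let ?f = "\<lambda>s. indicator {0..\<sigma>} s * indicator {s. x s \<le> 0} s :: real"
  let ?g = "\<lambda>s. indicator {0..\<sigma>} s * indicator {s. 0 \<le> x s} s :: real"
  have i: "integrable lborel (indicator {0..\<sigma>} :: real \<Rightarrow> real)"
    using sigma_nonneg[OF gp] by (intro integrable_real_indicator) auto
  have if': "integrable lborel ?f" "integrable lborel ?g"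
    by (rule Bochner_Integration.integrable_bound[OF i]; (rule occupation_measurable)?; simp add: indicator_def)+
  have "N_plus x + N_minus x = (\<integral>s. ?g s + ?f s \<partial>lborel)"
    unfolding N_plus_def N_minus_def set_lebesgue_integral_def real_scaleR_def
    using if' by (subst Bochner_Integration.integral_add) auto
  also have "\<dots> = (\<integral>s. indicator {0..\<sigma>} s \<partial>lborel)"
  proof (rule integral_cong_AE)
    show "AE s in lborel. ?g s + ?f s = indicator {0..\<sigma>} s"
      using zero_set_null by eventually_elim (auto simp: indicator_def)
  qed (use occupation_measurable in auto)
  also have "\<dots> = \<sigma>" using sigma_nonneg[OF gp] by simp
  finally show ?thesis by simp
qed

text \<open>The count is the integral of a step function that looks at the path at the next grid point to the
  right, so right continuity gives pointwise convergence wherever \<open>x\<close> does not vanish.\<close>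

lemma skeleton_N_minus:
  assumes P: "\<And>r. r < 0 \<Longrightarrow> P r" "\<And>r::real. 0 < r \<Longrightarrow> \<not> P r"
  shows "(\<lambda>m. real (card {j. j < K m \<and> P (bridge (K m) (\<lambda>i. x (real i / 2 ^ m)) j)}) / 2 ^ m) \<longlonglongrightarrow> N_minus x"
proof -
  define Q where "Q = (\<lambda>m j. P (bridge (K m) (\<lambda>i. x (real i / 2 ^ m)) j))"
  define f where "f = (\<lambda>m s. \<Sum>j<K m. of_bool (Q m (Suc j)) * indicator {real j / 2 ^ m<..real (Suc j) / 2 ^ m} s :: real)"
  have cell: "s \<in> {real j / 2 ^ m<..real (Suc j) / 2 ^ m} \<longleftrightarrow> \<lceil>s * 2 ^ m\<rceil> = int (Suc j)" for s j m
  proof -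
    have "s \<in> {real j / 2 ^ m<..real (Suc j) / 2 ^ m} \<longleftrightarrow> real j < s * 2 ^ m \<and> s * 2 ^ m \<le> real j + 1"
      by (simp add: field_simps)
    also have "\<dots> \<longleftrightarrow> \<lceil>s * 2 ^ m\<rceil> = int (Suc j)" by (auto simp: ceiling_eq_iff)
    finally show ?thesis .
  qed
  have f_eq: "f m s = of_bool (Q m (nat \<lceil>s * 2 ^ m\<rceil>) \<and> nat \<lceil>s * 2 ^ m\<rceil> \<le> K m)" if s: "0 < s" for m s
  proof -
    have "0 < \<lceil>s * 2 ^ m\<rceil>" using s by simp
    then obtain i where i: "\<lceil>s * 2 ^ m\<rceil> = int (Suc i)" by (metis gr0_conv_Suc zero_less_imp_eq_int)
    have "f m s = (\<Sum>j<K m. if j = i then of_bool (Q m (Suc i)) else 0)"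
      unfolding f_def
    proof (intro sum.cong refl)
      fix j
      have "indicator {real j / 2 ^ m<..real (Suc j) / 2 ^ m} s = (if j = i then 1 else 0 :: real)"
      proof (cases "j = i")
        case True
        then have "s \<in> {real j / 2 ^ m<..real (Suc j) / 2 ^ m}" by (intro cell[THEN iffD2]) (simp add: i)
        from indicator_simps(1)[OF this] show ?thesis using True by simp
      next
        case False
        then have "s \<notin> {real j / 2 ^ m<..real (Suc j) / 2 ^ m}" unfolding cell i by simp
        from indicator_simps(2)[OF this] show ?thesis using False by simp
      qed
      then show "of_bool (Q m (Suc j)) * indicator {real j / 2 ^ m<..real (Suc j) / 2 ^ m} s = (if j = i then of_bool (Q m (Suc i)) else 0 :: real)"
        by simp
    qed
    also have "\<dots> = of_bool (Q m (Suc i) \<and> Suc i \<le> K m)" by (simp add: Suc_le_eq)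
    finally show ?thesis unfolding i nat_int .
  qed
  have f_neg: "f m s = 0" if "s \<le> 0" for m s
  proof -
    have "s \<notin> {real j / 2 ^ m<..real (Suc j) / 2 ^ m}" for j
    proof -
      have "0 \<le> real j / 2 ^ m" by simp
      then have "\<not> real j / 2 ^ m < s" using that by linarith
      then show ?thesis by (simp only: greaterThanAtMost_iff simp_thms)
    qed
    then show ?thesis by (simp add: f_def)
  qed
  have int_f: "(\<integral>s. f m s \<partial>lborel) = real (card {j. j < K m \<and> Q m j}) / 2 ^ m" for m
  proof -
    \<comment> \<open>the bridge vanishes at both ends, so the indices \<open>0, \<dots>, k - 1\<close> and \<open>1, \<dots>, k\<close> give the same count\<close>
    have Q0: "Q m 0 = Q m (K m)" by (cases "K m = 0") (auto simp: Q_def bridge_def x0)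
    have "(\<integral>s. f m s \<partial>lborel) = (\<Sum>j<K m. of_bool (Q m (Suc j)) * (1 / 2 ^ m))"
      unfolding f_def by (subst Bochner_Integration.integral_sum) (auto simp: field_simps add_divide_distrib[symmetric])
    also have "\<dots> = (\<Sum>j<K m. of_bool (Q m (Suc j))) / 2 ^ m" by (simp only: sum_divide_distrib times_divide_eq_right mult_1_right)
    also have "(\<Sum>j<K m. of_bool (Q m (Suc j)) :: real) = (\<Sum>j<K m. of_bool (Q m j))"
      using sum.lessThan_Suc_shift[of "\<lambda>j. of_bool (Q m j) :: real" "K m"] sum.lessThan_Suc[of "\<lambda>j. of_bool (Q m j) :: real" "K m"] Q0 by simp
    also have "\<dots> = real (card {j. j < K m \<and> Q m j})"
    proof -
      have "{j. j < K m \<and> Q m j} = {..<K m} \<inter> {j. Q m j}" by auto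
      then show ?thesis by simp
    qed
    finally show ?thesis .
  qed
  have "(\<lambda>m. \<integral>s. f m s \<partial>lborel) \<longlonglongrightarrow> (\<integral>s. indicator {0..\<sigma>} s * indicator {s. x s \<le> 0} s \<partial>lborel)"
  proof (rule integral_dominated_convergence[where w="indicator {0..\<sigma>}"])
    show "f m \<in> borel_measurable lborel" for m unfolding f_def by measurable
    show "integrable lborel (indicator {0..\<sigma>} :: real \<Rightarrow> real)"
      using sigma_nonneg[OF gp] by (intro integrable_real_indicator) auto
    show "AE s in lborel. norm (f m s) \<le> indicator {0..\<sigma>} s" for m
    proof (rule AE_I2)
      fix s :: real
      show "norm (f m s) \<le> indicator {0..\<sigma>} s"
      proof (cases "0 < s")
        case True
        have "s \<le> \<sigma>" if "nat \<lceil>s * 2 ^ m\<rceil> \<le> K m"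
        proof -
          have "dy m s \<le> T m" unfolding dy_nat[OF less_imp_le[OF True]] using that by (simp add: divide_right_mono)
          then show ?thesis using dy_ge[of s m] T_le[of m] by simp
        qed
        then show ?thesis using True by (auto simp: f_eq indicator_def)
      qed (auto simp: f_neg)
    qed
    show "AE s in lborel. (\<lambda>m. f m s) \<longlonglongrightarrow> indicator {0..\<sigma>} s * indicator {s. x s \<le> 0} s"
      using zero_set_null AE_lborel_singleton[of 0] AE_lborel_singleton[of \<sigma>]
    proof eventually_elim
      case (elim s)
      consider "s < 0" | "\<sigma> < s" "0 < s" | "0 < s" "s < \<sigma>" using elim by linarith
      then show ?case
      proof cases
        case 1 then show ?thesis by (simp add: f_neg)
      next
        case 2
        have "f m s = 0" for m
        proof -
          have "\<not> nat \<lceil>s * 2 ^ m\<rceil> \<le> K m"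
          proof
            assume "nat \<lceil>s * 2 ^ m\<rceil> \<le> K m"
            then have "dy m s \<le> T m" unfolding dy_nat[OF less_imp_le[OF 2(2)]] by (simp add: divide_right_mono)
            then show False using dy_ge[of s m] T_le[of m] 2 by simp
          qed
          then show ?thesis using 2 by (simp add: f_eq)
        qed
        then show ?thesis using 2 by simp
      next
        case 3
        obtain u where u: "s < u" "u < \<sigma>" using dense[OF 3(2)] by blast
        have "\<forall>\<^sub>F m in sequentially. dy m s < u" by (rule order_tendstoD(2)[OF dy_tendsto u(1)])
        moreover have "\<forall>\<^sub>F m in sequentially. u < T m" by (rule order_tendstoD(1)[OF T_tendsto u(2)])
        ultimately have lt: "\<forall>\<^sub>F m in sequentially. nat \<lceil>s * 2 ^ m\<rceil> < K m"
        proof eventually_elim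
          case (elim m)
          then have "dy m s < T m" by simp
          then show ?case unfolding dy_nat[OF less_imp_le[OF 3(1)]] by (simp add: divide_less_cancel)
        qed
        have br: "(\<lambda>m. bridge (K m) (\<lambda>i. x (real i / 2 ^ m)) (nat \<lceil>s * 2 ^ m\<rceil>)) \<longlonglongrightarrow> x s"
        proof -
          have "(\<lambda>m. real (nat \<lceil>s * 2 ^ m\<rceil>) / real (K m) * x (T m)) \<longlonglongrightarrow> 0"
          proof (rule Lim_null_comparison)
            show "\<forall>\<^sub>F m in sequentially. norm (real (nat \<lceil>s * 2 ^ m\<rceil>) / real (K m) * x (T m)) \<le> \<bar>x (T m)\<bar>"
              using lt
            proof eventually_elim
              case (elim m)
              have "a < b \<Longrightarrow> real a / real b \<le> 1" for a b :: nat by simp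
              from this[OF elim] have "real (nat \<lceil>s * 2 ^ m\<rceil>) / real (K m) \<le> 1" .
              then have "\<bar>real (nat \<lceil>s * 2 ^ m\<rceil>) / real (K m)\<bar> * \<bar>x (T m)\<bar> \<le> 1 * \<bar>x (T m)\<bar>" by (intro mult_right_mono) auto
              then show ?case by (simp only: real_norm_def abs_mult mult_1)
            qed
            show "(\<lambda>m. \<bar>x (T m)\<bar>) \<longlonglongrightarrow> 0" using xT_tendsto by (rule tendsto_rabs_zero)
          qed
          from tendsto_diff[OF cadlag_dy[OF c less_imp_le[OF 3(1)]] this]
          show ?thesis unfolding bridge_def dy_nat[OF less_imp_le[OF 3(1)]] by simp
        qed
        have "\<forall>\<^sub>F m in sequentially. Q m (nat \<lceil>s * 2 ^ m\<rceil>) \<longleftrightarrow> x s \<le> 0"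
        proof (cases "x s < 0")
          case True
          from order_tendstoD(2)[OF br True] show ?thesis unfolding Q_def by eventually_elim (use True P in auto)
        next
          case False
          then have xs: "0 < x s" using elim(1) 3 by simp
          from order_tendstoD(1)[OF br xs] show ?thesis unfolding Q_def by eventually_elim (use xs P in auto)
        qed
        with lt have "\<forall>\<^sub>F m in sequentially. f m s = indicator {0..\<sigma>} s * indicator {s. x s \<le> 0} s"
        proof eventually_elim
          case (elim m)
          have "nat \<lceil>s * 2 ^ m\<rceil> \<le> K m" using elim(1) by (rule less_imp_le)
          then have "f m s = of_bool (Q m (nat \<lceil>s * 2 ^ m\<rceil>))" unfolding f_eq[OF 3(1)] by (simp only: simp_thms)
          then show ?case using elim(2) 3 by (simp add: indicator_def)
        qed
        then show ?thesis by (rule tendsto_eventually)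
      qed
    qed
  qed (rule occupation_measurable)
  then show ?thesis unfolding int_f Q_def N_minus_def set_lebesgue_integral_def real_scaleR_def .
qed

lemma skeleton_rank:
  shows "(\<lambda>m. real (rank_lo (K m) (\<lambda>i. x (real i / 2 ^ m))) / 2 ^ m) \<longlonglongrightarrow> N_minus x"
    and "(\<lambda>m. real (rank_hi (K m) (\<lambda>i. x (real i / 2 ^ m))) / 2 ^ m) \<longlonglongrightarrow> N_minus x"
  unfolding rank_lo_def rank_hi_def by (rule skeleton_N_minus; simp)+

end

section \<open>Cyclic shifts of a random walk\<close>

definition walk :: "(nat \<Rightarrow> real) \<Rightarrow> nat \<Rightarrow> real" where "walk w j = (\<Sum>i<j. w i)"

definition cyc :: "nat \<Rightarrow> nat \<Rightarrow> nat \<Rightarrow> nat" where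
  "cyc k u i = (if i < k then (i + u) mod k else i)"

lemma cyc_if: "u < k \<Longrightarrow> i < k \<Longrightarrow> cyc k u i = (if i + u < k then i + u else i + u - k)"
  by (auto simp: cyc_def mod_if)

lemma cyc_bij: assumes "u < k" shows "bij_betw (cyc k u) {..<k} {..<k}"
proof -
  have inj: "inj_on (cyc k u) {..<k}"
    using assms by (intro inj_onI) (auto simp: cyc_if split: if_splits)
  have "cyc k u ` {..<k} \<subseteq> {..<k}" using assms by (auto simp: cyc_def)
  then show ?thesis using endo_inj_surj[of "{..<k}" "cyc k u"] inj by (auto simp: bij_betw_def)
qed

lemma cyc_inj: assumes "u < k" shows "inj (cyc k u)"
proof (rule injI)
  fix i j assume h: "cyc k u i = cyc k u j"
  have lt: "cyc k u i < k \<longleftrightarrow> i < k" for i using assms by (auto simp: cyc_def)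
  show "i = j"
  proof (cases "i < k")
    case True
    then have "j < k" using lt[of i] lt[of j] h by simp
    then show ?thesis using True h bij_betw_imp_inj_on[OF cyc_bij[OF assms]] by (auto dest: inj_onD)
  next
    case False
    then have "\<not> j < k" using lt[of i] lt[of j] h by simp
    then show ?thesis using False h by (simp add: cyc_def)
  qed
qed

lemma walk_cyc_ge:
  assumes "u < k" "k \<le> j" shows "walk (\<lambda>i. w (cyc k u i)) j = walk w j"
proof -
  have s: "{..<j} = {..<k} \<union> {k..<j}" "{..<k} \<inter> {k..<j} = {}" using assms by auto
  have "(\<Sum>i<k. w (cyc k u i)) = (\<Sum>i<k. w i)"
    by (rule sum.reindex_bij_betw[OF cyc_bij[OF assms(1)]])
  moreover have "(\<Sum>i\<in>{k..<j}. w (cyc k u i)) = (\<Sum>i\<in>{k..<j}. w i)"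
    by (intro sum.cong) (auto simp: cyc_def)
  ultimately show ?thesis unfolding walk_def s(1) by (simp add: sum.union_disjoint[OF _ _ s(2)])
qed

lemma bridge_cyc:
  assumes u: "u < k" and j: "j < k"
  shows "bridge k (walk (\<lambda>i. w (cyc k u i))) j = bridge k (walk w) (cyc k u j) - bridge k (walk w) u"
proof -
  let ?b = "bridge k (walk w)" and ?S = "walk w k"
  have k: "0 < k" using u by simp
  have step: "?b (Suc i mod k) = ?b i + (w i - ?S / k)" if i: "i < k" for i
  proof (cases "Suc i = k")
    case True
    then have ik: "real i = real k - 1" by auto
    have "?S = walk w i + w i" using True by (auto simp: walk_def)
    then have "?b i + (w i - ?S / k) = ?S - real i / real k * ?S - ?S / k" by (simp add: bridge_def)
    also have "\<dots> = 0" using k by (simp add: ik field_simps)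
    finally show ?thesis using True by (simp add: bridge_def walk_def)
  next
    case False
    then have "Suc i mod k = Suc i" using i by simp
    moreover have "real (Suc i) / real k = real i / real k + 1 / real k" by (simp add: add_divide_distrib)
    ultimately show ?thesis unfolding bridge_def by (simp add: walk_def algebra_simps)
  qed
  show ?thesis using j
  proof (induction j)
    case 0
    then show ?case using u by (simp add: bridge_def walk_def cyc_def)
  next
    case (Suc j)
    have jk: "j < k" using Suc.prems by simp
    have c: "cyc k u j < k" using k jk by (simp add: cyc_def)
    have c2: "cyc k u (Suc j) = Suc (cyc k u j) mod k"
      using jk Suc.prems by (simp add: cyc_def mod_Suc_eq)
    have "bridge k (walk (\<lambda>i. w (cyc k u i))) (Suc j)
      = bridge k (walk (\<lambda>i. w (cyc k u i))) j + (w (cyc k u j) - ?S / k)"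
    proof -
      have "real (Suc j) / real k = real j / real k + 1 / real k" by (simp add: add_divide_distrib)
      then show ?thesis unfolding bridge_def walk_cyc_ge[OF u order_refl] by (simp add: walk_def algebra_simps)
    qed
    also have "\<dots> = ?b (cyc k u j) - ?b u + (w (cyc k u j) - ?S / k)" using Suc.IH[OF jk] by simp
    also have "\<dots> = ?b (cyc k u (Suc j)) - ?b u" unfolding c2 step[OF c] by simp
    finally show ?case .
  qed
qed

text \<open>Because of ties neither functional need be uniform over the \<open>k\<close> rotations of a sequence, but the two
  enclose a quantity that is.\<close>

definition cyclically_uniform :: "(nat \<Rightarrow> (nat \<Rightarrow> real) \<Rightarrow> nat) \<Rightarrow> (nat \<Rightarrow> (nat \<Rightarrow> real) \<Rightarrow> nat) \<Rightarrow> bool" where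
  "cyclically_uniform L U \<longleftrightarrow> (\<forall>k>0. \<forall>w. \<exists>\<tau>. bij_betw \<tau> {..<k} {..<k} \<and>
     (\<forall>u<k. L k (walk (\<lambda>i. w (cyc k u i))) \<le> \<tau> u \<and> Suc (\<tau> u) \<le> U k (walk (\<lambda>i. w (cyc k u i)))))"

text \<open>Follow one fixed maximiser of the bridge through the rotations.\<close>

lemma argmax_cyclically_uniform: "cyclically_uniform argmax_lo argmax_hi"
  unfolding cyclically_uniform_def
proof (intro allI impI)
  fix k :: nat and w :: "nat \<Rightarrow> real" assume k: "0 < k"
  obtain a where a: "a \<in> maxima k (walk w)" using maxima_nonempty[OF k] by blast
  then have ak: "a < k" by (simp add: maxima_def)
  define \<tau> where "\<tau> = (\<lambda>u. if u \<le> a then a - u else a + k - u)"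
  have \<tau>k: "\<tau> u < k" if "u < k" for u using that ak by (auto simp: \<tau>_def)
  have inj: "inj_on \<tau> {..<k}" using ak by (intro inj_onI) (auto simp: \<tau>_def split: if_splits)
  have bij: "bij_betw \<tau> {..<k} {..<k}"
    using endo_inj_surj[of "{..<k}" \<tau>] inj \<tau>k by (auto simp: bij_betw_def)
  have mem: "\<tau> u \<in> maxima k (walk (\<lambda>i. w (cyc k u i)))" if u: "u < k" for u
  proof -
    have "cyc k u (\<tau> u) = a" using u ak \<tau>k[OF u] by (auto simp: cyc_if \<tau>_def)
    moreover have "cyc k u i < k" if "i < k" for i using k that by (simp add: cyc_def)
    ultimately show ?thesis using a \<tau>k[OF u] u by (auto simp: maxima_def bridge_cyc)
  qed
  show "\<exists>\<tau>. bij_betw \<tau> {..<k} {..<k} \<and> (\<forall>u<k. argmax_lo k (walk (\<lambda>i. w (cyc k u i))) \<le> \<tau> u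
      \<and> Suc (\<tau> u) \<le> argmax_hi k (walk (\<lambda>i. w (cyc k u i))))"
    using bij mem k by (intro exI[of _ \<tau>]) (auto simp: argmax_lo_def argmax_hi_def)
qed

text \<open>After rotation to the origin \<open>u\<close>, the points below the starting point are those with a smaller
  value than \<open>u\<close>; breaking ties by the index turns these ranks into a bijection.\<close>

lemma rank_cyclically_uniform: "cyclically_uniform rank_lo rank_hi"
  unfolding cyclically_uniform_def
proof (intro allI impI)
  fix k :: nat and w :: "nat \<Rightarrow> real" assume k: "0 < k"
  define b where "b = bridge k (walk w)"
  define R where "R = (\<lambda>u. {i. i < k \<and> (b i < b u \<or> b i = b u \<and> i < u)})"
  define \<tau> where "\<tau> = (\<lambda>u. card (R u))"
  have fin: "finite (R u)" for u by (simp add: R_def)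
  have \<tau>k: "\<tau> u < k" if "u < k" for u
  proof -
    have "R u \<subset> {..<k}" using that by (auto simp: R_def)
    from psubset_card_mono[OF _ this] show ?thesis by (simp add: \<tau>_def)
  qed
  have less: "\<tau> u < \<tau> v" if "u < k" "v < k" "b u < b v \<or> b u = b v \<and> u < v" for u v
  proof -
    have "R u \<subset> R v" using that by (force simp: R_def)
    from psubset_card_mono[OF fin this] show ?thesis by (simp add: \<tau>_def)
  qed
  have inj: "inj_on \<tau> {..<k}"
  proof (rule inj_onI, rule ccontr)
    fix u v assume uv: "u \<in> {..<k}" "v \<in> {..<k}" "\<tau> u = \<tau> v" "u \<noteq> v"
    then have "(b u < b v \<or> b u = b v \<and> u < v) \<or> (b v < b u \<or> b v = b u \<and> v < u)" by auto
    then show False using less[of u v] less[of v u] uv by auto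
  qed
  have bij: "bij_betw \<tau> {..<k} {..<k}"
    using endo_inj_surj[of "{..<k}" \<tau>] inj \<tau>k by (auto simp: bij_betw_def)
  have shifted: "card {j. j < k \<and> P (bridge k (walk (\<lambda>i. w (cyc k u i))) j)} = card {i. i < k \<and> P (b i - b u)}"
    if u: "u < k" for u and P :: "real \<Rightarrow> bool"
  proof -
    have "bij_betw (cyc k u) {j\<in>{..<k}. P (bridge k (walk (\<lambda>i. w (cyc k u i))) j)} {i\<in>{..<k}. P (b i - b u)}"
      using u by (intro bij_betw_Collect[OF cyc_bij[OF u]]) (auto simp: bridge_cyc b_def)
    from bij_betw_same_card[OF this] show ?thesis by simp
  qed
  have "rank_lo k (walk (\<lambda>i. w (cyc k u i))) \<le> \<tau> u \<and> Suc (\<tau> u) \<le> rank_hi k (walk (\<lambda>i. w (cyc k u i)))" if u: "u < k" for u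
  proof
    have "rank_lo k (walk (\<lambda>i. w (cyc k u i))) = card {i. i < k \<and> b i - b u < 0}"
      unfolding rank_lo_def by (rule shifted[OF u])
    also have "\<dots> \<le> card (R u)" by (rule card_mono[OF fin]) (auto simp: R_def)
    finally show "rank_lo k (walk (\<lambda>i. w (cyc k u i))) \<le> \<tau> u" by (simp add: \<tau>_def)
    have "R u \<subset> {i. i < k \<and> b i - b u \<le> 0}" using u by (auto simp: R_def)
    from psubset_card_mono[OF _ this] have "card (R u) < card {i. i < k \<and> b i - b u \<le> 0}" by simp
    also have "\<dots> = rank_hi k (walk (\<lambda>i. w (cyc k u i)))"
      unfolding rank_hi_def by (rule shifted[OF u, symmetric])
    finally show "Suc (\<tau> u) \<le> rank_hi k (walk (\<lambda>i. w (cyc k u i)))" by (simp add: \<tau>_def)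
  qed
  then show "\<exists>\<tau>. bij_betw \<tau> {..<k} {..<k} \<and> (\<forall>u<k. rank_lo k (walk (\<lambda>i. w (cyc k u i))) \<le> \<tau> u
      \<and> Suc (\<tau> u) \<le> rank_hi k (walk (\<lambda>i. w (cyc k u i))))"
    using bij by blast
qed

lemma walk_uminus: "walk (\<lambda>i. - w i) j = - walk w j"
  by (simp add: walk_def sum_negf)

lemma cyclically_uniform_uminus:
  assumes "cyclically_uniform L U"
  shows "cyclically_uniform (\<lambda>k S. L k (\<lambda>i. - S i)) (\<lambda>k S. U k (\<lambda>i. - S i))"
  unfolding cyclically_uniform_def
proof (intro allI impI)
  fix k :: nat and w :: "nat \<Rightarrow> real" assume "0 < k"
  have "walk (\<lambda>i. - w (cyc k u i)) = (\<lambda>j. - walk (\<lambda>i. w (cyc k u i)) j)" for u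
    by (intro ext walk_uminus)
  then show "\<exists>\<tau>. bij_betw \<tau> {..<k} {..<k} \<and> (\<forall>u<k. L k (\<lambda>i. - walk (\<lambda>i. w (cyc k u i)) i) \<le> \<tau> u
      \<and> Suc (\<tau> u) \<le> U k (\<lambda>i. - walk (\<lambda>i. w (cyc k u i)) i))"
    using assms[unfolded cyclically_uniform_def, rule_format, OF \<open>0 < k\<close>, of "\<lambda>i. - w i"] by simp
qed

definition measurable_functional :: "(nat \<Rightarrow> (nat \<Rightarrow> real) \<Rightarrow> nat) \<Rightarrow> bool" where
  "measurable_functional L \<longleftrightarrow> (\<forall>k. (\<lambda>S. real (L k S)) \<in> borel_measurable (PiM UNIV (\<lambda>_. borel)))"

lemma bridge_measurable [measurable]: "(\<lambda>S. bridge k S j) \<in> borel_measurable (PiM UNIV (\<lambda>_. borel))"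
  unfolding bridge_def by measurable

lemma measurable_functional_rank: "measurable_functional rank_lo" "measurable_functional rank_hi"
proof -
  have 1: "real (rank_lo k S) = (\<Sum>j<k. of_bool (bridge k S j < 0))" for k S
  proof -
    have "{j. j < k \<and> bridge k S j < 0} = {..<k} \<inter> {j. bridge k S j < 0}" by auto
    then show ?thesis by (simp add: rank_lo_def)
  qed
  have 2: "real (rank_hi k S) = (\<Sum>j<k. of_bool (bridge k S j \<le> 0))" for k S
  proof -
    have "{j. j < k \<and> bridge k S j \<le> 0} = {..<k} \<inter> {j. bridge k S j \<le> 0}" by auto
    then show ?thesis by (simp add: rank_hi_def)
  qed
  show "measurable_functional rank_lo" "measurable_functional rank_hi"
    unfolding measurable_functional_def 1 2 of_bool_def by measurable
qed

lemma measurable_functional_argmax: "measurable_functional argmax_lo" "measurable_functional argmax_hi"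
proof -
  let ?P = "PiM (UNIV::nat set) (\<lambda>_. borel :: real measure)"
  have mx: "{S\<in>space ?P. j \<in> maxima k S} \<in> sets ?P" for j k
  proof -
    have "{S\<in>space ?P. j \<in> maxima k S} = {S\<in>space ?P. j < k \<and> (\<forall>i\<in>{..<k}. bridge k S i \<le> bridge k S j)}"
      by (auto simp: maxima_def)
    also have "\<dots> \<in> sets ?P"
      by (intro sets.sets_Collect_conj sets.sets_Collect_finite_All sets.sets_Collect_const borel_measurable_le bridge_measurable) simp
    finally show ?thesis .
  qed
  show "measurable_functional argmax_lo" unfolding measurable_functional_def
  proof (intro allI)
    fix k show "(\<lambda>S. real (argmax_lo k S)) \<in> borel_measurable ?P"
    proof (cases "k = 0")
      case False
      have "real (argmax_lo k S) \<le> a \<longleftrightarrow> (\<exists>j\<in>{..<k}. j \<in> maxima k S \<and> real j \<le> a)" for a S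
      proof
        assume "real (argmax_lo k S) \<le> a"
        moreover have "argmax_lo k S \<in> maxima k S" using False Min_in[OF finite_maxima maxima_nonempty] by (simp add: argmax_lo_def)
        ultimately show "\<exists>j\<in>{..<k}. j \<in> maxima k S \<and> real j \<le> a" by (auto simp: maxima_def)
      next
        assume "\<exists>j\<in>{..<k}. j \<in> maxima k S \<and> real j \<le> a"
        then obtain j where "j \<in> maxima k S" "real j \<le> a" by blast
        moreover have "argmax_lo k S \<le> j" using False Min_le[OF finite_maxima \<open>j \<in> maxima k S\<close>] by (simp add: argmax_lo_def)
        ultimately show "real (argmax_lo k S) \<le> a" by (meson of_nat_mono order_trans)
      qed
      then show ?thesis unfolding borel_measurable_iff_le
        using mx by (auto intro!: sets.sets_Collect_finite_Ex sets.sets_Collect_conj)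
    qed (simp add: argmax_lo_def)
  qed
  show "measurable_functional argmax_hi" unfolding measurable_functional_def
  proof (intro allI)
    fix k show "(\<lambda>S. real (argmax_hi k S)) \<in> borel_measurable ?P"
    proof (cases "k = 0")
      case False
      have "real (argmax_hi k S) \<le> a \<longleftrightarrow> (\<forall>j\<in>{..<k}. \<not> j \<in> maxima k S \<or> real (Suc j) \<le> a)" for a S
      proof
        assume a: "real (argmax_hi k S) \<le> a"
        show "\<forall>j\<in>{..<k}. \<not> j \<in> maxima k S \<or> real (Suc j) \<le> a"
        proof (intro ballI)
          fix j show "\<not> j \<in> maxima k S \<or> real (Suc j) \<le> a"
          proof (cases "j \<in> maxima k S")
            case True
            then have "Suc j \<le> argmax_hi k S" using False Max_ge[OF finite_maxima True] by (simp add: argmax_hi_def)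
            then show ?thesis using a by (meson of_nat_mono order_trans)
          qed simp
        qed
      next
        assume h: "\<forall>j\<in>{..<k}. \<not> j \<in> maxima k S \<or> real (Suc j) \<le> a"
        have "Max (maxima k S) \<in> maxima k S" using False by (intro Max_in maxima_nonempty) auto
        then show "real (argmax_hi k S) \<le> a" using h False by (auto simp: argmax_hi_def maxima_def)
      qed
      then show ?thesis unfolding borel_measurable_iff_le
        using mx by (auto intro!: sets.sets_Collect_finite_All sets.sets_Collect_disj sets.sets_Collect_neg)
    qed (simp add: argmax_hi_def)
  qed
qed

lemma measurable_functional_uminus:
  assumes "measurable_functional L" shows "measurable_functional (\<lambda>k S. L k (\<lambda>i. - S i))"
proof -
  have "(\<lambda>S i. - S i) \<in> measurable (PiM (UNIV::nat set) (\<lambda>_. borel :: real measure)) (PiM UNIV (\<lambda>_. borel))"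
    by (intro measurable_PiM_single') auto
  from measurable_compose[OF this] show ?thesis using assms by (auto simp: measurable_functional_def)
qed

lemma monotone_riemann_bounds:
  fixes \<psi> :: "real \<Rightarrow> real"
  assumes mono: "mono \<psi>" and cont: "continuous_on UNIV \<psi>" and k: "0 < k"
  shows "(\<Sum>i<k. \<psi> (real i / real k)) / real k \<le> integral {0..1} \<psi>"
    and "integral {0..1} \<psi> \<le> (\<Sum>i<k. \<psi> (real (Suc i) / real k)) / real k"
proof -
  have int: "\<psi> integrable_on {a..b}" for a b
    using cont by (intro integrable_continuous_interval) (auto intro: continuous_on_subset)
  have cell: "\<psi> a * (b - a) \<le> integral {a..b} \<psi>" "integral {a..b} \<psi> \<le> \<psi> b * (b - a)" if "a \<le> b" for a b
  proof -
    have "integral {a..b} (\<lambda>_. \<psi> a) \<le> integral {a..b} \<psi>"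
      using mono by (intro integral_le int) (auto simp: mono_def)
    then show "\<psi> a * (b - a) \<le> integral {a..b} \<psi>" using that by (simp add: mult.commute)
    have "integral {a..b} \<psi> \<le> integral {a..b} (\<lambda>_. \<psi> b)"
      using mono by (intro integral_le int) (auto simp: mono_def)
    then show "integral {a..b} \<psi> \<le> \<psi> b * (b - a)" using that by (simp add: mult.commute)
  qed
  have "(\<Sum>i<n. \<psi> (real i / real k)) / real k \<le> integral {0..real n / real k} \<psi> \<and>
        integral {0..real n / real k} \<psi> \<le> (\<Sum>i<n. \<psi> (real (Suc i) / real k)) / real k" for n
  proof (induction n)
    case (Suc n)
    have le: "real n / real k \<le> real (Suc n) / real k" by (simp add: divide_right_mono)
    have w: "real (Suc n) / real k - real n / real k = 1 / real k" by (simp add: diff_divide_distrib[symmetric])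
    have "integral {0..real (Suc n) / real k} \<psi> = integral {0..real n / real k} \<psi> + integral {real n / real k..real (Suc n) / real k} \<psi>"
      by (rule Henstock_Kurzweil_Integration.integral_combine[symmetric, OF _ le int]) simp
    moreover note cell[OF le, unfolded w] Suc.IH
    ultimately show ?case by (simp add: add_divide_distrib)
  qed simp
  from this[of k] k show "(\<Sum>i<k. \<psi> (real i / real k)) / real k \<le> integral {0..1} \<psi>"
    and "integral {0..1} \<psi> \<le> (\<Sum>i<k. \<psi> (real (Suc i) / real k)) / real k" by auto
qed

lemma cyclic_average:
  assumes LU: "cyclically_uniform L U" and k: "0 < k"
    and mono: "mono \<psi>" and cont: "continuous_on UNIV \<psi>"
  shows "(\<Sum>u<k. \<psi> (real (L k (walk (\<lambda>i. w (cyc k u i)))) / real k)) \<le> real k * integral {0..1} \<psi>"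
    and "real k * integral {0..1} \<psi> \<le> (\<Sum>u<k. \<psi> (real (U k (walk (\<lambda>i. w (cyc k u i)))) / real k))"
proof -
  obtain \<tau> where \<tau>: "bij_betw \<tau> {..<k} {..<k}"
    "\<And>u. u < k \<Longrightarrow> L k (walk (\<lambda>i. w (cyc k u i))) \<le> \<tau> u"
    "\<And>u. u < k \<Longrightarrow> Suc (\<tau> u) \<le> U k (walk (\<lambda>i. w (cyc k u i)))"
    using LU k unfolding cyclically_uniform_def by metis
  have "(\<Sum>u<k. \<psi> (real (L k (walk (\<lambda>i. w (cyc k u i)))) / real k)) \<le> (\<Sum>u<k. \<psi> (real (\<tau> u) / real k))"
    using \<tau>(2) mono by (intro sum_mono) (auto simp: mono_def divide_right_mono)
  also have "\<dots> = (\<Sum>i<k. \<psi> (real i / real k))" by (rule sum.reindex_bij_betw[OF \<tau>(1)])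
  also have "\<dots> \<le> real k * integral {0..1} \<psi>"
    using monotone_riemann_bounds(1)[OF mono cont k] k by (simp add: field_simps)
  finally show "(\<Sum>u<k. \<psi> (real (L k (walk (\<lambda>i. w (cyc k u i)))) / real k)) \<le> real k * integral {0..1} \<psi>" .
  have "real k * integral {0..1} \<psi> \<le> (\<Sum>i<k. \<psi> (real (Suc i) / real k))"
    using monotone_riemann_bounds(2)[OF mono cont k] k by (simp add: field_simps)
  also have "\<dots> = (\<Sum>u<k. \<psi> (real (Suc (\<tau> u)) / real k))" by (rule sum.reindex_bij_betw[OF \<tau>(1), symmetric])
  also have "\<dots> \<le> (\<Sum>u<k. \<psi> (real (U k (walk (\<lambda>i. w (cyc k u i)))) / real k))"
  proof (intro sum_mono)
    fix u assume "u \<in> {..<k}"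
    then have "real (Suc (\<tau> u)) \<le> real (U k (walk (\<lambda>i. w (cyc k u i))))" using \<tau>(3)[of u] by (simp only: of_nat_le_iff lessThan_iff)
    then show "\<psi> (real (Suc (\<tau> u)) / real k) \<le> \<psi> (real (U k (walk (\<lambda>i. w (cyc k u i)))) / real k)"
      using mono by (auto simp: mono_def divide_right_mono)
  qed
  finally show "real k * integral {0..1} \<psi> \<le> (\<Sum>u<k. \<psi> (real (U k (walk (\<lambda>i. w (cyc k u i)))) / real k))" .
qed

text \<open>Replace the integrand by its average over the rotations, which the law and \<open>E\<close> do not notice.\<close>

lemma iid_cyclic_bounds:
  fixes \<mu> :: "real measure"
  assumes \<mu>: "prob_space \<mu>" and [measurable_cong]: "sets \<mu> = sets borel"
    and LU: "cyclically_uniform L U" "measurable_functional L" "measurable_functional U"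
    and k: "0 < k" and \<psi>: "mono \<psi>" "continuous_on UNIV \<psi>" "\<And>r. 0 \<le> \<psi> r"
    and E: "E \<in> sets (PiM (UNIV::nat set) (\<lambda>_. \<mu>))" "\<And>w u. u < k \<Longrightarrow> (\<lambda>i. w (cyc k u i)) \<in> E \<longleftrightarrow> w \<in> E"
  shows "(\<integral>\<^sup>+w. ennreal (\<psi> (real (L k (walk w)) / real k)) * indicator E w \<partial>PiM UNIV (\<lambda>_. \<mu>))
      \<le> ennreal (integral {0..1} \<psi>) * emeasure (PiM UNIV (\<lambda>_. \<mu>)) E"
    and "ennreal (integral {0..1} \<psi>) * emeasure (PiM UNIV (\<lambda>_. \<mu>)) E
      \<le> (\<integral>\<^sup>+w. ennreal (\<psi> (real (U k (walk w)) / real k)) * indicator E w \<partial>PiM UNIV (\<lambda>_. \<mu>))"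
proof -
  define P where "P = PiM (UNIV::nat set) (\<lambda>_. \<mu>)"
  have E1[measurable]: "E \<in> sets P" using E by (simp add: P_def)
  have sP[measurable_cong]: "sets P = sets (PiM UNIV (\<lambda>_. borel))"
    unfolding P_def by (intro sets_PiM_cong refl) (simp add: assms)
  have [measurable]: "\<psi> \<in> borel_measurable borel" using \<psi>(2) by (rule borel_measurable_continuous_onI)
  have wm: "walk \<in> measurable P (PiM UNIV (\<lambda>_. borel))"
    unfolding walk_def by (intro measurable_PiM_single') auto
  have cm[measurable]: "(\<lambda>w i. w (cyc k u i)) \<in> measurable P P" for u
  proof -
    have "(\<lambda>w i. w (cyc k u i)) \<in> measurable P (PiM UNIV (\<lambda>_. borel))"
      by (intro measurable_PiM_single') auto
    then show ?thesis using sP by (simp cong: measurable_cong_sets)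
  qed
  have inv: "distr P P (\<lambda>w i. w (cyc k u i)) = P" if "u < k" for u
  proof -
    have "distr (PiM UNIV (\<lambda>_. \<mu>)) (PiM UNIV (\<lambda>_. \<mu>)) (\<lambda>w. \<lambda>n\<in>UNIV. w (cyc k u n)) = PiM (UNIV::nat set) (\<lambda>_. \<mu>)"
      by (rule distr_PiM_reindex) (use \<mu> cyc_inj[OF that] in auto)
    then show ?thesis by (simp add: P_def)
  qed
  have avg: "of_nat k * (\<integral>\<^sup>+w. ennreal (\<psi> (real (V k (walk w)) / real k)) * indicator E w \<partial>P)
     = (\<integral>\<^sup>+w. ennreal (\<Sum>u<k. \<psi> (real (V k (walk (\<lambda>i. w (cyc k u i)))) / real k)) * indicator E w \<partial>P)"
    if V: "measurable_functional V" for V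
  proof -
    have "(\<lambda>S. real (V k S)) \<in> borel_measurable (PiM UNIV (\<lambda>_. borel))" using V by (simp add: measurable_functional_def)
    from measurable_compose[OF wm this] have Vm[measurable]: "(\<lambda>w. real (V k (walk w))) \<in> borel_measurable P" .
    have "(\<integral>\<^sup>+w. ennreal (\<psi> (real (V k (walk w)) / real k)) * indicator E w \<partial>P)
       = (\<integral>\<^sup>+w. ennreal (\<psi> (real (V k (walk (\<lambda>i. w (cyc k u i)))) / real k)) * indicator E w \<partial>P)" if u: "u < k" for u
    proof -
      have "(\<integral>\<^sup>+w. ennreal (\<psi> (real (V k (walk w)) / real k)) * indicator E w \<partial>P)
        = (\<integral>\<^sup>+w. ennreal (\<psi> (real (V k (walk w)) / real k)) * indicator E w \<partial>distr P P (\<lambda>w i. w (cyc k u i)))"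
        by (simp add: inv[OF u])
      also have "\<dots> = (\<integral>\<^sup>+w. ennreal (\<psi> (real (V k (walk (\<lambda>i. w (cyc k u i)))) / real k)) * indicator E (\<lambda>i. w (cyc k u i)) \<partial>P)"
        by (subst nn_integral_distr) auto
      finally show ?thesis using E(2)[OF u] by (simp add: indicator_def)
    qed
    then have "(\<Sum>u<k. \<integral>\<^sup>+w. ennreal (\<psi> (real (V k (walk w)) / real k)) * indicator E w \<partial>P)
       = (\<Sum>u<k. (\<integral>\<^sup>+w. ennreal (\<psi> (real (V k (walk (\<lambda>i. w (cyc k u i)))) / real k)) * indicator E w \<partial>P))"
      by (intro sum.cong refl) blast
    then have "of_nat k * (\<integral>\<^sup>+w. ennreal (\<psi> (real (V k (walk w)) / real k)) * indicator E w \<partial>P)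
       = (\<Sum>u<k. (\<integral>\<^sup>+w. ennreal (\<psi> (real (V k (walk (\<lambda>i. w (cyc k u i)))) / real k)) * indicator E w \<partial>P))"
      unfolding sum_constant card_lessThan .
    also have "\<dots> = (\<integral>\<^sup>+w. (\<Sum>u<k. ennreal (\<psi> (real (V k (walk (\<lambda>i. w (cyc k u i)))) / real k)) * indicator E w) \<partial>P)"
    proof (rule nn_integral_sum[symmetric])
      fix u
      have [measurable]: "(\<lambda>w. real (V k (walk (\<lambda>i. w (cyc k u i))))) \<in> borel_measurable P"
        by (rule measurable_compose[OF cm Vm])
      show "(\<lambda>w. ennreal (\<psi> (real (V k (walk (\<lambda>i. w (cyc k u i)))) / real k)) * indicator E w) \<in> borel_measurable P"
        by measurable
    qed
    also have "\<dots> = (\<integral>\<^sup>+w. ennreal (\<Sum>u<k. \<psi> (real (V k (walk (\<lambda>i. w (cyc k u i)))) / real k)) * indicator E w \<partial>P)"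
      by (simp add: sum_distrib_right[symmetric] sum_ennreal \<psi>(3))
    finally show ?thesis .
  qed
  have I0: "0 \<le> integral {0..1} \<psi>" using \<psi>(2,3)
    by (intro integral_nonneg integrable_continuous_interval) (auto intro: continuous_on_subset)
  have kI: "(\<integral>\<^sup>+w. ennreal (real k * integral {0..1} \<psi>) * indicator E w \<partial>P) = of_nat k * (ennreal (integral {0..1} \<psi>) * emeasure P E)"
    unfolding nn_integral_cmult_indicator[OF E1] using I0 by (simp add: ennreal_mult mult.assoc ennreal_of_nat_eq_real_of_nat)
  have cancel: "of_nat k * a \<le> of_nat k * b \<Longrightarrow> a \<le> b" for a b :: ennreal
    using k by (subst (asm) ennreal_mult_le_mult_iff) auto
  show "(\<integral>\<^sup>+w. ennreal (\<psi> (real (L k (walk w)) / real k)) * indicator E w \<partial>PiM UNIV (\<lambda>_. \<mu>))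
      \<le> ennreal (integral {0..1} \<psi>) * emeasure (PiM UNIV (\<lambda>_. \<mu>)) E"
    unfolding P_def[symmetric]
    by (rule cancel, unfold avg[OF LU(2)] kI[symmetric], intro nn_integral_mono mult_right_mono ennreal_leI cyclic_average(1)[OF LU(1) k \<psi>(1,2)]) simp
  show "ennreal (integral {0..1} \<psi>) * emeasure (PiM UNIV (\<lambda>_. \<mu>)) E
      \<le> (\<integral>\<^sup>+w. ennreal (\<psi> (real (U k (walk w)) / real k)) * indicator E w \<partial>PiM UNIV (\<lambda>_. \<mu>))"
    unfolding P_def[symmetric]
    by (rule cancel, unfold avg[OF LU(3)] kI[symmetric], intro nn_integral_mono mult_right_mono ennreal_leI cyclic_average(2)[OF LU(1) k \<psi>(1,2)]) simp
qed

context spectrally_negative begin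

definition K :: "nat \<Rightarrow> 'a \<Rightarrow> nat" where "K m \<omega> = last_nonpos m (\<lambda>t. X t \<omega>)"
definition skeleton :: "nat \<Rightarrow> 'a \<Rightarrow> nat \<Rightarrow> real" where "skeleton m \<omega> j = X (real j / 2 ^ m) \<omega>"

lemma K_eq_iff: "K m \<omega> = k \<longleftrightarrow> skeleton m \<omega> k \<le> 0 \<and> (\<forall>j>k. 0 < skeleton m \<omega> j)"
proof
  assume "K m \<omega> = k"
  then show "skeleton m \<omega> k \<le> 0 \<and> (\<forall>j>k. 0 < skeleton m \<omega> j)"
    using last_nonpos(2)[OF good[of \<omega>], of m] last_nonpos(3)[OF good[of \<omega>], where m=m]
    unfolding K_def skeleton_def by (metis not_le)
next
  assume h: "skeleton m \<omega> k \<le> 0 \<and> (\<forall>j>k. 0 < skeleton m \<omega> j)"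
  show "K m \<omega> = k"
  proof (rule antisym)
    show "k \<le> K m \<omega>" using h last_nonpos(3)[OF good[of \<omega>], where m=m] unfolding K_def skeleton_def by simp
    show "K m \<omega> \<le> k" using h last_nonpos(2)[OF good[of \<omega>], of m] unfolding K_def skeleton_def by (meson not_le)
  qed
qed

lemma skeleton_measurable [measurable]: "skeleton m \<in> measurable M (PiM UNIV (\<lambda>_. borel))"
  unfolding skeleton_def by (intro measurable_PiM_single' measurable_X) auto

lemma K_measurable [measurable]: "K m \<in> measurable M (count_space UNIV)"
proof (rule measurable_count_space_eq2_countable[THEN iffD2], intro conjI ballI)
  fix k
  have [measurable]: "(\<lambda>\<omega>. skeleton m \<omega> j) \<in> borel_measurable M" for j
    unfolding skeleton_def by (rule measurable_X) simp
  have "K m -` {k} \<inter> space M = {\<omega>\<in>space M. skeleton m \<omega> k \<le> 0 \<and> (\<forall>j>k. 0 < skeleton m \<omega> j)}"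
  proof (rule set_eqI)
    fix \<omega> show "\<omega> \<in> K m -` {k} \<inter> space M \<longleftrightarrow> \<omega> \<in> {\<omega>\<in>space M. skeleton m \<omega> k \<le> 0 \<and> (\<forall>j>k. 0 < skeleton m \<omega> j)}"
      using K_eq_iff[of m \<omega> k] by (simp only: Int_iff vimage_eq singleton_iff mem_Collect_eq) blast
  qed
  also have "\<dots> \<in> sets M" by measurable
  finally show "K m -` {k} \<inter> space M \<in> sets M" .
qed auto

lemma functional_measurable:
  assumes "measurable_functional L"
  shows "(\<lambda>\<omega>. real (L (K m \<omega>) (skeleton m \<omega>))) \<in> borel_measurable M"
proof (rule measurable_compose_countable[of "\<lambda>k \<omega>. real (L k (skeleton m \<omega>))"])
  fix k show "(\<lambda>\<omega>. real (L k (skeleton m \<omega>))) \<in> borel_measurable M"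
    using assms by (intro measurable_compose[OF skeleton_measurable]) (auto simp: measurable_functional_def)
qed (rule K_measurable)

text \<open>Sum over the values \<open>k\<close> of the last nonpositive index.  As \<open>\<phi> 0 = 0\<close>, the value \<open>k = 0\<close>, for which
  there is nothing to rotate, does not contribute.\<close>

lemma expectation_bounds:
  assumes LU: "cyclically_uniform L U" "measurable_functional L" "measurable_functional U"
    and \<phi>: "\<And>t. 0 \<le> \<phi> t" "\<phi> 0 = 0" and \<psi>: "mono \<psi>" "continuous_on UNIV \<psi>" "\<And>r. 0 \<le> \<psi> r"
  shows "(\<integral>\<^sup>+\<omega>. ennreal (\<phi> (real (K m \<omega>) / 2 ^ m)) * ennreal (\<psi> (real (L (K m \<omega>) (skeleton m \<omega>)) / real (K m \<omega>))) \<partial>M)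
      \<le> ennreal (integral {0..1} \<psi>) * (\<integral>\<^sup>+\<omega>. ennreal (\<phi> (real (K m \<omega>) / 2 ^ m)) \<partial>M)"
    and "ennreal (integral {0..1} \<psi>) * (\<integral>\<^sup>+\<omega>. ennreal (\<phi> (real (K m \<omega>) / 2 ^ m)) \<partial>M)
      \<le> (\<integral>\<^sup>+\<omega>. ennreal (\<phi> (real (K m \<omega>) / 2 ^ m)) * ennreal (\<psi> (real (U (K m \<omega>) (skeleton m \<omega>)) / real (K m \<omega>))) \<partial>M)"
proof -
  define \<delta> :: real where "\<delta> = 1 / 2 ^ m"
  have \<delta>: "0 < \<delta>" by (simp add: \<delta>_def)
  define \<mu> where "\<mu> = distr M borel (X \<delta>)"
  have \<mu>: "prob_space \<mu>" "sets \<mu> = sets borel"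
    unfolding \<mu>_def using \<delta> by (auto intro!: prob_space_distr measurable_X)
  define P where "P = PiM (UNIV::nat set) (\<lambda>_. \<mu>)"
  define \<xi> where "\<xi> = (\<lambda>\<omega> i. X (\<delta> * real (Suc i)) \<omega> - X (\<delta> * real i) \<omega>)"
  have sP[measurable_cong]: "sets P = sets (PiM UNIV (\<lambda>_. borel))"
    unfolding P_def by (intro sets_PiM_cong refl) (simp add: \<mu>)
  have \<xi>m: "\<xi> \<in> measurable M (PiM UNIV (\<lambda>_. borel))"
    unfolding \<xi>_def using \<delta> by (intro measurable_PiM_single' borel_measurable_diff measurable_X) auto
  have \<xi>m': "\<xi> \<in> measurable M P" using \<xi>m sP by (simp cong: measurable_cong_sets)
  have \<xi>P: "distr M (PiM UNIV (\<lambda>_. borel)) \<xi> = P"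
    unfolding \<xi>_def P_def \<mu>_def by (rule iid_grid[OF \<delta>])
  have wk: "walk (\<xi> \<omega>) = skeleton m \<omega>" for \<omega>
    unfolding walk_def \<xi>_def skeleton_def \<delta>_def by (subst sum_lessThan_telescope) (simp add: fun_eq_iff)
  define E where "E = (\<lambda>k. {w\<in>space P. walk w k \<le> 0 \<and> (\<forall>j>k. 0 < walk w j)})"
  have [measurable]: "(\<lambda>w. walk w j) \<in> borel_measurable P" for j unfolding walk_def by measurable
  have E[measurable]: "E k \<in> sets P" for k unfolding E_def by measurable
  have spP: "space P = UNIV" using sets_eq_imp_space_eq[OF sP] by (simp add: space_PiM)
  have KE: "K m \<omega> = k \<longleftrightarrow> \<xi> \<omega> \<in> E k" for \<omega> k by (simp add: K_eq_iff E_def spP wk)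
  have Einv: "(\<lambda>i. w (cyc k u i)) \<in> E k \<longleftrightarrow> w \<in> E k" if "u < k" for w u k
    using that by (auto simp: E_def spP walk_cyc_ge)
  have wm: "walk \<in> measurable P (PiM UNIV (\<lambda>_. borel))"
    unfolding walk_def by (intro measurable_PiM_single') auto
  have [measurable]: "\<psi> \<in> borel_measurable borel" using \<psi>(2) by (rule borel_measurable_continuous_onI)
  have Vm[measurable]: "(\<lambda>w. real (V k (walk w))) \<in> borel_measurable P" if "measurable_functional V" for V k
  proof -
    have "(\<lambda>S. real (V k S)) \<in> borel_measurable (PiM UNIV (\<lambda>_. borel))" by (rule that[unfolded measurable_functional_def, rule_format])
    from measurable_compose[OF wm this] show ?thesis .
  qed
  define c where "c = (\<lambda>k. ennreal (\<phi> (real k / 2 ^ m)))"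
  have split: "(\<integral>\<^sup>+\<omega>. c (K m \<omega>) * h (K m \<omega>) (\<xi> \<omega>) \<partial>M) = (\<Sum>k. c k * (\<integral>\<^sup>+w. h k w * indicator (E k) w \<partial>P))"
    if h[measurable]: "\<And>k. h k \<in> borel_measurable P" for h :: "nat \<Rightarrow> (nat \<Rightarrow> real) \<Rightarrow> ennreal"
  proof -
    have h': "(\<lambda>\<omega>. h k (\<xi> \<omega>)) \<in> borel_measurable M" "(\<lambda>\<omega>. indicator (E k) (\<xi> \<omega>) :: ennreal) \<in> borel_measurable M" for k
      by (rule measurable_compose[OF \<xi>m' h], rule measurable_compose[OF \<xi>m' borel_measurable_indicator[OF E]])
    have "c (K m \<omega>) * h (K m \<omega>) (\<xi> \<omega>) = (\<Sum>k. c k * (h k (\<xi> \<omega>) * indicator (E k) (\<xi> \<omega>)))" for \<omega>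
    proof -
      have "c k * (h k (\<xi> \<omega>) * indicator (E k) (\<xi> \<omega>)) = (if k = K m \<omega> then c k * h k (\<xi> \<omega>) else 0)" for k
        using KE[of \<omega> k] by (auto simp: indicator_def)
      then show ?thesis using sums_unique[OF sums_single[of "K m \<omega>" "\<lambda>k. c k * h k (\<xi> \<omega>)"]] by simp
    qed
    then have "(\<integral>\<^sup>+\<omega>. c (K m \<omega>) * h (K m \<omega>) (\<xi> \<omega>) \<partial>M) = (\<integral>\<^sup>+\<omega>. (\<Sum>k. c k * (h k (\<xi> \<omega>) * indicator (E k) (\<xi> \<omega>))) \<partial>M)"
      by simp
    also have "\<dots> = (\<Sum>k. \<integral>\<^sup>+\<omega>. c k * (h k (\<xi> \<omega>) * indicator (E k) (\<xi> \<omega>)) \<partial>M)"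
      by (intro nn_integral_suminf borel_measurable_times_ennreal borel_measurable_const h')
    also have "\<dots> = (\<Sum>k. c k * (\<integral>\<^sup>+w. h k w * indicator (E k) w \<partial>P))"
    proof (rule suminf_cong)
      fix k
      have "(\<integral>\<^sup>+w. h k w * indicator (E k) w \<partial>P) = (\<integral>\<^sup>+w. h k w * indicator (E k) w \<partial>distr M (PiM UNIV (\<lambda>_. borel)) \<xi>)"
        by (simp add: \<xi>P)
      also have "\<dots> = (\<integral>\<^sup>+\<omega>. h k (\<xi> \<omega>) * indicator (E k) (\<xi> \<omega>) \<partial>M)"
      proof (rule nn_integral_distr[OF \<xi>m])
        show "(\<lambda>w. h k w * indicator (E k) w) \<in> borel_measurable (distr M (PiM UNIV (\<lambda>_. borel)) \<xi>)"
          unfolding \<xi>P by measurable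
      qed
      finally have eq: "(\<integral>\<^sup>+w. h k w * indicator (E k) w \<partial>P) = (\<integral>\<^sup>+\<omega>. h k (\<xi> \<omega>) * indicator (E k) (\<xi> \<omega>) \<partial>M)" .
      show "(\<integral>\<^sup>+\<omega>. c k * (h k (\<xi> \<omega>) * indicator (E k) (\<xi> \<omega>)) \<partial>M) = c k * (\<integral>\<^sup>+w. h k w * indicator (E k) w \<partial>P)"
        unfolding eq by (rule nn_integral_cmult) (rule borel_measurable_times_ennreal[OF h'])
    qed
    finally show ?thesis .
  qed
  have tot: "(\<integral>\<^sup>+\<omega>. c (K m \<omega>) \<partial>M) = (\<Sum>k. c k * emeasure P (E k))"
    using split[of "\<lambda>_ _. 1"] by (simp add: nn_integral_indicator)
  have c0: "c 0 = 0" using \<phi> by (simp add: c_def)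
  note B = iid_cyclic_bounds[OF \<mu> LU _ \<psi>, folded P_def]
  have "(\<integral>\<^sup>+\<omega>. c (K m \<omega>) * ennreal (\<psi> (real (L (K m \<omega>) (skeleton m \<omega>)) / real (K m \<omega>))) \<partial>M)
     = (\<Sum>k. c k * (\<integral>\<^sup>+w. ennreal (\<psi> (real (L k (walk w)) / real k)) * indicator (E k) w \<partial>P))"
    using split[of "\<lambda>k w. ennreal (\<psi> (real (L k (walk w)) / real k))"] Vm[OF LU(2)] by (simp add: wk)
  also have "\<dots> \<le> (\<Sum>k. c k * (ennreal (integral {0..1} \<psi>) * emeasure P (E k)))"
  proof (intro suminf_le)
    fix k show "c k * (\<integral>\<^sup>+w. ennreal (\<psi> (real (L k (walk w)) / real k)) * indicator (E k) w \<partial>P) \<le> c k * (ennreal (integral {0..1} \<psi>) * emeasure P (E k))"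
    proof (cases "k = 0")
      case False then show ?thesis using E[of k] Einv by (intro mult_left_mono B(1)) auto
    qed (simp add: c0)
  qed auto
  also have "\<dots> = ennreal (integral {0..1} \<psi>) * (\<integral>\<^sup>+\<omega>. c (K m \<omega>) \<partial>M)"
    unfolding tot ennreal_suminf_cmult[symmetric] by (simp add: mult.left_commute)
  finally show "(\<integral>\<^sup>+\<omega>. ennreal (\<phi> (real (K m \<omega>) / 2 ^ m)) * ennreal (\<psi> (real (L (K m \<omega>) (skeleton m \<omega>)) / real (K m \<omega>))) \<partial>M)
      \<le> ennreal (integral {0..1} \<psi>) * (\<integral>\<^sup>+\<omega>. ennreal (\<phi> (real (K m \<omega>) / 2 ^ m)) \<partial>M)" by (simp add: c_def)
  have "ennreal (integral {0..1} \<psi>) * (\<integral>\<^sup>+\<omega>. c (K m \<omega>) \<partial>M) = (\<Sum>k. c k * (ennreal (integral {0..1} \<psi>) * emeasure P (E k)))"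
    unfolding tot ennreal_suminf_cmult[symmetric] by (simp add: mult.left_commute)
  also have "\<dots> \<le> (\<Sum>k. c k * (\<integral>\<^sup>+w. ennreal (\<psi> (real (U k (walk w)) / real k)) * indicator (E k) w \<partial>P))"
  proof (intro suminf_le)
    fix k show "c k * (ennreal (integral {0..1} \<psi>) * emeasure P (E k)) \<le> c k * (\<integral>\<^sup>+w. ennreal (\<psi> (real (U k (walk w)) / real k)) * indicator (E k) w \<partial>P)"
    proof (cases "k = 0")
      case False then show ?thesis using E[of k] Einv by (intro mult_left_mono B(2)) auto
    qed (simp add: c0)
  qed auto
  also have "\<dots> = (\<integral>\<^sup>+\<omega>. c (K m \<omega>) * ennreal (\<psi> (real (U (K m \<omega>) (skeleton m \<omega>)) / real (K m \<omega>))) \<partial>M)"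
    using split[of "\<lambda>k w. ennreal (\<psi> (real (U k (walk w)) / real k))"] Vm[OF LU(3)] by (simp add: wk)
  finally show "ennreal (integral {0..1} \<psi>) * (\<integral>\<^sup>+\<omega>. ennreal (\<phi> (real (K m \<omega>) / 2 ^ m)) \<partial>M)
      \<le> (\<integral>\<^sup>+\<omega>. ennreal (\<phi> (real (K m \<omega>) / 2 ^ m)) * ennreal (\<psi> (real (U (K m \<omega>) (skeleton m \<omega>)) / real (K m \<omega>))) \<partial>M)"
    by (simp add: c_def)
qed

end

section \<open>From the uniform law to the conditional distribution\<close>

text \<open>Continuous nondecreasing approximations of the indicator of \<open>{y<..}\<close>: continuity is needed for the
  limit along the grids, monotonicity for the two-sided bounds.\<close>

definition ramp :: "nat \<Rightarrow> real \<Rightarrow> real \<Rightarrow> real" where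
  "ramp n y r = max 0 (min 1 (real n * (r - y)))"

lemma ramp_continuous: "continuous_on UNIV (ramp n y)"
  unfolding ramp_def by (intro continuous_intros)

lemma ramp_borel [measurable]: "ramp n y \<in> borel_measurable borel"
  by (rule borel_measurable_continuous_onI[OF ramp_continuous])

lemma ramp_mono: "mono (ramp n y)"
  unfolding ramp_def by (intro monoI max.mono min.mono mult_left_mono) auto

lemma ramp_bounds: "0 \<le> ramp n y r" "ramp n y r \<le> 1"
  by (auto simp: ramp_def)

lemma ramp_zero: "r \<le> y \<Longrightarrow> ramp n y r = 0"
  using mult_nonneg_nonpos[of "real n" "r - y"] by (simp add: ramp_def)

lemma ramp_tendsto: "(\<lambda>n. ramp n y r) \<longlonglongrightarrow> indicator {y<..} r"
proof (cases "y < r")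
  case True
  obtain n0 :: nat where n0: "1 / (r - y) < real n0" using reals_Archimedean2 by blast
  have "\<forall>\<^sub>F n in sequentially. ramp n y r = indicator {y<..} r"
    using eventually_ge_at_top[of n0]
  proof eventually_elim
    case (elim n)
    have "1 / (r - y) \<le> real n" using elim n0 by (meson less_imp_le less_le_trans of_nat_mono)
    then have "1 \<le> real n * (r - y)" using True by (simp add: field_simps)
    then show ?case using True by (simp add: ramp_def)
  qed
  then show ?thesis by (rule tendsto_eventually)
qed (simp add: ramp_zero)

lemma ramp_integral_tendsto: "(\<lambda>n. integral {0..1} (ramp n y)) \<longlonglongrightarrow> measure lborel ({0..1} \<inter> {y<..})"
proof -
  have eq: "integral {0..1} (ramp n y) = (\<integral>r. indicator {0..1} r * ramp n y r \<partial>lborel)" for n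
  proof -
    have "set_integrable lborel {0..1} (ramp n y)" unfolding set_integrable_def real_scaleR_def
    proof (rule Bochner_Integration.integrable_bound[of lborel "indicator {0..1} :: real \<Rightarrow> real"])
      show "AE r in lborel. norm (indicator {0..1} r * ramp n y r) \<le> norm (indicator {0..1} r :: real)"
        using ramp_bounds[of n y] by (auto simp: indicator_def)
    qed auto
    from set_borel_integral_eq_integral(2)[OF this] show ?thesis
      by (simp add: set_lebesgue_integral_def)
  qed
  have "(\<lambda>n. \<integral>r. indicator {0..1} r * ramp n y r \<partial>lborel) \<longlonglongrightarrow> (\<integral>r. indicator {0..1} r * indicator {y<..} r \<partial>lborel)"
  proof (rule integral_dominated_convergence[where w="indicator {0..1}"])
    show "AE r in lborel. (\<lambda>n. indicator {0..1} r * ramp n y r) \<longlonglongrightarrow> indicator {0..1} r * indicator {y<..} r"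
      by (intro AE_I2 tendsto_intros ramp_tendsto)
    show "AE r in lborel. norm (indicator {0..1} r * ramp n y r) \<le> indicator {0..1} r" for n
      using ramp_bounds[of n y] by (auto simp: indicator_def)
  qed auto
  also have "(\<integral>r. indicator {0..1} r * indicator {y<..} r \<partial>lborel) = measure lborel ({0..1} \<inter> {y<..})"
    by (simp flip: indicator_inter_arith)
  finally show ?thesis by (simp add: eq)
qed

text \<open>On the event \<open>0 < S\<close>, \<open>R\<close> is uniform on the unit interval and independent of \<open>S\<close>.\<close>

definition indep_uniform :: "'a measure \<Rightarrow> ('a \<Rightarrow> real) \<Rightarrow> ('a \<Rightarrow> real) \<Rightarrow> bool" where
  "indep_uniform N S R \<longleftrightarrow> (\<forall>A\<in>sets borel. \<forall>B\<in>sets borel.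
     measure N {\<omega>\<in>space N. 0 < S \<omega> \<and> S \<omega> \<in> A \<and> R \<omega> \<in> B}
     = measure N {\<omega>\<in>space N. 0 < S \<omega> \<and> S \<omega> \<in> A} * measure lborel ({0..1} \<inter> B))"

lemma measure_unit_interval: "emeasure lborel ({0..1} \<inter> B) = ennreal (measure lborel ({0..1} \<inter> B))"
  if "B \<in> sets borel" for B :: "real set"
proof -
  have "emeasure lborel ({0..1} \<inter> B) \<le> emeasure lborel {0..1::real}" using that by (intro emeasure_mono) auto
  also have "\<dots> < \<infinity>" by simp
  finally show ?thesis by (intro emeasure_eq_ennreal_measure) auto
qed

lemma indep_uniform_from_ramps:
  assumes "prob_space N" and [measurable]: "S \<in> borel_measurable N" "R \<in> borel_measurable N"
    and eq: "\<And>n n' a y. 0 \<le> a \<Longrightarrow>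
      (\<integral>\<omega>. ramp n a (S \<omega>) * ramp n' y (R \<omega>) \<partial>N) = integral {0..1} (ramp n' y) * (\<integral>\<omega>. ramp n a (S \<omega>) \<partial>N)"
  shows "indep_uniform N S R"
proof -
  interpret prob_space N by fact
  have rays: "prob {\<omega>\<in>space N. a < S \<omega> \<and> y < R \<omega>} = prob {\<omega>\<in>space N. a < S \<omega>} * measure lborel ({0..1} \<inter> {y<..})"
    if a: "0 \<le> a" for a y
  proof -
    have "(\<lambda>n. \<integral>\<omega>. ramp n a (S \<omega>) * ramp n y (R \<omega>) \<partial>N) \<longlonglongrightarrow> (\<integral>\<omega>. indicator {a<..} (S \<omega>) * indicator {y<..} (R \<omega>) \<partial>N)"
    proof (rule integral_dominated_convergence[where w="\<lambda>_. 1"])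
      show "AE \<omega> in N. (\<lambda>n. ramp n a (S \<omega>) * ramp n y (R \<omega>)) \<longlonglongrightarrow> indicator {a<..} (S \<omega>) * indicator {y<..} (R \<omega>)"
        by (intro AE_I2 tendsto_intros ramp_tendsto)
      show "AE \<omega> in N. norm (ramp n a (S \<omega>) * ramp n y (R \<omega>)) \<le> 1" for n
        using ramp_bounds by (auto simp: abs_mult intro!: mult_le_one)
    qed auto
    moreover have "(\<lambda>n. integral {0..1} (ramp n y) * (\<integral>\<omega>. ramp n a (S \<omega>) \<partial>N))
        \<longlonglongrightarrow> measure lborel ({0..1} \<inter> {y<..}) * (\<integral>\<omega>. indicator {a<..} (S \<omega>) \<partial>N)"
    proof (intro tendsto_mult ramp_integral_tendsto integral_dominated_convergence[where w="\<lambda>_. 1"])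
      show "AE \<omega> in N. (\<lambda>n. ramp n a (S \<omega>)) \<longlonglongrightarrow> indicator {a<..} (S \<omega>)"
        by (intro AE_I2 ramp_tendsto)
      show "AE \<omega> in N. norm (ramp n a (S \<omega>)) \<le> 1" for n
        using ramp_bounds by auto
    qed auto
    ultimately have "(\<integral>\<omega>. indicator {a<..} (S \<omega>) * indicator {y<..} (R \<omega>) \<partial>N) = measure lborel ({0..1} \<inter> {y<..}) * (\<integral>\<omega>. indicator {a<..} (S \<omega>) \<partial>N)"
      unfolding eq[OF a] by (rule LIMSEQ_unique)
    moreover have "(\<integral>\<omega>. indicator {a<..} (S \<omega>) * indicator {y<..} (R \<omega>) \<partial>N) = prob {\<omega>\<in>space N. a < S \<omega> \<and> y < R \<omega>}"
    proof -
      have "(\<integral>\<omega>. indicator {a<..} (S \<omega>) * indicator {y<..} (R \<omega>) \<partial>N) = (\<integral>\<omega>. (indicator {\<omega>\<in>space N. a < S \<omega> \<and> y < R \<omega>} \<omega> :: real) \<partial>N)"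
        by (intro Bochner_Integration.integral_cong) (auto simp: indicator_def)
      also have "\<dots> = prob {\<omega>\<in>space N. a < S \<omega> \<and> y < R \<omega>}"
        by (subst Bochner_Integration.integral_indicator) (auto intro!: arg_cong[of _ _ prob])
      finally show ?thesis .
    qed
    moreover have "(\<integral>\<omega>. indicator {a<..} (S \<omega>) \<partial>N) = prob {\<omega>\<in>space N. a < S \<omega>}"
    proof -
      have "(\<integral>\<omega>. indicator {a<..} (S \<omega>) \<partial>N) = (\<integral>\<omega>. (indicator {\<omega>\<in>space N. a < S \<omega>} \<omega> :: real) \<partial>N)"
        by (intro Bochner_Integration.integral_cong) (auto simp: indicator_def)
      also have "\<dots> = prob {\<omega>\<in>space N. a < S \<omega>}"
        by (subst Bochner_Integration.integral_indicator) (auto intro!: arg_cong[of _ _ prob])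
      finally show ?thesis .
    qed
    ultimately show ?thesis by (simp add: mult.commute)
  qed
  have half: "prob {\<omega>\<in>space N. a < S \<omega> \<and> R \<omega> \<in> B} = prob {\<omega>\<in>space N. a < S \<omega>} * measure lborel ({0..1} \<inter> B)"
    if a: "0 \<le> a" and B[measurable]: "B \<in> sets borel" for a B
  proof -
    let ?N1 = "distr (density N (indicator {\<omega>\<in>space N. a < S \<omega>})) borel R"
    define c where "c = ennreal (prob {\<omega>\<in>space N. a < S \<omega>})"
    let ?N2 = "density lborel (\<lambda>r::real. c * indicator {0..1} r)"
    have e1: "emeasure ?N1 C = prob {\<omega>\<in>space N. a < S \<omega> \<and> R \<omega> \<in> C}" if C[measurable]: "C \<in> sets borel" for C
    proof -
      have "emeasure ?N1 C = emeasure (density N (indicator {\<omega>\<in>space N. a < S \<omega>})) (R -` C \<inter> space N)"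
        by (subst emeasure_distr) auto
      also have "\<dots> = emeasure N ({\<omega>\<in>space N. a < S \<omega>} \<inter> (R -` C \<inter> space N))"
        by (subst emeasure_density) (auto simp flip: indicator_inter_arith)
      also have "{\<omega>\<in>space N. a < S \<omega>} \<inter> (R -` C \<inter> space N) = {\<omega>\<in>space N. a < S \<omega> \<and> R \<omega> \<in> C}" by auto
      finally show ?thesis by (simp add: emeasure_eq_measure)
    qed
    have e2: "emeasure ?N2 C = ennreal (prob {\<omega>\<in>space N. a < S \<omega>} * measure lborel ({0..1} \<inter> C))" if C[measurable]: "C \<in> sets borel" for C
    proof -
      have "emeasure ?N2 C = (\<integral>\<^sup>+r. c * indicator ({0..1} \<inter> C) r \<partial>lborel)"
        by (subst emeasure_density) (auto simp: indicator_inter_arith mult.assoc intro!: nn_integral_cong)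
      also have "\<dots> = c * emeasure lborel ({0..1} \<inter> C)"
        by (rule nn_integral_cmult_indicator) auto
      finally show ?thesis by (simp add: measure_unit_interval[OF C] ennreal_mult c_def)
    qed
    have "?N1 = ?N2"
    proof (rule measure_eqI_lessThan)
      show "emeasure ?N1 {y<..} < \<infinity>" for y using e1[of "{y<..}"] by simp
      show "emeasure ?N1 {y<..} = emeasure ?N2 {y<..}" for y
        using e1[of "{y<..}"] e2[of "{y<..}"] rays[OF a, of y] by simp
    qed auto
    then show ?thesis using e1[OF B] e2[OF B] by simp
  qed
  show ?thesis unfolding indep_uniform_def
  proof (intro ballI)
    fix A B :: "real set" assume A: "A \<in> sets borel" and B[measurable]: "B \<in> sets borel"
    let ?N1 = "distr (density N (indicator {\<omega>\<in>space N. 0 < S \<omega> \<and> R \<omega> \<in> B})) borel S"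
    let ?N2 = "distr (density N (\<lambda>\<omega>. ennreal (measure lborel ({0..1} \<inter> B)) * indicator {\<omega>\<in>space N. 0 < S \<omega>} \<omega>)) borel S"
    have e1: "emeasure ?N1 C = prob {\<omega>\<in>space N. 0 < S \<omega> \<and> S \<omega> \<in> C \<and> R \<omega> \<in> B}" if C[measurable]: "C \<in> sets borel" for C
    proof -
      have "emeasure ?N1 C = emeasure (density N (indicator {\<omega>\<in>space N. 0 < S \<omega> \<and> R \<omega> \<in> B})) (S -` C \<inter> space N)"
        by (subst emeasure_distr) auto
      also have "\<dots> = emeasure N ({\<omega>\<in>space N. 0 < S \<omega> \<and> R \<omega> \<in> B} \<inter> (S -` C \<inter> space N))"
        by (subst emeasure_density) (auto simp flip: indicator_inter_arith)
      also have "{\<omega>\<in>space N. 0 < S \<omega> \<and> R \<omega> \<in> B} \<inter> (S -` C \<inter> space N) = {\<omega>\<in>space N. 0 < S \<omega> \<and> S \<omega> \<in> C \<and> R \<omega> \<in> B}" by auto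
      finally show ?thesis by (simp add: emeasure_eq_measure)
    qed
    have e2: "emeasure ?N2 C = ennreal (prob {\<omega>\<in>space N. 0 < S \<omega> \<and> S \<omega> \<in> C} * measure lborel ({0..1} \<inter> B))" if C[measurable]: "C \<in> sets borel" for C
    proof -
      have "emeasure ?N2 C = emeasure (density N (\<lambda>\<omega>. ennreal (measure lborel ({0..1} \<inter> B)) * indicator {\<omega>\<in>space N. 0 < S \<omega>} \<omega>)) (S -` C \<inter> space N)"
        by (subst emeasure_distr) auto
      also have "\<dots> = (\<integral>\<^sup>+\<omega>. ennreal (measure lborel ({0..1} \<inter> B)) * indicator ({\<omega>\<in>space N. 0 < S \<omega>} \<inter> (S -` C \<inter> space N)) \<omega> \<partial>N)"
        by (subst emeasure_density) (auto simp: indicator_inter_arith mult.assoc intro!: nn_integral_cong)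
      also have "\<dots> = ennreal (measure lborel ({0..1} \<inter> B)) * emeasure N ({\<omega>\<in>space N. 0 < S \<omega>} \<inter> (S -` C \<inter> space N))"
        by (rule nn_integral_cmult_indicator) auto
      also have "{\<omega>\<in>space N. 0 < S \<omega>} \<inter> (S -` C \<inter> space N) = {\<omega>\<in>space N. 0 < S \<omega> \<and> S \<omega> \<in> C}" by auto
      finally show ?thesis by (simp add: emeasure_eq_measure ennreal_mult mult.commute)
    qed
    have "?N1 = ?N2"
    proof (rule measure_eqI_lessThan)
      show "emeasure ?N1 {y<..} < \<infinity>" for y using e1[of "{y<..}"] by simp
      show "emeasure ?N1 {y<..} = emeasure ?N2 {y<..}" for y
      proof -
        have "{\<omega>\<in>space N. 0 < S \<omega> \<and> S \<omega> \<in> {y<..} \<and> R \<omega> \<in> B} = {\<omega>\<in>space N. max 0 y < S \<omega> \<and> R \<omega> \<in> B}"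
          "{\<omega>\<in>space N. 0 < S \<omega> \<and> S \<omega> \<in> {y<..}} = {\<omega>\<in>space N. max 0 y < S \<omega>}" by auto
        then show ?thesis using e1[of "{y<..}"] e2[of "{y<..}"] half[of "max 0 y" B] by simp
      qed
    qed auto
    then show "prob {\<omega>\<in>space N. 0 < S \<omega> \<and> S \<omega> \<in> A \<and> R \<omega> \<in> B} = prob {\<omega>\<in>space N. 0 < S \<omega> \<and> S \<omega> \<in> A} * measure lborel ({0..1} \<inter> B)"
      using e1[OF A] e2[OF A] by simp
  qed
qed

lemma indep_uniform_reflect:
  assumes "indep_uniform N S R" shows "indep_uniform N S (\<lambda>\<omega>. 1 - R \<omega>)"
  unfolding indep_uniform_def
proof (intro ballI)
  fix A B :: "real set" assume A: "A \<in> sets borel" and B[measurable]: "B \<in> sets borel"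
  let ?C = "(\<lambda>r. 1 - r) -` B"
  have C: "?C \<in> sets borel" using measurable_sets[of "\<lambda>r::real. 1 - r" borel borel B] by simp
  have "emeasure lborel ({0..1} \<inter> B) = emeasure (distr lborel borel (\<lambda>r. 1 + (-1) * r)) ({0..1} \<inter> B)"
    using lborel_real_affine[of "-1" 1] by (simp add: density_1)
  also have "\<dots> = emeasure lborel ((\<lambda>r. 1 + (-1) * r) -` ({0..1} \<inter> B))" by (subst emeasure_distr) auto
  also have "(\<lambda>r. 1 + (-1) * r) -` ({0..1} \<inter> B) = {0..1} \<inter> ?C" by auto
  finally have "measure lborel ({0..1} \<inter> B) = measure lborel ({0..1} \<inter> ?C)" by (simp add: measure_def)
  then show "measure N {\<omega>\<in>space N. 0 < S \<omega> \<and> S \<omega> \<in> A \<and> 1 - R \<omega> \<in> B} = measure N {\<omega>\<in>space N. 0 < S \<omega> \<and> S \<omega> \<in> A} * measure lborel ({0..1} \<inter> B)"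
    using assms[unfolded indep_uniform_def, rule_format, OF A C] by simp
qed

lemma indep_uniform_cong_AE:
  assumes [measurable]: "S \<in> borel_measurable N" "R \<in> borel_measurable N" "S' \<in> borel_measurable N" "R' \<in> borel_measurable N"
    and ae: "AE \<omega> in N. S \<omega> = S' \<omega> \<and> (0 < S \<omega> \<longrightarrow> R \<omega> = R' \<omega>)" and u: "indep_uniform N S' R'"
  shows "indep_uniform N S R"
  unfolding indep_uniform_def
proof (intro ballI)
  fix A B :: "real set" assume AB[measurable]: "A \<in> sets borel" "B \<in> sets borel"
  have "measure N {\<omega>\<in>space N. 0 < S \<omega> \<and> S \<omega> \<in> A \<and> R \<omega> \<in> B} = measure N {\<omega>\<in>space N. 0 < S' \<omega> \<and> S' \<omega> \<in> A \<and> R' \<omega> \<in> B}"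
  proof (rule measure_eq_AE)
    show "AE \<omega> in N. (\<omega> \<in> {\<omega>\<in>space N. 0 < S \<omega> \<and> S \<omega> \<in> A \<and> R \<omega> \<in> B}) = (\<omega> \<in> {\<omega>\<in>space N. 0 < S' \<omega> \<and> S' \<omega> \<in> A \<and> R' \<omega> \<in> B})"
      using ae by eventually_elim auto
  qed measurable
  moreover have "measure N {\<omega>\<in>space N. 0 < S \<omega> \<and> S \<omega> \<in> A} = measure N {\<omega>\<in>space N. 0 < S' \<omega> \<and> S' \<omega> \<in> A}"
  proof (rule measure_eq_AE)
    show "AE \<omega> in N. (\<omega> \<in> {\<omega>\<in>space N. 0 < S \<omega> \<and> S \<omega> \<in> A}) = (\<omega> \<in> {\<omega>\<in>space N. 0 < S' \<omega> \<and> S' \<omega> \<in> A})"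
      using ae by eventually_elim auto
  qed measurable
  ultimately show "measure N {\<omega>\<in>space N. 0 < S \<omega> \<and> S \<omega> \<in> A \<and> R \<omega> \<in> B} = measure N {\<omega>\<in>space N. 0 < S \<omega> \<and> S \<omega> \<in> A} * measure lborel ({0..1} \<inter> B)"
    using u AB unfolding indep_uniform_def by simp
qed

lemma uniform_scaled:
  fixes s :: real
  assumes s: "0 < s" and C[measurable]: "C \<in> sets borel"
  shows "emeasure lborel {r\<in>{0..1}. s * r \<in> C} = ennreal (measure (uniform_measure lborel {0..s}) C)"
proof -
  have "emeasure lborel ({0..s} \<inter> C) = emeasure (density (distr lborel borel (\<lambda>r. 0 + s * r)) (\<lambda>_. ennreal \<bar>s\<bar>)) ({0..s} \<inter> C)"
    using lborel_real_affine[of s 0] s by simp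
  also have "\<dots> = ennreal s * emeasure lborel ((\<lambda>r. s * r) -` ({0..s} \<inter> C))"
    using s by (simp add: emeasure_density_const emeasure_distr)
  also have "(\<lambda>r. s * r) -` ({0..s} \<inter> C) = {r\<in>{0..1}. s * r \<in> C}"
    using s by (auto simp: zero_le_mult_iff)
  finally have e: "emeasure lborel ({0..s} \<inter> C) = ennreal s * emeasure lborel {r\<in>{0..1}. s * r \<in> C}" .
  have "emeasure (uniform_measure lborel {0..s}) C = emeasure lborel ({0..s} \<inter> C) / emeasure lborel {0..s}"
    by (rule emeasure_uniform_measure) auto
  also have "\<dots> = emeasure lborel {r\<in>{0..1}. s * r \<in> C}"
    unfolding e using s by (simp add: ennreal_mult_divide_eq mult.commute[of "ennreal s"])
  finally have e2: "emeasure (uniform_measure lborel {0..s}) C = emeasure lborel {r\<in>{0..1}. s * r \<in> C}" .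
  have "prob_space (uniform_measure lborel {0..s})" using s by (intro prob_space_uniform_measure) auto
  then interpret U: prob_space "uniform_measure lborel {0..s}" .
  show ?thesis using e2 by (simp add: U.emeasure_eq_measure)
qed

text \<open>The joint law of \<open>S\<close> and \<open>Y / S\<close> on \<open>0 < S\<close> is a product, so Fubini's theorem integrates out \<open>Y / S\<close>
  for each value \<open>s\<close> of \<open>S\<close>; scaling by \<open>s\<close> gives the uniform law on \<open>{0..s}\<close>.\<close>

lemma cond_distr_on_uniform:
  assumes "prob_space N" and S[measurable]: "S \<in> borel_measurable N" and Y[measurable]: "Y \<in> borel_measurable N"
    and u: "indep_uniform N S (\<lambda>\<omega>. Y \<omega> / S \<omega>)"
  shows "cond_distr_on N Y S {0<..} (\<lambda>t. uniform_measure lborel {0..t})"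
  unfolding cond_distr_on_def
proof (intro conjI ballI)
  interpret prob_space N by fact
  fix C :: "real set" assume C[measurable]: "C \<in> sets borel"
  define V where "V = vimage_algebra (space N) S borel"
  have subalg: "subalgebra N V"
    unfolding subalgebra_def V_def using S by (auto simp: sets_vimage_algebra2 measurable_sets)
  interpret V: finite_measure_subalgebra N V by standard (rule subalg)
  have SV: "S \<in> measurable V borel" unfolding V_def by (rule measurable_vimage_algebra1) auto
  define R where "R = (\<lambda>\<omega>. Y \<omega> / S \<omega>)"
  have [measurable]: "R \<in> borel_measurable N" unfolding R_def by measurable
  define \<kappa> where "\<kappa> = (\<lambda>s::real. enn2real (emeasure lborel {r\<in>{0..1}. s * r \<in> C}))"
  have Qm: "{p\<in>space (borel \<Otimes>\<^sub>M lborel). snd p \<in> {0..1::real} \<and> fst p * snd p \<in> C} \<in> sets (borel \<Otimes>\<^sub>M lborel)" by measurable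
  have slice: "Pair s -` {p\<in>space (borel \<Otimes>\<^sub>M lborel). snd p \<in> {0..1::real} \<and> fst p * snd p \<in> C} = {r\<in>{0..1}. s * r \<in> C}" for s :: real
    by (auto simp: space_pair_measure)
  have em[measurable]: "(\<lambda>s::real. emeasure lborel {r\<in>{0..1}. s * r \<in> C}) \<in> borel_measurable borel"
    using lborel.measurable_emeasure_Pair[OF Qm] unfolding slice .
  have \<kappa>m[measurable]: "\<kappa> \<in> borel_measurable borel" unfolding \<kappa>_def by measurable
  have \<kappa>_eq: "\<kappa> s = measure (uniform_measure lborel {0..s}) C" if "0 < s" for s
    using uniform_scaled[OF that C] by (simp add: \<kappa>_def)
  have \<kappa>01: "0 \<le> \<kappa> s" "\<kappa> s \<le> 1" "ennreal (\<kappa> s) = emeasure lborel {r\<in>{0..1}. s * r \<in> C}" for s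
  proof -
    have le: "emeasure lborel {r\<in>{0..1}. s * r \<in> C} \<le> emeasure lborel {0..1::real}" by (intro emeasure_mono) auto
    then have le1: "emeasure lborel {r\<in>{0..1}. s * r \<in> C} \<le> 1" by simp
    then show "\<kappa> s \<le> 1" unfolding \<kappa>_def by (metis enn2real_leI ennreal_1 zero_le_one)
    show "0 \<le> \<kappa> s" by (simp add: \<kappa>_def)
    have "emeasure lborel {r\<in>{0..1}. s * r \<in> C} < top" using le1 ennreal_one_less_top le_less_trans by blast
    then show "ennreal (\<kappa> s) = emeasure lborel {r\<in>{0..1}. s * r \<in> C}"
      unfolding \<kappa>_def by (simp add: ennreal_enn2real)
  qed
  let ?f = "\<lambda>\<omega>. indicator {0<..} (S \<omega>) * indicator (Y -` C \<inter> space N) \<omega> :: real"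
  let ?g = "\<lambda>\<omega>. indicator {0<..} (S \<omega>) * \<kappa> (S \<omega>)"
  have YC[measurable]: "Y -` C \<inter> space N \<in> sets N" using Y C by (rule measurable_sets)
  have indSV: "(\<lambda>\<omega>. indicator {0<..} (S \<omega>) :: real) \<in> borel_measurable V"
    by (rule measurable_compose[OF SV]) auto
  have intf: "integrable N ?f"
    by (rule integrable_const_bound[where B=1]) (auto simp: indicator_def)
  have intg: "integrable N ?g"
    by (rule integrable_const_bound[where B=1]) (use \<kappa>01 in \<open>auto simp: indicator_def\<close>)
  define E1 where "E1 = density N (indicator {\<omega>\<in>space N. 0 < S \<omega>})"
  define SR where "SR = distr E1 (borel \<Otimes>\<^sub>M borel) (\<lambda>\<omega>. (S \<omega>, R \<omega>))"
  define S1 where "S1 = distr E1 borel S"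
  define U where "U = density lborel (indicator {0..1::real})"
  have [measurable_cong]: "sets E1 = sets N" by (simp add: E1_def)
  have spE1: "space E1 = space N" by (simp add: E1_def)
  have eE1: "emeasure E1 A = emeasure N ({\<omega>\<in>space N. 0 < S \<omega>} \<inter> A)" if "A \<in> sets N" for A
    unfolding E1_def using that by (subst emeasure_density) (auto simp flip: indicator_inter_arith)
  have fS1: "finite_measure S1"
    by standard (simp add: S1_def emeasure_distr eE1 spE1 emeasure_eq_measure)
  have eU: "emeasure U B = emeasure lborel ({0..1} \<inter> B)" if "B \<in> sets borel" for B
    unfolding U_def using that by (subst emeasure_density) (auto simp flip: indicator_inter_arith)
  have fU: "finite_measure U" by standard (simp add: eU, simp add: U_def eU[unfolded U_def])
  interpret S1: finite_measure S1 by fact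
  interpret U: finite_measure U by fact
  have prod: "S1 \<Otimes>\<^sub>M U = SR"
  proof (rule pair_measure_eqI)
    show "sets (S1 \<Otimes>\<^sub>M U) = sets SR"
      unfolding SR_def by (simp, intro sets_pair_measure_cong) (auto simp: S1_def U_def)
    fix A B assume "A \<in> sets S1" "B \<in> sets U"
    then have AB[measurable]: "A \<in> sets borel" "B \<in> sets borel" by (auto simp: S1_def U_def)
    have "emeasure S1 A = emeasure N {\<omega>\<in>space N. 0 < S \<omega> \<and> S \<omega> \<in> A}"
      unfolding S1_def by (subst emeasure_distr) (auto simp: eE1 spE1 intro!: arg_cong[of _ _ "emeasure N"])
    moreover have "emeasure SR (A \<times> B) = emeasure N {\<omega>\<in>space N. 0 < S \<omega> \<and> S \<omega> \<in> A \<and> R \<omega> \<in> B}"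
      unfolding SR_def by (subst emeasure_distr) (auto simp: eE1 spE1 intro!: arg_cong[of _ _ "emeasure N"])
    ultimately show "emeasure S1 A * emeasure U B = emeasure SR (A \<times> B)"
      using u AB measure_unit_interval[of B] unfolding indep_uniform_def R_def[symmetric]
      by (simp add: eU emeasure_eq_measure ennreal_mult)
  qed (rule S1.sigma_finite_measure U.sigma_finite_measure)+
  have key: "prob {\<omega>\<in>space N. 0 < S \<omega> \<and> S \<omega> \<in> A \<and> Y \<omega> \<in> C} = (\<integral>\<omega>. indicator A (S \<omega>) * ?g \<omega> \<partial>N)"
    if A[measurable]: "A \<in> sets borel" for A
  proof -
    define Q where "Q = {p\<in>space (borel \<Otimes>\<^sub>M borel). fst p \<in> A \<and> fst p * snd p \<in> C}"
    have Q[measurable]: "Q \<in> sets (borel \<Otimes>\<^sub>M borel)"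
    proof -
      have "Q = (fst -` A \<inter> space (borel \<Otimes>\<^sub>M borel)) \<inter> ((\<lambda>p. fst p * snd p) -` C \<inter> space (borel \<Otimes>\<^sub>M borel))"
        unfolding Q_def by auto
      also have "\<dots> \<in> sets (borel \<Otimes>\<^sub>M borel)"
        by (intro sets.Int measurable_sets[OF measurable_fst A] measurable_sets[OF _ C]) measurable
      finally show ?thesis .
    qed
    have "emeasure N {\<omega>\<in>space N. 0 < S \<omega> \<and> S \<omega> \<in> A \<and> Y \<omega> \<in> C} = emeasure SR Q"
    proof -
      have m: "(\<lambda>\<omega>. (S \<omega>, R \<omega>)) \<in> measurable E1 (borel \<Otimes>\<^sub>M borel)" by measurable
      have "{\<omega>\<in>space N. 0 < S \<omega> \<and> S \<omega> \<in> A \<and> Y \<omega> \<in> C} = {\<omega>\<in>space N. 0 < S \<omega>} \<inter> ((\<lambda>\<omega>. (S \<omega>, R \<omega>)) -` Q \<inter> space N)"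
        by (auto simp: Q_def space_pair_measure R_def)
      moreover have "(\<lambda>\<omega>. (S \<omega>, R \<omega>)) -` Q \<inter> space N \<in> sets N"
        using measurable_sets[OF m Q] by (simp add: spE1 E1_def)
      ultimately show ?thesis unfolding SR_def emeasure_distr[OF m Q] spE1 by (simp add: eE1)
    qed
    also have "\<dots> = (\<integral>\<^sup>+s. emeasure U (Pair s -` Q) \<partial>S1)"
    proof -
      have "Q \<in> sets (S1 \<Otimes>\<^sub>M U)" unfolding prod SR_def sets_distr by (rule Q)
      then show ?thesis unfolding prod[symmetric] by (rule U.emeasure_pair_measure_alt)
    qed
    also have "\<dots> = (\<integral>\<^sup>+s. indicator A s * ennreal (\<kappa> s) \<partial>S1)"
    proof (rule nn_integral_cong)
      fix s
      have "Pair s -` Q = (if s \<in> A then {r. s * r \<in> C} else {})" by (auto simp: Q_def space_pair_measure)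
      moreover have "{r. s * r \<in> C} \<in> sets borel" using measurable_sets[of "(*) s" borel borel C] by (simp add: vimage_def)
      moreover have "{0..1} \<inter> {r. s * r \<in> C} = {r\<in>{0..1}. s * r \<in> C}" by auto
      ultimately show "emeasure U (Pair s -` Q) = indicator A s * ennreal (\<kappa> s)"
        unfolding \<kappa>01(3) by (cases "s \<in> A") (simp_all only: eU if_True if_False indicator_simps mult_1 mult_zero_left emeasure_empty not_False_eq_True)
    qed
    also have "\<dots> = (\<integral>\<^sup>+\<omega>. indicator A (S \<omega>) * ennreal (\<kappa> (S \<omega>)) \<partial>E1)"
      unfolding S1_def by (subst nn_integral_distr) auto
    also have "\<dots> = (\<integral>\<^sup>+\<omega>. indicator {\<omega>\<in>space N. 0 < S \<omega>} \<omega> * (indicator A (S \<omega>) * ennreal (\<kappa> (S \<omega>))) \<partial>N)"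
      unfolding E1_def by (rule nn_integral_density) auto
    also have "\<dots> = (\<integral>\<^sup>+\<omega>. ennreal (indicator A (S \<omega>) * ?g \<omega>) \<partial>N)"
      by (intro nn_integral_cong) (auto simp: indicator_def)
    also have "\<dots> = ennreal (\<integral>\<omega>. indicator A (S \<omega>) * ?g \<omega> \<partial>N)"
      by (intro nn_integral_eq_integral integrable_const_bound[where B=1]) (use \<kappa>01 in \<open>auto simp: indicator_def\<close>)
    finally show ?thesis
      by (simp add: emeasure_eq_measure) (subst (asm) ennreal_inj, auto intro!: integral_nonneg_AE simp: \<kappa>01)
  qed
  have "AE \<omega> in N. real_cond_exp N V ?f \<omega> = ?g \<omega>"
  proof (rule V.real_cond_exp_charact)
    show "?g \<in> borel_measurable V"
      by (rule measurable_compose[OF SV, of "\<lambda>s. indicator {0<..} s * \<kappa> s"]) measurable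
    fix B assume "B \<in> sets V"
    then obtain A where A: "A \<in> sets borel" "B = S -` A \<inter> space N"
      unfolding V_def by (auto simp: sets_vimage_algebra2)
    have "(\<integral>\<omega>\<in>B. ?f \<omega> \<partial>N) = (\<integral>\<omega>. indicator {\<omega>\<in>space N. 0 < S \<omega> \<and> S \<omega> \<in> A \<and> Y \<omega> \<in> C} \<omega> \<partial>N)"
      unfolding set_lebesgue_integral_def A(2)
      by (intro Bochner_Integration.integral_cong) (auto simp: indicator_def)
    also have "\<dots> = prob {\<omega>\<in>space N. 0 < S \<omega> \<and> S \<omega> \<in> A \<and> Y \<omega> \<in> C}"
      using A(1) by (subst Bochner_Integration.integral_indicator) (auto intro!: arg_cong[of _ _ prob])
    also have "\<dots> = (\<integral>\<omega>. indicator A (S \<omega>) * ?g \<omega> \<partial>N)" by (rule key[OF A(1)])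
    also have "\<dots> = (\<integral>\<omega>\<in>B. ?g \<omega> \<partial>N)"
      unfolding set_lebesgue_integral_def A(2)
      by (intro Bochner_Integration.integral_cong) (auto simp: indicator_def)
    finally show "(\<integral>\<omega>\<in>B. ?f \<omega> \<partial>N) = (\<integral>\<omega>\<in>B. ?g \<omega> \<partial>N)" .
  qed (rule intf intg)+
  moreover have "AE \<omega> in N. real_cond_exp N V ?f \<omega> = indicator {0<..} (S \<omega>) * real_cond_exp N V (indicator (Y -` C \<inter> space N)) \<omega>"
    by (rule V.real_cond_exp_mult[OF indSV _ intf]) measurable
  ultimately show "AE \<omega> in N. S \<omega> \<in> {0<..} \<longrightarrow>
     real_cond_exp N (vimage_algebra (space N) S borel) (indicator (Y -` C \<inter> space N)) \<omega> = measure (uniform_measure lborel {0..S \<omega>}) C"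
    unfolding V_def[symmetric] by eventually_elim (auto simp: \<kappa>_eq)
qed fact+

section \<open>Passage to the limit\<close>

lemma completion_measurable_AE:
  fixes f g :: "'a \<Rightarrow> real"
  assumes g: "g \<in> borel_measurable (completion M)" and ae: "AE \<omega> in completion M. f \<omega> = g \<omega>"
  shows "f \<in> borel_measurable (completion M)"
proof (rule measurableI)
  fix A :: "real set" assume "A \<in> sets borel"
  then have gA: "g -` A \<inter> space (completion M) \<in> sets (completion M)" using g by (rule measurable_sets[rotated])
  show "f -` A \<inter> space (completion M) \<in> sets (completion M)"
  proof (rule completion.in_sets_AE[OF _ gA])
    show "AE \<omega> in completion M. (\<omega> \<in> g -` A \<inter> space (completion M)) = (\<omega> \<in> f -` A \<inter> space (completion M))"
      using ae by eventually_elim auto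
  qed auto
qed auto

lemma completion_measurable_limit:
  fixes f :: "nat \<Rightarrow> 'a \<Rightarrow> real"
  assumes f: "\<And>m. f m \<in> borel_measurable M" and lim: "AE \<omega> in M. (\<lambda>m. f m \<omega>) \<longlonglongrightarrow> g \<omega>"
  shows "g \<in> borel_measurable (completion M)"
proof (rule completion_measurable_AE)
  show "(\<lambda>\<omega>. lim (\<lambda>m. f m \<omega>)) \<in> borel_measurable (completion M)"
    by (intro measurable_completion borel_measurable_lim_metric f)
  show "AE \<omega> in completion M. g \<omega> = lim (\<lambda>m. f m \<omega>)"
    by (rule AE_completion) (use lim in eventually_elim, rule limI[symmetric])
qed

text \<open>Both discrete functionals converge to \<open>Y\<close>, so the two inequalities of \<open>expectation_bounds\<close> have
  the same limit and become an equality.\<close>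

lemma (in spectrally_negative) functional_indep_uniform:
  assumes nice: "AE \<omega> in M. nice_path (\<lambda>t. X t \<omega>)"
    and LU: "cyclically_uniform L U" "measurable_functional L" "measurable_functional U"
    and lim: "\<And>x. nice_path x \<Longrightarrow> (\<lambda>m. real (L (last_nonpos m x) (\<lambda>i. x (real i / 2 ^ m))) / 2 ^ m) \<longlonglongrightarrow> Y x"
      "\<And>x. nice_path x \<Longrightarrow> (\<lambda>m. real (U (last_nonpos m x) (\<lambda>i. x (real i / 2 ^ m))) / 2 ^ m) \<longlonglongrightarrow> Y x"
  shows "(\<lambda>\<omega>. sigma_time (\<lambda>t. X t \<omega>)) \<in> borel_measurable (completion M)"
    and "(\<lambda>\<omega>. Y (\<lambda>t. X t \<omega>)) \<in> borel_measurable (completion M)"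
    and "indep_uniform (completion M) (\<lambda>\<omega>. sigma_time (\<lambda>t. X t \<omega>)) (\<lambda>\<omega>. Y (\<lambda>t. X t \<omega>) / sigma_time (\<lambda>t. X t \<omega>))"
proof -
  define S where "S = (\<lambda>\<omega>. sigma_time (\<lambda>t. X t \<omega>))"
  define Z where "Z = (\<lambda>\<omega>. Y (\<lambda>t. X t \<omega>))"
  define Tm where "Tm = (\<lambda>m \<omega>. real (K m \<omega>) / 2 ^ m)"
  define Q where "Q = (\<lambda>(V :: nat \<Rightarrow> (nat \<Rightarrow> real) \<Rightarrow> nat) m \<omega>. real (V (K m \<omega>) (skeleton m \<omega>)))"
  have Kr: "(\<lambda>\<omega>. real (K m \<omega>)) \<in> borel_measurable M" for m
    by (rule measurable_compose[OF K_measurable]) simp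
  have Tm_m[measurable]: "Tm m \<in> borel_measurable M" for m unfolding Tm_def using Kr by measurable
  have Qm: "Q V m \<in> borel_measurable M" if "measurable_functional V" for V m
    unfolding Q_def by (rule functional_measurable[OF that])
  have ratio: "(\<lambda>\<omega>. Q V m \<omega> / real (K m \<omega>)) \<in> borel_measurable M" if "measurable_functional V" for V m
    by (rule borel_measurable_divide[OF Qm[OF that] Kr])
  have S_lim: "AE \<omega> in M. (\<lambda>m. Tm m \<omega>) \<longlonglongrightarrow> S \<omega>"
    using nice by eventually_elim (simp add: Tm_def K_def S_def T_tendsto)
  have sk: "skeleton m \<omega> = (\<lambda>i. X (real i / 2 ^ m) \<omega>)" for m \<omega> by (rule ext) (rule skeleton_def)
  have Z_lim1: "AE \<omega> in M. (\<lambda>m. Q L m \<omega> / 2 ^ m) \<longlonglongrightarrow> Z \<omega>"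
    using nice
  proof eventually_elim
    case (elim \<omega>) show ?case using lim(1)[OF elim] unfolding Q_def K_def Z_def sk .
  qed
  have Z_lim2: "AE \<omega> in M. (\<lambda>m. Q U m \<omega> / 2 ^ m) \<longlonglongrightarrow> Z \<omega>"
    using nice
  proof eventually_elim
    case (elim \<omega>) show ?case using lim(2)[OF elim] unfolding Q_def K_def Z_def sk .
  qed
  note Z_lim = Z_lim1 Z_lim2
  have Sm[measurable]: "S \<in> borel_measurable (completion M)" by (rule completion_measurable_limit[OF Tm_m S_lim])
  have Zm[measurable]: "Z \<in> borel_measurable (completion M)" by (rule completion_measurable_limit[OF _ Z_lim(1)]) (rule borel_measurable_divide[OF Qm[OF LU(2)] borel_measurable_const])
  have S0: "0 \<le> S \<omega>" for \<omega> unfolding S_def by (rule sigma_nonneg[OF good])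
  interpret N: prob_space "completion M" by (rule prob_space_completion)
  have conv: "(\<lambda>m. \<integral>\<omega>. \<phi> (Tm m \<omega>) * \<psi> (Q V m \<omega> / real (K m \<omega>)) \<partial>M)
      \<longlonglongrightarrow> (\<integral>\<omega>. \<phi> (S \<omega>) * \<psi> (Z \<omega> / S \<omega>) \<partial>completion M)"
    if V: "measurable_functional V" "AE \<omega> in M. (\<lambda>m. Q V m \<omega> / 2 ^ m) \<longlonglongrightarrow> Z \<omega>"
      and \<phi>: "continuous_on UNIV \<phi>" "\<phi> 0 = 0" "\<And>t. 0 \<le> \<phi> t" "\<And>t. \<phi> t \<le> 1"
      and \<psi>: "continuous_on UNIV \<psi>" "\<And>t. 0 \<le> \<psi> t" "\<And>t. \<psi> t \<le> 1" for V and \<phi> \<psi> :: "real \<Rightarrow> real"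
  proof -
    have borel: "\<phi> \<in> borel_measurable borel" "\<psi> \<in> borel_measurable borel"
      using \<phi>(1) \<psi>(1) by (auto intro: borel_measurable_continuous_onI)
    note [measurable] = borel
    have fm: "(\<lambda>\<omega>. \<phi> (Tm m \<omega>) * \<psi> (Q V m \<omega> / real (K m \<omega>))) \<in> borel_measurable M" for m
      by (rule borel_measurable_times, rule measurable_compose[OF Tm_m borel(1)], rule measurable_compose[OF ratio[OF V(1)] borel(2)])
    have b: "\<bar>\<phi> s * \<psi> r\<bar> \<le> 1" for s r
      using \<phi>(3,4)[of s] \<psi>(2,3)[of r] by (auto simp: abs_mult intro!: mult_le_one)
    have \<phi>c: "isCont \<phi> s" and \<psi>c: "isCont \<psi> s" for s using \<phi>(1) \<psi>(1) by (auto simp: continuous_on_eq_continuous_at)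
    have "(\<lambda>m. \<integral>\<omega>. \<phi> (Tm m \<omega>) * \<psi> (Q V m \<omega> / real (K m \<omega>)) \<partial>completion M)
      \<longlonglongrightarrow> (\<integral>\<omega>. \<phi> (S \<omega>) * \<psi> (Z \<omega> / S \<omega>) \<partial>completion M)"
    proof (rule integral_dominated_convergence[where w="\<lambda>_. 1"])
      show "(\<lambda>\<omega>. \<phi> (Tm m \<omega>) * \<psi> (Q V m \<omega> / real (K m \<omega>))) \<in> borel_measurable (completion M)" for m
        by (rule measurable_completion[OF fm])
      show "AE \<omega> in completion M. (\<lambda>m. \<phi> (Tm m \<omega>) * \<psi> (Q V m \<omega> / real (K m \<omega>))) \<longlonglongrightarrow> \<phi> (S \<omega>) * \<psi> (Z \<omega> / S \<omega>)"
      proof (rule AE_completion)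
        show "AE \<omega> in M. (\<lambda>m. \<phi> (Tm m \<omega>) * \<psi> (Q V m \<omega> / real (K m \<omega>))) \<longlonglongrightarrow> \<phi> (S \<omega>) * \<psi> (Z \<omega> / S \<omega>)"
          using S_lim V(2)
        proof eventually_elim
          case (elim \<omega>)
          have ph: "(\<lambda>m. \<phi> (Tm m \<omega>)) \<longlonglongrightarrow> \<phi> (S \<omega>)" by (rule isCont_tendsto_compose[OF \<phi>c elim(1)])
          show ?case
          proof (cases "S \<omega> = 0")
            case True
            have "(\<lambda>m. \<phi> (Tm m \<omega>) * \<psi> (Q V m \<omega> / real (K m \<omega>))) \<longlonglongrightarrow> 0"
            proof (rule tendsto_sandwich[OF _ _ tendsto_const])
              show "\<forall>\<^sub>F m in sequentially. \<phi> (Tm m \<omega>) * \<psi> (Q V m \<omega> / real (K m \<omega>)) \<le> \<phi> (Tm m \<omega>)"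
                using \<phi>(3) \<psi>(3) by (intro always_eventually allI mult_left_le) auto
              show "(\<lambda>m. \<phi> (Tm m \<omega>)) \<longlonglongrightarrow> 0" using ph True \<phi>(2) by simp
            qed (use \<phi>(3) \<psi>(2) in auto)
            then show ?thesis using True \<phi>(2) by simp
          next
            case False
            have "(\<lambda>m. Q V m \<omega> / 2 ^ m / Tm m \<omega>) \<longlonglongrightarrow> Z \<omega> / S \<omega>" by (rule tendsto_divide[OF elim(2,1) False])
            moreover have eqK: "Q V m \<omega> / 2 ^ m / Tm m \<omega> = Q V m \<omega> / real (K m \<omega>)" for m by (simp add: Tm_def)
            ultimately have "(\<lambda>m. Q V m \<omega> / real (K m \<omega>)) \<longlonglongrightarrow> Z \<omega> / S \<omega>" by (simp only: eqK)
            then show ?thesis by (intro tendsto_mult ph isCont_tendsto_compose[OF \<psi>c])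
          qed
        qed
      qed
      show "AE \<omega> in completion M. norm (\<phi> (Tm m \<omega>) * \<psi> (Q V m \<omega> / real (K m \<omega>))) \<le> 1" for m
        using b by auto
    qed auto
    then show ?thesis by (simp only: integral_completion[OF fm])
  qed
  have "indep_uniform (completion M) S (\<lambda>\<omega>. Z \<omega> / S \<omega>)"
  proof (rule indep_uniform_from_ramps[OF prob_space_completion Sm])
    show "(\<lambda>\<omega>. Z \<omega> / S \<omega>) \<in> borel_measurable (completion M)" by measurable
    fix n n' :: nat and a y :: real assume a: "0 \<le> a"
    let ?\<phi> = "ramp n a" and ?\<psi> = "ramp n' y"
    have \<phi>0: "?\<phi> 0 = 0" using a by (rule ramp_zero)
    have I0: "0 \<le> integral {0..1} ?\<psi>"
      by (intro integral_nonneg integrable_continuous_interval continuous_on_subset[OF ramp_continuous]) (auto simp: ramp_bounds)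
    have one: "continuous_on UNIV (\<lambda>_::real. 1::real)" by simp
    have mid: "(\<lambda>m. \<integral>\<omega>. ?\<phi> (Tm m \<omega>) \<partial>M) \<longlonglongrightarrow> (\<integral>\<omega>. ?\<phi> (S \<omega>) \<partial>completion M)"
      using conv[OF LU(2) Z_lim(1) ramp_continuous[of n a] \<phi>0 ramp_bounds one] by simp
    have int: "integrable M (\<lambda>\<omega>. ?\<phi> (Tm m \<omega>))" for m
      by (rule integrable_const_bound[where B=1]) (auto simp: ramp_bounds)
    have int2: "integrable M (\<lambda>\<omega>. ?\<phi> (Tm m \<omega>) * ?\<psi> (Q V m \<omega> / real (K m \<omega>)))" if "measurable_functional V" for V m
    proof (rule integrable_const_bound[where B=1])
      show "(\<lambda>\<omega>. ?\<phi> (Tm m \<omega>) * ?\<psi> (Q V m \<omega> / real (K m \<omega>))) \<in> borel_measurable M"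
        by (rule borel_measurable_times, rule measurable_compose[OF Tm_m ramp_borel], rule measurable_compose[OF ratio[OF that] ramp_borel])
      show "AE \<omega> in M. norm (?\<phi> (Tm m \<omega>) * ?\<psi> (Q V m \<omega> / real (K m \<omega>))) \<le> 1"
        using ramp_bounds by (auto simp: abs_mult intro!: mult_le_one)
    qed
    have nn1: "(\<integral>\<^sup>+\<omega>. ennreal (?\<phi> (Tm m \<omega>)) * ennreal (?\<psi> (Q V m \<omega> / real (K m \<omega>))) \<partial>M)
       = ennreal (\<integral>\<omega>. ?\<phi> (Tm m \<omega>) * ?\<psi> (Q V m \<omega> / real (K m \<omega>)) \<partial>M)" if "measurable_functional V" for V m
      using nn_integral_eq_integral[OF int2[OF that]] by (simp add: ramp_bounds ennreal_mult)
    have nn2: "(\<integral>\<^sup>+\<omega>. ennreal (?\<phi> (Tm m \<omega>)) \<partial>M) = ennreal (\<integral>\<omega>. ?\<phi> (Tm m \<omega>) \<partial>M)" for m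
      using nn_integral_eq_integral[OF int] by (simp add: ramp_bounds)
    have p: "0 \<le> (\<integral>\<omega>. ?\<phi> (Tm m \<omega>) \<partial>M)" for m by (simp add: ramp_bounds)
    have p2: "0 \<le> (\<integral>\<omega>. ?\<phi> (Tm m \<omega>) * ?\<psi> (Q V m \<omega> / real (K m \<omega>)) \<partial>M)" for V m
      by (simp add: ramp_bounds)
    note EB = expectation_bounds[OF LU, of ?\<phi> ?\<psi>, OF ramp_bounds(1) \<phi>0 ramp_mono ramp_continuous ramp_bounds(1)]
    have fold: "real (K m \<omega>) / 2 ^ m = Tm m \<omega>" "real (L (K m \<omega>) (skeleton m \<omega>)) = Q L m \<omega>"
      "real (U (K m \<omega>) (skeleton m \<omega>)) = Q U m \<omega>" for m \<omega> by (simp_all add: Tm_def Q_def)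
    have lo: "(\<integral>\<omega>. ?\<phi> (Tm m \<omega>) * ?\<psi> (Q L m \<omega> / real (K m \<omega>)) \<partial>M) \<le> integral {0..1} ?\<psi> * (\<integral>\<omega>. ?\<phi> (Tm m \<omega>) \<partial>M)" for m
    proof -
      have "ennreal (\<integral>\<omega>. ?\<phi> (Tm m \<omega>) * ?\<psi> (Q L m \<omega> / real (K m \<omega>)) \<partial>M) \<le> ennreal (integral {0..1} ?\<psi> * (\<integral>\<omega>. ?\<phi> (Tm m \<omega>) \<partial>M))"
        using EB(1)[of m] unfolding fold nn1[OF LU(2)] nn2 by (simp only: ennreal_mult[OF I0 p])
      then show ?thesis using I0 p by (subst (asm) ennreal_le_iff) auto
    qed
    have hi: "integral {0..1} ?\<psi> * (\<integral>\<omega>. ?\<phi> (Tm m \<omega>) \<partial>M) \<le> (\<integral>\<omega>. ?\<phi> (Tm m \<omega>) * ?\<psi> (Q U m \<omega> / real (K m \<omega>)) \<partial>M)" for m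
    proof -
      have "ennreal (integral {0..1} ?\<psi> * (\<integral>\<omega>. ?\<phi> (Tm m \<omega>) \<partial>M)) \<le> ennreal (\<integral>\<omega>. ?\<phi> (Tm m \<omega>) * ?\<psi> (Q U m \<omega> / real (K m \<omega>)) \<partial>M)"
        using EB(2)[of m] unfolding fold nn1[OF LU(3)] nn2 by (simp only: ennreal_mult[OF I0 p])
      then show ?thesis using p2 by (subst (asm) ennreal_le_iff) auto
    qed
    have l1: "(\<lambda>m. \<integral>\<omega>. ?\<phi> (Tm m \<omega>) * ?\<psi> (Q L m \<omega> / real (K m \<omega>)) \<partial>M) \<longlonglongrightarrow> (\<integral>\<omega>. ?\<phi> (S \<omega>) * ?\<psi> (Z \<omega> / S \<omega>) \<partial>completion M)"
      by (rule conv[OF LU(2) Z_lim(1)]) (auto simp: ramp_continuous \<phi>0 ramp_bounds)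
    have l2: "(\<lambda>m. \<integral>\<omega>. ?\<phi> (Tm m \<omega>) * ?\<psi> (Q U m \<omega> / real (K m \<omega>)) \<partial>M) \<longlonglongrightarrow> (\<integral>\<omega>. ?\<phi> (S \<omega>) * ?\<psi> (Z \<omega> / S \<omega>) \<partial>completion M)"
      by (rule conv[OF LU(3) Z_lim(2)]) (auto simp: ramp_continuous \<phi>0 ramp_bounds)
    have l3: "(\<lambda>m. integral {0..1} ?\<psi> * (\<integral>\<omega>. ?\<phi> (Tm m \<omega>) \<partial>M)) \<longlonglongrightarrow> integral {0..1} ?\<psi> * (\<integral>\<omega>. ?\<phi> (S \<omega>) \<partial>completion M)"
      by (intro tendsto_mult_left mid)
    show "(\<integral>\<omega>. ?\<phi> (S \<omega>) * ?\<psi> (Z \<omega> / S \<omega>) \<partial>completion M) = integral {0..1} ?\<psi> * (\<integral>\<omega>. ?\<phi> (S \<omega>) \<partial>completion M)"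
      by (rule antisym[OF LIMSEQ_le[OF l1 l3] LIMSEQ_le[OF l3 l2]]) (use lo hi in auto)
  qed
  then show "indep_uniform (completion M) (\<lambda>\<omega>. sigma_time (\<lambda>t. X t \<omega>)) (\<lambda>\<omega>. Y (\<lambda>t. X t \<omega>) / sigma_time (\<lambda>t. X t \<omega>))"
    unfolding S_def Z_def .
  show "(\<lambda>\<omega>. sigma_time (\<lambda>t. X t \<omega>)) \<in> borel_measurable (completion M)"
    and "(\<lambda>\<omega>. Y (\<lambda>t. X t \<omega>)) \<in> borel_measurable (completion M)"
    using Sm Zm unfolding S_def Z_def by auto
qed

lemma (in spectrally_negative) AE_nice_path: "AE \<omega> in M. nice_path (\<lambda>t. X t \<omega>)"
proof -
  interpret D: diffuse_levy M "\<lambda>t \<omega>. - X t \<omega>" by (rule diffuse_uminus)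
  have "AE \<omega> in M. \<forall>n::nat. \<exists>s. 0 < s \<and> s < 1 / real (Suc n) \<and> 0 < X s \<omega>"
    unfolding AE_all_countable by (intro allI immediately_positive) simp
  with AE_no_ties D.AE_no_ties D.AE_no_max_at_zero levels_null[of 0] show ?thesis
  proof eventually_elim
    case (elim \<omega>)
    have "\<exists>s. 0 < s \<and> s < \<eta> \<and> 0 < X s \<omega>" if \<eta>: "0 < \<eta>" for \<eta>
    proof -
      obtain n :: nat where "1 / real (Suc n) < \<eta>" using nat_approx_posE[OF \<eta>] by blast
      moreover obtain s where "0 < s" "s < 1 / real (Suc n)" "0 < X s \<omega>" using elim by blast
      ultimately show ?thesis by (meson less_trans)
    qed
    then show ?case using elim good by (simp add: nice_path_def)
  qed
qed

lemma levy_process_modification: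
  assumes "levy_process M X" and N: "N \<inter> space M \<in> null_sets M"
  shows "levy_process M (\<lambda>t \<omega>. if \<omega> \<in> N then t else X t \<omega>)"
proof -
  interpret levy_process M X by fact
  let ?X = "\<lambda>t \<omega>. if \<omega> \<in> N then t else X t \<omega>"
  have [measurable]: "Measurable.pred M (\<lambda>\<omega>. \<omega> \<in> N)"
    using N by (simp add: pred_def Int_def null_sets_def conj_commute)
  have ae: "AE \<omega> in M. \<omega> \<notin> N" using AE_not_in[OF N] AE_space by eventually_elim simp
  have m: "?X t \<in> borel_measurable M" if "0 \<le> t" for t
    using measurable_X[OF that] by measurable
  show ?thesis
  proof
    show "?X t \<in> borel_measurable M" if "0 \<le> t" for t by (rule m[OF that])
    show "AE \<omega> in M. ?X 0 \<omega> = 0" using start_zero by eventually_elim simp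
    show "AE \<omega> in M. cadlag (\<lambda>t. ?X t \<omega>)" using cadlag_paths ae by eventually_elim simp
  next
    fix n :: nat and t :: "nat \<Rightarrow> real" assume t: "0 \<le> t 0" "\<And>i. i < n \<Longrightarrow> t i \<le> t (Suc i)"
    have t0: "0 \<le> t i" if "i \<le> n" for i using that by (induction i) (use t in \<open>auto intro: order_trans\<close>)
    let ?d = "\<lambda>i \<omega>. X (t (Suc i)) \<omega> - X (t i) \<omega>" and ?d' = "\<lambda>i \<omega>. ?X (t (Suc i)) \<omega> - ?X (t i) \<omega>"
    have md: "?d i \<in> borel_measurable M" "?d' i \<in> borel_measurable M" if "i < n" for i
      using that t0 by (auto intro!: borel_measurable_diff measurable_X m simp del: if_split)
    show "indep_vars (\<lambda>_. borel) ?d' {..<n}"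
    proof (cases "n = 0")
      case True then show ?thesis by (simp add: indep_vars_def indep_sets_def)
    next
      case False
      have "distr M (PiM {..<n} (\<lambda>_. borel)) (\<lambda>\<omega>. \<lambda>i\<in>{..<n}. ?d' i \<omega>) = distr M (PiM {..<n} (\<lambda>_. borel)) (\<lambda>\<omega>. \<lambda>i\<in>{..<n}. ?d i \<omega>)"
      proof (rule distr_cong_AE)
        show "AE \<omega> in M. (\<lambda>i\<in>{..<n}. ?d' i \<omega>) = (\<lambda>i\<in>{..<n}. ?d i \<omega>)" using ae by eventually_elim simp
      qed (use md in \<open>auto intro!: measurable_restrict simp del: if_split\<close>)
      also have "\<dots> = PiM {..<n} (\<lambda>i. distr M borel (?d i))"
      proof -
        have "indep_vars (\<lambda>_. borel) ?d {..<n}" by (rule indep_increments) (use t in auto)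
        then show ?thesis using False md by (subst (asm) indep_vars_iff_distr_eq_PiM') auto
      qed
      also have "\<dots> = PiM {..<n} (\<lambda>i. distr M borel (?d' i))"
      proof (intro PiM_cong refl distr_cong_AE)
        fix i assume "i \<in> {..<n}"
        show "AE \<omega> in M. ?d i \<omega> = ?d' i \<omega>" using ae by eventually_elim simp
      qed (use md in auto)
      finally show ?thesis using False md by (subst indep_vars_iff_distr_eq_PiM') auto
    qed
  next
    fix s t :: real assume st: "0 \<le> s" "s \<le> t"
    have "distr M borel (\<lambda>\<omega>. ?X t \<omega> - ?X s \<omega>) = distr M borel (\<lambda>\<omega>. X t \<omega> - X s \<omega>)"
      using st ae by (intro distr_cong_AE) (auto intro!: borel_measurable_diff measurable_X m simp del: if_split elim!: eventually_mono)
    also have "\<dots> = distr M borel (X (t - s))" by (rule stationary_increments[OF st])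
    also have "\<dots> = distr M borel (?X (t - s))"
      using st ae by (intro distr_cong_AE) (auto intro!: measurable_X m simp del: if_split elim!: eventually_mono)
    finally show "distr M borel (\<lambda>\<omega>. ?X t \<omega> - ?X s \<omega>) = distr M borel (?X (t - s))" .
  qed
qed

lemma good_path_identity: "good_path (\<lambda>t. t)"
proof -
  have "Lim (at_left t) (\<lambda>t::real. t) = t" for t :: real by (intro tendsto_Lim) (auto intro: tendsto_ident_at)
  then show ?thesis
    by (auto simp: good_path_def cadlag_def filterlim_ident intro: tendsto_ident_at)
qed

text \<open>Exceptional paths are replaced by the identity, which has every property required of a good
  path, so that path properties may be assumed everywhere.\<close>

lemma levy_process_AE_version:
  assumes levy: "levy_process M X" and P: "AE \<omega> in M. P (\<lambda>t. X t \<omega>)" and Pid: "P (\<lambda>t. t)"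
  obtains X' where "levy_process M X'" "\<And>\<omega>. P (\<lambda>t. X' t \<omega>)" "AE \<omega> in M. (\<lambda>t. X' t \<omega>) = (\<lambda>t. X t \<omega>)"
proof -
  obtain N where N: "N \<in> null_sets M" "\<And>\<omega>. \<omega> \<in> space M - N \<Longrightarrow> P (\<lambda>t. X t \<omega>)"
    using AE_E3[OF P] by auto
  \<comment> \<open>outside \<open>space M\<close> nothing is known about \<open>X\<close>, yet the version is to be good for every \<open>\<omega>\<close>\<close>
  define B where "B = N \<union> - space M"
  have "B \<inter> space M = N" using sets.sets_into_space[of N M] N(1) by (auto simp: B_def)
  then have B: "B \<inter> space M \<in> null_sets M" using N(1) by simp
  show ?thesis
  proof (rule that[of "\<lambda>t \<omega>. if \<omega> \<in> B then t else X t \<omega>"])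
    show "levy_process M (\<lambda>t \<omega>. if \<omega> \<in> B then t else X t \<omega>)" by (rule levy_process_modification[OF levy B])
    show "P (\<lambda>t. if \<omega> \<in> B then t else X t \<omega>)" for \<omega>
      using N(2)[of \<omega>] Pid by (cases "\<omega> \<in> B") (auto simp: B_def)
    show "AE \<omega> in M. (\<lambda>t. if \<omega> \<in> B then t else X t \<omega>) = (\<lambda>t. X t \<omega>)"
      using AE_not_in[OF B] AE_space by eventually_elim simp
  qed
qed

lemma spectrally_negative_version:
  assumes levy: "levy_process M X" and jumps: "no_positive_jumps M X"
    and mean: "0 < prob_space.expectation M (X 1)"
  obtains X' where "spectrally_negative M X'" "AE \<omega> in M. (\<lambda>t. X' t \<omega>) = (\<lambda>t. X t \<omega>)"
proof -
  interpret levy_process M X by fact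
  let ?P = "\<lambda>x::real\<Rightarrow>real. cadlag x \<and> x 0 = 0 \<and> (\<forall>t>0. x t \<le> Lim (at_left t) x)"
  have "AE \<omega> in M. ?P (\<lambda>t. X t \<omega>)"
    using start_zero cadlag_paths jumps unfolding no_positive_jumps_def jump_def by eventually_elim auto
  moreover have "?P (\<lambda>t. t)" using good_path_identity by (simp add: good_path_def)
  ultimately obtain X1 where X1: "levy_process M X1" "\<And>\<omega>. ?P (\<lambda>t. X1 t \<omega>)" "AE \<omega> in M. (\<lambda>t. X1 t \<omega>) = (\<lambda>t. X t \<omega>)"
    using levy_process_AE_version[OF levy, of ?P] by blast
  interpret X1: cadlag_levy M X1
    using X1(1,2) by (intro cadlag_levy.intro cadlag_levy_axioms.intro) auto
  have "expectation (X1 1) = expectation (X 1)"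
    using X1(3) by (intro integral_cong_AE measurable_X X1.measurable_X) (auto elim!: eventually_mono dest: fun_cong)
  then have "AE \<omega> in M. filterlim (\<lambda>t. X1 t \<omega>) at_top at_top" using mean by (intro X1.tendsto_infinity) simp
  then have "AE \<omega> in M. good_path (\<lambda>t. X1 t \<omega>)"
    by eventually_elim (use X1(2) in \<open>simp add: good_path_def\<close>)
  then obtain X2 where X2: "levy_process M X2" "\<And>\<omega>. good_path (\<lambda>t. X2 t \<omega>)" "AE \<omega> in M. (\<lambda>t. X2 t \<omega>) = (\<lambda>t. X1 t \<omega>)"
    using levy_process_AE_version[OF X1(1), of good_path] good_path_identity by blast
  show ?thesis
  proof (rule that)
    show "spectrally_negative M X2"
      using X2(1,2) by (intro spectrally_negative.intro spectrally_negative_axioms.intro cadlag_levy.intro cadlag_levy_axioms.intro)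
        (auto simp: good_path_def)
    show "AE \<omega> in M. (\<lambda>t. X2 t \<omega>) = (\<lambda>t. X t \<omega>)" using X2(3) X1(3) by eventually_elim simp
  qed
qed

theorem mainTheorem3:
  fixes M :: "'a measure" and X :: "real \<Rightarrow> 'a \<Rightarrow> real"
  assumes "levy_process M X"
    and "no_positive_jumps M X"
    and "0 < prob_space.expectation M (X 1)"
  shows "(AE \<omega> in M. bdd_above (nonpos_times (\<lambda>t. X t \<omega>))) \<and>
    (\<forall>Y\<in>{F_right, F_left, G_right, G_left, N_minus, N_plus}.
       cond_distr_on (completion M) (\<lambda>\<omega>. Y (\<lambda>t. X t \<omega>)) (\<lambda>\<omega>. sigma_time (\<lambda>t. X t \<omega>))
         {0<..} (\<lambda>t. uniform_measure lborel {0..t}))"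
proof -
  obtain Z where "spectrally_negative M Z" and eq: "AE \<omega> in M. (\<lambda>t. Z t \<omega>) = (\<lambda>t. X t \<omega>)"
    using spectrally_negative_version[OF assms] .
  then interpret Z: spectrally_negative M Z by simp
  note nice = Z.AE_nice_path
  let ?N = "completion M"
  let ?S = "\<lambda>\<omega>. sigma_time (\<lambda>t. X t \<omega>)" and ?S' = "\<lambda>\<omega>. sigma_time (\<lambda>t. Z t \<omega>)"
  have pN: "prob_space ?N" by (rule Z.prob_space_completion)
  have eqN: "AE \<omega> in ?N. (\<lambda>t. X t \<omega>) = (\<lambda>t. Z t \<omega>)"
    by (rule AE_completion) (use eq in eventually_elim, simp)
  have niceN: "AE \<omega> in ?N. nice_path (\<lambda>t. X t \<omega>)"
    using AE_completion[OF nice] eqN by eventually_elim simp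
  let ?m = "\<lambda>Y. (\<lambda>\<omega>. Y (\<lambda>t. Z t \<omega>) :: real) \<in> borel_measurable ?N"
    and ?i = "\<lambda>Y. indep_uniform ?N ?S' (\<lambda>\<omega>. Y (\<lambda>t. Z t \<omega>) / ?S' \<omega>)"
  note argmax_measurable_neg = measurable_functional_argmax[THEN measurable_functional_uminus]
  have G: "?S' \<in> borel_measurable ?N" "?m G_right" "?i G_right"
    by (rule Z.functional_indep_uniform[OF nice argmax_cyclically_uniform measurable_functional_argmax];
        erule skeleton_G_right)+
  have F: "?m F_right" "?i F_right"
    by (rule Z.functional_indep_uniform[OF nice cyclically_uniform_uminus[OF argmax_cyclically_uniform] argmax_measurable_neg];
        erule skeleton_F_right)+
  have N: "?m N_minus" "?i N_minus"
    by (rule Z.functional_indep_uniform[OF nice rank_cyclically_uniform measurable_functional_rank];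
        erule skeleton_rank)+
  have Sm: "?S \<in> borel_measurable ?N"
    by (rule completion_measurable_AE[OF G(1)]) (use eqN in eventually_elim, simp)
  have transfer: "(\<lambda>\<omega>. Y (\<lambda>t. X t \<omega>)) \<in> borel_measurable ?N \<and> indep_uniform ?N ?S (\<lambda>\<omega>. Y (\<lambda>t. X t \<omega>) / ?S \<omega>)"
    if Y: "(\<lambda>\<omega>. Y (\<lambda>t. Z t \<omega>)) \<in> borel_measurable ?N" "indep_uniform ?N ?S' (\<lambda>\<omega>. Y (\<lambda>t. Z t \<omega>) / ?S' \<omega>)" for Y
  proof
    show Ym: "(\<lambda>\<omega>. Y (\<lambda>t. X t \<omega>)) \<in> borel_measurable ?N"
      by (rule completion_measurable_AE[OF Y(1)]) (use eqN in eventually_elim, simp)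
    show "indep_uniform ?N ?S (\<lambda>\<omega>. Y (\<lambda>t. X t \<omega>) / ?S \<omega>)"
    proof (rule indep_uniform_cong_AE[OF Sm _ G(1) _ _ Y(2)])
      show "AE \<omega> in ?N. ?S \<omega> = ?S' \<omega> \<and> (0 < ?S \<omega> \<longrightarrow> Y (\<lambda>t. X t \<omega>) / ?S \<omega> = Y (\<lambda>t. Z t \<omega>) / ?S' \<omega>)"
        using eqN by eventually_elim simp
    qed (use Ym Y(1) Sm G(1) in measurable)
  qed
  have reflect: "cond_distr_on ?N (\<lambda>\<omega>. Y' (\<lambda>t. X t \<omega>)) ?S {0<..} (\<lambda>t. uniform_measure lborel {0..t})"
    if Y: "(\<lambda>\<omega>. Y (\<lambda>t. X t \<omega>)) \<in> borel_measurable ?N \<and> indep_uniform ?N ?S (\<lambda>\<omega>. Y (\<lambda>t. X t \<omega>) / ?S \<omega>)"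
      and Y': "AE \<omega> in ?N. Y' (\<lambda>t. X t \<omega>) = ?S \<omega> - Y (\<lambda>t. X t \<omega>)" for Y Y'
  proof (rule cond_distr_on_uniform[OF pN Sm])
    have Ym: "(\<lambda>\<omega>. Y (\<lambda>t. X t \<omega>)) \<in> borel_measurable ?N" using Y by simp
    have d: "(\<lambda>\<omega>. ?S \<omega> - Y (\<lambda>t. X t \<omega>)) \<in> borel_measurable ?N" using Sm Ym by measurable
    show Y'm: "(\<lambda>\<omega>. Y' (\<lambda>t. X t \<omega>)) \<in> borel_measurable ?N" by (rule completion_measurable_AE[OF d Y'])
    show "indep_uniform ?N ?S (\<lambda>\<omega>. Y' (\<lambda>t. X t \<omega>) / ?S \<omega>)"
    proof (rule indep_uniform_cong_AE[OF Sm _ Sm _ _ indep_uniform_reflect[OF conjunct2[OF Y]]])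
      show "AE \<omega> in ?N. ?S \<omega> = ?S \<omega> \<and> (0 < ?S \<omega> \<longrightarrow> Y' (\<lambda>t. X t \<omega>) / ?S \<omega> = 1 - Y (\<lambda>t. X t \<omega>) / ?S \<omega>)"
        using Y' by eventually_elim (simp add: diff_divide_distrib)
    qed (use Ym Y'm Sm in measurable)
  qed
  have direct: "cond_distr_on ?N (\<lambda>\<omega>. Y (\<lambda>t. X t \<omega>)) ?S {0<..} (\<lambda>t. uniform_measure lborel {0..t})"
    if Y: "(\<lambda>\<omega>. Y (\<lambda>t. X t \<omega>)) \<in> borel_measurable ?N \<and> indep_uniform ?N ?S (\<lambda>\<omega>. Y (\<lambda>t. X t \<omega>) / ?S \<omega>)" for Y
    using Y by (intro cond_distr_on_uniform[OF pN Sm]) auto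
  note FX = transfer[OF F] and GX = transfer[OF G(2,3)] and NX = transfer[OF N]
  have "AE \<omega> in M. bdd_above (nonpos_times (\<lambda>t. X t \<omega>))"
    using eq
  proof eventually_elim
    case (elim \<omega>) then show ?case using bdd_nonpos_times[OF Z.good[of \<omega>]] by simp
  qed
  moreover have "cond_distr_on ?N (\<lambda>\<omega>. F_left (\<lambda>t. X t \<omega>)) ?S {0<..} (\<lambda>t. uniform_measure lborel {0..t})"
    by (rule reflect[OF FX]) (simp add: F_left_def)
  moreover have "cond_distr_on ?N (\<lambda>\<omega>. G_left (\<lambda>t. X t \<omega>)) ?S {0<..} (\<lambda>t. uniform_measure lborel {0..t})"
    by (rule reflect[OF GX]) (simp add: G_left_def)
  moreover have "cond_distr_on ?N (\<lambda>\<omega>. N_plus (\<lambda>t. X t \<omega>)) ?S {0<..} (\<lambda>t. uniform_measure lborel {0..t})"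
    by (rule reflect[OF NX]) (use niceN in eventually_elim, rule N_plus_minus)
  ultimately show ?thesis using direct[OF FX] direct[OF GX] direct[OF NX] by blast
qed

end
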